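(* Let $n_1\asymp\cdots\asymp n_d\asymp n^{1/d}$, let $k\ge1$ be a fixed integer with $k\le\min_{i}n_i-1$, and let $H(d)=\sum_{i=1}^d1/i$. For $M\in\mathcal P[d]\setminus\{\emptyset\}$ and $h\in[k]^{d-|M|}$ let $c_{M,h}>0$ be constants of order $\mathcal O(1)$. Choose the tuning parameters $\lambda_{M,h}=\lambda$ with $$\lambda\asymp n^{-\frac{H(d)+2k-1}{2H(d)+2k-1}}\log^{\frac{H(d)}{2H(d)+2k-1}}(n).$$ Then, with probability at least $1-\Theta(1/n)$, it holds that $$\frac{\|\hat f-f^0\|_2^2}{n}\le\sum_{\substack{M\in\mathcal P[d]\setminus\{\emptyset\}\\ h\in[k]^{d-|M|}}}\ \min_{\substack{\bar{\mathrm f}_{\mathcal M(M,h)}:\\ \|D_M^k\bar{\mathrm f}_{\mathcal M(M,h)}\|_1\le c_{M,h}}}\frac{\|\bar f^0_{\mathcal M(M,h)}-\bar{\mathrm f}_{\mathcal M(M,h)}\|_2^2}{n_M}+\mathcal O\!\left(n^{-\frac{H(d)+2k-1}{2H(d)+2k-1}}\log^{\frac{H(d)}{2H(d)+2k-1}}n\right).$$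
   Context: Notation: $[i:j]=\{i,\dots,j\}$, $[j]=[1:j]$, $\mathcal P[d]$ is the power set of $[d]$. $\|a\|_2$ is the Frobenius norm, $\|a\|_1$ the sum of absolute entries. For vectors (or lower-dimensional tensors) $\times$ denotes the outer product: $(f_1\times\cdots\times f_d)(j_1,\dots,j_d)=\prod_if_i(j_i)$, factors being placed in their own coordinates. Model: $Y=f^0+\epsilon$ in $\mathbb{R}^{n_1\times\cdots\times n_d}$, $n=n_1\cdots n_d$, $f^0$ fixed, $\epsilon$ with i.i.d. $\mathcal N(0,\sigma^2)$ entries, $\sigma\in(0,\infty)$ known. One-dimensional dictionary (for length $N$; used with $N=n_i$ for coordinate $i$): $\phi^1_j=\{1_{\{j'\ge j\}}\}_{j'\in[N]}$; for $k\ge2$, $\phi^k_j=\phi^j_j$ if $j\in[k-1]$ and $\phi^k_j=\sum_{l\ge j}\phi^{k-1}_l/N$ if $j\in[k:N]$. With $\mathrm A_{W}$ the orthogonal projection onto the orthogonal complement of $\mathrm{span}(W)$: $\tilde\phi^k_j=\sqrt N\,\mathrm A_{\{\phi_l^l,l\in[j-1]\}}\phi^j_j/\|\mathrm A_{\{\phi_l^l,l\in[j-1]\}}\phi^j_j\|_2$ for $j\in[k]$, and $\tilde\phi^k_j=\mathrm A_{\{\phi^l_l,l\in[k]\}}\phi^k_j$ for $j\in[k+1:N]$. In $d$ dimensions $\tilde\phi^k_{j_1,\dots,j_d}=\tilde\phi^k_{j_1}\times\cdots\times\tilde\phi^k_{j_d}$. ANOVA decomposition: for $M\in\mathcal P[d]$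 and $h=(h_i)_{i\notin M}\in[k]^{d-|M|}$ let $I^k_{M,h}$ be the set of indices $(k_1,\dots,k_d)$ with $k_i\in[k+1:n_i]$ for $i\in M$ and $k_i=h_i$ for $i\notin M$, and $\mathcal M(M,h)=\mathrm{span}\{\tilde\phi^k_{k_1,\dots,k_d}:(k_1,\dots,k_d)\in I^k_{M,h}\}$. These spaces are mutually orthogonal and sum to $\mathbb{R}^{n_1\times\cdots\times n_d}$. $f_{\mathcal M(M,h)}$ is the orthogonal projection of $f$ onto $\mathcal M(M,h)$; it has the form $f_{\mathcal M(M,h)}=\bar f_{\mathcal M(M,h)}\times(\times_{i\notin M}\tilde\phi^k_{h_i})$ with $\bar f_{\mathcal M(M,h)}\in\mathbb{R}^{\times_{i\in M}n_i}$ (a scalar if $M=\emptyset$). Similarly for $Y$ and $f^0$. The tensors $\bar{\mathrm f}_{\mathcal M(M,h)}$ range over $\mathrm{span}\{\times_{i\in M}\tilde\phi^k_{k_i}:k_i\in[k+1:n_i]\}$. Put $n_M=\prod_{i\in M}n_i$. Estimator: let $D^k_M=\prod_{i\in M}D^k_i$, where $(D_i^kf)(\dots,j_i,\dots)=n_i^{k-1}\sum_{l=0}^k(-1)^l\binom kl f(\dots,j_i-l,\dots)$, $j_i\in[k+1:n_i]$. Then $\hat f=\sum_{M\in\mathcal P[d]}\sum_{h\in[k]^{d-|M|}}\hat f_{\mathcal M(M,h)}$ with $\hat f_{\mathcal M(\emptyset,h)}=Y_{\mathcal M(\emptyset,h)}$ and, for $M\ne\emptyset$, $\hat f_{\mathcal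 M(M,h)}=\hat{\bar f}_{\mathcal M(M,h)}\times(\times_{i\notin M}\tilde\phi^k_{h_i})$, where $$\hat{\bar f}_{\mathcal M(M,h)}=\arg\min_{\bar{\mathrm f}_{\mathcal M(M,h)}}\left\{\|\bar Y_{\mathcal M(M,h)}-\bar{\mathrm f}_{\mathcal M(M,h)}\|_2^2/n_M+2\lambda_{M,h}\|D_M^k\bar{\mathrm f}_{\mathcal M(M,h)}\|_1\right\}.$$ Asymptotics are for $n\to\infty$ with $k,d,\sigma$ fixed; implied constants may depend on $k,d,\sigma$, the $c_{M,h}$, and the constants in $n_i\asymp n^{1/d}$. *)

theory Defs
  imports "HOL-Probability.Probability" "HOL-Library.Function_Algebras"
begin

text \<open>
  Vectors and tensors are real functions that vanish off a finite index set. Sums and differences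
  of such functions are the pointwise ones of \<^theory>\<open>HOL-Library.Function_Algebras\<close>.
\<close>

global_interpretation fun_vs: vector_space "\<lambda>(r::real) (f::'a \<Rightarrow> real) x. r * f x"
  by unfold_locales (auto simp: algebra_simps fun_eq_iff)

text \<open>
  Orthogonal projection onto the span of W, for the Euclidean inner product over the index set J.
  Only the values of f on J matter; W is assumed to consist of functions vanishing off J.
\<close>

definition orth_proj :: "'a set \<Rightarrow> ('a \<Rightarrow> real) set \<Rightarrow> ('a \<Rightarrow> real) \<Rightarrow> 'a \<Rightarrow> real" where
  "orth_proj J W f =
     (THE p. p \<in> fun_vs.span W \<and> (\<forall>w\<in>fun_vs.span W. (\<Sum>j\<in>J. (f j - p j) * w j) = 0))"

definition anti_proj :: "'a set \<Rightarrow> ('a \<Rightarrow> real) set \<Rightarrow> ('a \<Rightarrow> real) \<Rightarrow> 'a \<Rightarrow> real" where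
  "anti_proj J W f = f - orth_proj J W f"

text \<open>\<open>phi N k j\<close> is meant for \<open>1 \<le> k\<close> and \<open>1 \<le> j \<le> N\<close>.\<close>

fun phi :: "nat \<Rightarrow> nat \<Rightarrow> nat \<Rightarrow> nat \<Rightarrow> real" where
  "phi N k j =
     (if k \<le> 1 then (\<lambda>j'. if j \<le> j' \<and> j' \<le> N then 1 else 0)
      else if j \<le> k - 1 then phi N j j
      else (\<lambda>j'. (\<Sum>l=j..N. phi N (k - 1) l j') / real N))"

declare phi.simps [simp del]

definition phit :: "nat \<Rightarrow> nat \<Rightarrow> nat \<Rightarrow> nat \<Rightarrow> real" where
  "phit N k j =
     (if j \<le> k
      then (let v = anti_proj {1..N} {phi N l l | l. l \<in> {1..j - 1}} (phi N j j)
            in (\<lambda>j'. sqrt (real N) * v j' / L2_set v {1..N}))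
      else anti_proj {1..N} {phi N l l | l. l \<in> {1..k}} (phi N k j))"

text \<open>
  A multi-index over a set K of coordinates is a function in \<open>PiE K\<close>; coordinates i and entries
  \<open>j i\<close> are counted from 1, and \<open>n i\<close> is the length of the tensor in direction i. For \<open>K = {}\<close> there
  is exactly one multi-index, so that tensors over \<open>{}\<close> are scalars.
\<close>

type_synonym idx = "nat \<Rightarrow> nat"
type_synonym tensor = "idx \<Rightarrow> real"

definition ibox :: "idx \<Rightarrow> nat set \<Rightarrow> idx set" where
  "ibox n K = PiE K (\<lambda>i. {1..n i})"

definition tensors :: "idx \<Rightarrow> nat set \<Rightarrow> tensor set" where
  "tensors n K = {f. \<forall>j. j \<notin> ibox n K \<longrightarrow> f j = 0}"

definition phit_tensor :: "idx \<Rightarrow> nat \<Rightarrow> nat set \<Rightarrow> idx \<Rightarrow> tensor" where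
  "phit_tensor n k K q =
     (\<lambda>j. if j \<in> ibox n K then (\<Prod>i\<in>K. phit (n i) k (q i) (j i)) else 0)"

text \<open>
  Outer product of g, placed in the coordinates M, with the vectors \<open>phit (n i) k (h i)\<close> in the
  remaining coordinates of \<open>{1..d}\<close>.
\<close>

definition fill :: "nat \<Rightarrow> idx \<Rightarrow> nat \<Rightarrow> nat set \<Rightarrow> idx \<Rightarrow> tensor \<Rightarrow> tensor" where
  "fill d n k M h g =
     (\<lambda>j. if j \<in> ibox n {1..d}
          then g (restrict j M) * (\<Prod>i\<in>{1..d} - M. phit (n i) k (h i) (j i)) else 0)"

definition anova_idx :: "nat \<Rightarrow> idx \<Rightarrow> nat \<Rightarrow> nat set \<Rightarrow> idx \<Rightarrow> idx set" where
  "anova_idx d n k M h = PiE {1..d} (\<lambda>i. if i \<in> M then {k + 1..n i} else {h i})"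

definition anova_proj :: "nat \<Rightarrow> idx \<Rightarrow> nat \<Rightarrow> nat set \<Rightarrow> idx \<Rightarrow> tensor \<Rightarrow> tensor" where
  "anova_proj d n k M h f =
     orth_proj (ibox n {1..d}) (phit_tensor n k {1..d} ` anova_idx d n k M h) f"

definition anova_bar :: "nat \<Rightarrow> idx \<Rightarrow> nat \<Rightarrow> nat set \<Rightarrow> idx \<Rightarrow> tensor \<Rightarrow> tensor" where
  "anova_bar d n k M h f =
     (THE g. g \<in> tensors n M \<and> anova_proj d n k M h f = fill d n k M h g)"

definition bar_space :: "idx \<Rightarrow> nat \<Rightarrow> nat set \<Rightarrow> tensor set" where
  "bar_space n k M = fun_vs.span (phit_tensor n k M ` PiE M (\<lambda>i. {k + 1..n i}))"

definition h_range :: "nat \<Rightarrow> nat \<Rightarrow> nat set \<Rightarrow> idx set" where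
  "h_range d k M = PiE ({1..d} - M) (\<lambda>_. {1..k})"

definition D_coord :: "idx \<Rightarrow> nat \<Rightarrow> nat \<Rightarrow> tensor \<Rightarrow> tensor" where
  "D_coord n k i f =
     (\<lambda>j. if j i \<in> {k + 1..n i}
          then real (n i) ^ (k - 1) *
               (\<Sum>l=0..k. (-1) ^ l * real (k choose l) * f (j(i := j i - l)))
          else 0)"

text \<open>The operators \<open>D_coord n k i\<close> commute, so the order of composition is immaterial.\<close>

definition D_set :: "idx \<Rightarrow> nat \<Rightarrow> nat set \<Rightarrow> tensor \<Rightarrow> tensor" where
  "D_set n k M f = foldr (D_coord n k) (sorted_list_of_set M) f"

definition D_norm1 :: "idx \<Rightarrow> nat \<Rightarrow> nat set \<Rightarrow> tensor \<Rightarrow> real" where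
  "D_norm1 n k M f = (\<Sum>j\<in>PiE M (\<lambda>i. {k + 1..n i}). \<bar>D_set n k M f j\<bar>)"

definition numel :: "idx \<Rightarrow> nat set \<Rightarrow> nat" where
  "numel n M = (\<Prod>i\<in>M. n i)"

text \<open>Squared Frobenius norm of \<open>f - g\<close>, divided by the number of entries.\<close>

definition mse :: "idx \<Rightarrow> nat set \<Rightarrow> tensor \<Rightarrow> tensor \<Rightarrow> real" where
  "mse n M f g = (L2_set (f - g) (ibox n M))\<^sup>2 / real (numel n M)"

text \<open>The minimizer is unique, since the objective is strictly convex on \<open>bar_space n k M\<close>.\<close>

definition bar_est :: "nat \<Rightarrow> idx \<Rightarrow> nat \<Rightarrow> real \<Rightarrow> nat set \<Rightarrow> idx \<Rightarrow> tensor \<Rightarrow> tensor" where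
  "bar_est d n k lam M h Y =
     arg_min_on (\<lambda>g. mse n M (anova_bar d n k M h Y) g + 2 * lam * D_norm1 n k M g)
       (bar_space n k M)"

definition tf_estimator ::
  "nat \<Rightarrow> idx \<Rightarrow> nat \<Rightarrow> (nat set \<Rightarrow> idx \<Rightarrow> real) \<Rightarrow> tensor \<Rightarrow> tensor" where
  "tf_estimator d n k lam Y =
     (\<Sum>M\<in>Pow {1..d}. \<Sum>h\<in>h_range d k M.
        if M = {} then anova_proj d n k M h Y
        else fill d n k M h (bar_est d n k (lam M h) M h Y))"

text \<open>
  The infimum is a minimum: the feasible set is closed, convex and contains 0, inside a
  finite-dimensional space.
\<close>

definition oracle_err :: "nat \<Rightarrow> idx \<Rightarrow> nat \<Rightarrow> nat set \<Rightarrow> idx \<Rightarrow> real \<Rightarrow> tensor \<Rightarrow> real" where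
  "oracle_err d n k M h c f =
     (INF g\<in>{g \<in> bar_space n k M. D_norm1 n k M g \<le> c}. mse n M (anova_bar d n k M h f) g)"

definition gaussian_noise ::
  "'w measure \<Rightarrow> real \<Rightarrow> idx set \<Rightarrow> (idx \<Rightarrow> 'w \<Rightarrow> real) \<Rightarrow> bool" where
  "gaussian_noise \<Omega> \<sigma> J eps \<longleftrightarrow>
     prob_space \<Omega> \<and>
     prob_space.indep_vars \<Omega> (\<lambda>_. borel) eps J \<and>
     (\<forall>j\<in>J. distributed \<Omega> lborel (eps j) (\<lambda>x. ennreal (normal_density 0 \<sigma> x)))"

definition rate :: "nat \<Rightarrow> nat \<Rightarrow> nat \<Rightarrow> real" where
  "rate d k N =
     (let H = (harm d :: real) in
      real N powr (- ((H + 2 * real k - 1) / (2 * H + 2 * real k - 1))) *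
      ln (real N) powr (H / (2 * H + 2 * real k - 1)))"

end

theory Submission
  imports Defs
begin

text \<open>
  Optimality of the penalized fit and of any competitor \<open>g\<close> in one ANOVA component give
  \<open>|fit - f0|^2 + |fit - g|^2 \<le> |g - f0|^2 + 2 <eps, fit - g> + 2 n lam (|D g| - |D fit|)\<close>. Split the noise
  along a subspace \<open>S\<close>: the part in \<open>S\<close> costs \<open>|P_S eps|^2 + |fit - g|^2\<close>, and, since an element of the
  component is the combination of dictionary tensors with coefficients \<open>D g\<close>, the part orthogonal to
  \<open>S\<close> costs at most \<open>2 n lam (|D fit| + |D g|)\<close> as soon as the noise correlates with no dictionary
  residual by more than \<open>n lam\<close>. What remains is \<open>|P_S eps|^2 + 4 n lam |D g|\<close>.

  The same \<open>S\<close> serves all components. A truncated power function is a polynomial off the block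
  containing its knot, so dyadic blocks split each dictionary vector into levels \<open>l\<close> of norm
  \<open>2^(-(k - 1/2) l)\<close> living in spaces of dimension \<open>O(2^l)\<close>; \<open>S\<close> is the hyperbolic cross of all level
  vectors with sum at most \<open>L\<close>. For \<open>d = 1\<close> this attains the exponent \<open>(k - 1/2) / H(d)\<close> exactly, and
  for \<open>d \<ge> 2\<close> the usual logarithmic factors of the hyperbolic cross are absorbed because \<open>H(d) > 1\<close>.
\<close>

section \<open>Inner products and projections\<close>

text \<open>The balance behind the exponent: let N be the number of entries, g = k - 1/2, H = H(d),
  and let \<open>S\<close> have dimension of order X. If the squared dictionary residuals are of
  order N X^(-2g/H), a union bound over N Gaussian forms needs (N lam)^2 of order N ln N X^(-2g/H);
  equating N lam with X gives X^(2 + 2g/H) = N ln N, and the rate is X / N. Only the ratio g/H of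
  error exponent to dimension exponent matters, and it is split symmetrically into sqrt H for the
  dimension and g / sqrt H for the error. The constant in front of \<open>lam\<close> is prescribed
  and may be small, hence \<open>S\<close> is enlarged by a constant factor until the residuals fall
  below the threshold. The component with M = {} carries no penalty, so the basic inequality says
  nothing about it; it is controlled by the same residual condition, which is imposed on the
  dictionary tensors with low indices as well. A further obstacle is measurability: the probability
  of the event can be bounded below only if the event is measurable, although the estimator is given
  by a choice of minimizer. This is derived from the nonexpansiveness of the penalized fit.\<close>

definition ip :: "'a set \<Rightarrow> ('a \<Rightarrow> real) \<Rightarrow> ('a \<Rightarrow> real) \<Rightarrow> real" where
  "ip J f g = (\<Sum>j\<in>J. f j * g j)"

definition scal :: "real \<Rightarrow> ('a \<Rightarrow> real) \<Rightarrow> 'a \<Rightarrow> real" where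
  "scal r f = (\<lambda>x. r * f x)"

text \<open>\<open>ip J\<close> is only semidefinite on all functions; on \<open>supp_on J\<close>
  it is definite, which every uniqueness argument below relies on.\<close>

definition supp_on :: "'a set \<Rightarrow> ('a \<Rightarrow> real) set" where
  "supp_on J = {f. \<forall>j. j \<notin> J \<longrightarrow> f j = 0}"

abbreviation spn :: "('a \<Rightarrow> real) set \<Rightarrow> ('a \<Rightarrow> real) set" where
  "spn \<equiv> fun_vs.span"

definition orthonormal :: "'a set \<Rightarrow> ('a \<Rightarrow> real) set \<Rightarrow> bool" where
  "orthonormal J E \<longleftrightarrow> (\<forall>e\<in>E. \<forall>e'\<in>E. ip J e e' = (if e = e' then 1 else 0))"

lemma fun_sum_apply: "(\<Sum>i\<in>A. f i) x = (\<Sum>i\<in>A. f i (x::'a) :: real)"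
  by (induction A rule: infinite_finite_induct) auto

lemma ip_commute: "ip J f g = ip J g f"
  by (simp add: ip_def mult.commute)

lemma ip_simps:
  "ip J (f + g) h = ip J f h + ip J g h" "ip J h (f + g) = ip J h f + ip J h g"
  "ip J (f - g) h = ip J f h - ip J g h" "ip J h (f - g) = ip J h f - ip J h g"
  "ip J (scal r f) h = r * ip J f h" "ip J h (scal r f) = r * ip J h f"
  "ip J 0 h = 0" "ip J h 0 = 0"
  "ip J (\<lambda>x. f x + g x) h = ip J f h + ip J g h" "ip J h (\<lambda>x. f x + g x) = ip J h f + ip J h g"
  "ip J (\<lambda>x. 0) h = 0" "ip J h (\<lambda>x. 0) = 0"
  by (auto simp: ip_def scal_def algebra_simps sum.distrib sum_subtractf sum_distrib_left)

lemma ip_sum_left: "ip J (\<Sum>i\<in>A. f i) g = (\<Sum>i\<in>A. ip J (f i) g)"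
  by (induction A rule: infinite_finite_induct) (auto simp: ip_simps)

lemma ip_sum_right: "ip J g (\<Sum>i\<in>A. f i) = (\<Sum>i\<in>A. ip J g (f i))"
  by (induction A rule: infinite_finite_induct) (auto simp: ip_simps)

lemma ip_nonneg [simp]: "0 \<le> ip J f f"
  by (simp add: ip_def sum_nonneg)

lemma ip_cong: "(\<And>j. j \<in> J \<Longrightarrow> f j = f' j) \<Longrightarrow> (\<And>j. j \<in> J \<Longrightarrow> g j = g' j) \<Longrightarrow> ip J f g = ip J f' g'"
  unfolding ip_def by (intro sum.cong) auto

lemma ip_eq_0_iff:
  assumes "finite J"
  shows "ip J f f = 0 \<longleftrightarrow> (\<forall>j\<in>J. f j = 0)"
  using assms by (simp add: ip_def sum_nonneg_eq_0_iff)

lemma ip_eq_0_supp_on: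
  assumes "finite J" "f \<in> supp_on J" "ip J f f = 0"
  shows "f = 0"
  using assms by (auto simp: ip_eq_0_iff supp_on_def fun_eq_iff)

lemma L2_set_ip: "L2_set f J = sqrt (ip J f f)"
  by (simp add: L2_set_def ip_def power2_eq_square)

lemma L2_set_sq: "(L2_set f J)\<^sup>2 = ip J f f"
  by (simp add: L2_set_ip)

lemma L2_set_diff_commute: "L2_set (f - g) J = L2_set (g - f) J"
  by (simp add: L2_set_def power2_commute)

lemma L2_set_fun_add: "L2_set (f + g) J \<le> L2_set f J + L2_set g J"
  using L2_set_triangle_ineq[of f g J] by (simp add: plus_fun_def)

lemma L2_set_fun_sum: "L2_set (\<Sum>i\<in>A. f i) J \<le> (\<Sum>i\<in>A. L2_set (f i) J)"
proof (induction A rule: infinite_finite_induct)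
  case (insert x A)
  then show ?case
    using L2_set_fun_add[of "f x" "\<Sum>i\<in>A. f i" J] by (simp del: plus_fun_apply)
qed (auto simp: L2_set_def)

lemma L2_set_fun_diff: "L2_set (f - g) J \<le> L2_set f J + L2_set g J"
proof -
  have "L2_set (f - g) J \<le> L2_set f J + L2_set (- g) J"
    using L2_set_fun_add[of f "- g" J] by simp
  then show ?thesis by (simp add: L2_set_def)
qed

lemma Cauchy_ip: "ip J f g \<le> L2_set f J * L2_set g J"
  unfolding ip_def
  by (rule order_trans[OF sum_mono L2_set_mult_ineq]) (simp add: abs_mult flip: abs_mult)

lemma supp_on_diff: "f \<in> supp_on J \<Longrightarrow> g \<in> supp_on J \<Longrightarrow> f - g \<in> supp_on J"
  by (auto simp: supp_on_def)

lemma spn_subset_supp_on: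
  assumes "W \<subseteq> supp_on J"
  shows "spn W \<subseteq> supp_on J"
proof (rule fun_vs.span_minimal[OF assms])
  show "fun_vs.subspace (supp_on J)"
    unfolding fun_vs.subspace_def by (auto simp: supp_on_def)
qed

lemma spn_scal: "f \<in> spn W \<Longrightarrow> scal r f \<in> spn W"
  using fun_vs.span_scale[of f W r] by (simp add: scal_def)

lemma spn_induct [consumes 1, case_names base zero add scal]:
  assumes "x \<in> spn W"
    and "\<And>w. w \<in> W \<Longrightarrow> P w" and "P 0"
    and "\<And>f g. P f \<Longrightarrow> P g \<Longrightarrow> P (f + g)" and "\<And>r f. P f \<Longrightarrow> P (scal r f)"
  shows "P x"
  using assms(1)
proof (rule fun_vs.span_induct)
  show "fun_vs.subspace (Collect P)"
    unfolding fun_vs.subspace_def using assms(3-5) by (auto simp: scal_def)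
qed (use assms in auto)

lemma ip_spn_eq_0:
  assumes "x \<in> spn W" "\<And>w. w \<in> W \<Longrightarrow> ip J f w = 0"
  shows "ip J f x = 0"
  using assms(1) by (induction rule: spn_induct) (auto simp: assms(2) ip_simps)

lemma ip_spn_spn_eq_0:
  assumes "x \<in> spn W" "y \<in> spn V" "\<And>w v. w \<in> W \<Longrightarrow> v \<in> V \<Longrightarrow> ip J w v = 0"
  shows "ip J x y = 0"
proof -
  have "ip J x v = 0" if "v \<in> V" for v
    using ip_spn_eq_0[OF assms(1), of J v] assms(3)[OF _ that] by (simp add: ip_commute)
  then show ?thesis by (rule ip_spn_eq_0[OF assms(2)])
qed

text \<open>The difference of two candidates lies in the span and is orthogonal to itself, hence
  vanishes because \<open>W\<close> is supported on \<open>J\<close>. This resolves the description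
  in \<open>orth_proj\<close> for any exhibited candidate.\<close>

lemma orth_proj_eqI:
  assumes "finite J" "W \<subseteq> supp_on J" "p \<in> spn W" "\<And>w. w \<in> W \<Longrightarrow> ip J (f - p) w = 0"
  shows "orth_proj J W f = p"
proof -
  have *: "(\<Sum>j\<in>J. (f j - q j) * w j) = ip J (f - q) w" for q w
    by (simp add: ip_def)
  show ?thesis
    unfolding orth_proj_def *
  proof (rule the_equality)
    show "p \<in> spn W \<and> (\<forall>w\<in>spn W. ip J (f - p) w = 0)"
      using assms ip_spn_eq_0[of _ W J "f - p"] by blast
  next
    fix q assume q: "q \<in> spn W \<and> (\<forall>w\<in>spn W. ip J (f - q) w = 0)"
    then have "q - p \<in> spn W"
      using assms(3) fun_vs.span_diff by blast
    then have "ip J (f - q) (q - p) = 0" "ip J (f - p) (q - p) = 0"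
      using q ip_spn_eq_0[of "q - p" W J "f - p"] assms(4) by auto
    then have "ip J (q - p) (q - p) = 0"
      by (simp add: ip_simps)
    moreover have "q - p \<in> supp_on J"
      using \<open>q - p \<in> spn W\<close> spn_subset_supp_on[OF assms(2)] by blast
    ultimately have "q - p = 0"
      using ip_eq_0_supp_on[OF assms(1)] by blast
    then show "q = p" by simp
  qed
qed

text \<open>Being an explicit sum, it is linear and self-adjoint for every \<open>E\<close>; it is
  the orthogonal projection onto \<open>spn E\<close> once \<open>E\<close> is finite and
  orthonormal.\<close>

definition on_proj :: "'a set \<Rightarrow> ('a \<Rightarrow> real) set \<Rightarrow> ('a \<Rightarrow> real) \<Rightarrow> 'a \<Rightarrow> real" where
  "on_proj J E f = (\<Sum>e\<in>E. scal (ip J f e) e)"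

lemma on_proj_in_spn: "on_proj J E f \<in> spn E"
  unfolding on_proj_def by (intro fun_vs.span_sum spn_scal fun_vs.span_base)

lemma ip_on_proj:
  assumes "finite E" "orthonormal J E" "e \<in> E"
  shows "ip J (f - on_proj J E f) e = 0"
proof -
  have "ip J (on_proj J E f) e = (\<Sum>e'\<in>E. ip J f e' * (if e' = e then 1 else 0))"
    unfolding on_proj_def ip_sum_left
    by (intro sum.cong) (use assms in \<open>auto simp: ip_simps orthonormal_def\<close>)
  also have "\<dots> = ip J f e"
    using assms by (simp add: if_distrib sum.delta cong: if_cong)
  finally show ?thesis by (simp add: ip_simps)
qed

lemma ip_on_proj_spn:
  assumes "finite E" "orthonormal J E" "x \<in> spn E"
  shows "ip J (f - on_proj J E f) x = 0"
  using assms by (intro ip_spn_eq_0[OF assms(3)] ip_on_proj)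

text \<open>Pythagoras. It allows the residual of the projection to be bounded by any convenient
  approximant from the span.\<close>

lemma on_proj_best:
  assumes "finite E" "orthonormal J E" "x \<in> spn E"
  shows "L2_set (f - on_proj J E f) J \<le> L2_set (f - x) J"
proof -
  let ?p = "on_proj J E f"
  have "?p - x \<in> spn E" using assms on_proj_in_spn fun_vs.span_diff by blast
  then have "ip J (f - ?p) (?p - x) = 0" using assms ip_on_proj_spn by blast
  then have "ip J (f - x) (f - x) = ip J (f - ?p) (f - ?p) + ip J (?p - x) (?p - x)"
    by (simp add: ip_simps algebra_simps ip_commute[of J x f] ip_commute[of J ?p f] ip_commute[of J ?p x])
  then have "ip J (f - ?p) (f - ?p) \<le> ip J (f - x) (f - x)" by simp
  then show ?thesis by (simp add: L2_set_ip)
qed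

lemma ip_on_proj_self:
  assumes "finite E" "orthonormal J E"
  shows "ip J (on_proj J E f) (on_proj J E f) = (\<Sum>e\<in>E. (ip J f e)\<^sup>2)"
proof -
  have "ip J (f - on_proj J E f) (on_proj J E f) = 0"
    using assms ip_on_proj_spn on_proj_in_spn by blast
  then have "ip J (on_proj J E f) (on_proj J E f) = ip J f (on_proj J E f)"
    by (simp add: ip_simps)
  also have "\<dots> = (\<Sum>e\<in>E. (ip J f e)\<^sup>2)"
    unfolding on_proj_def ip_sum_right by (simp add: ip_simps power2_eq_square)
  finally show ?thesis .
qed

lemma Bessel:
  assumes "finite E" "orthonormal J E"
  shows "(\<Sum>e\<in>E. (ip J f e)\<^sup>2) \<le> ip J f f"
proof -
  let ?p = "on_proj J E f"
  have "ip J (f - ?p) ?p = 0"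
    using assms ip_on_proj_spn on_proj_in_spn by blast
  then have "ip J (f - ?p) (f - ?p) = ip J f f - ip J ?p ?p"
    by (simp add: ip_simps ip_commute[of J ?p f])
  then show ?thesis
    using ip_nonneg[of J "f - ?p"] ip_on_proj_self[OF assms, of f] by linarith
qed

lemma ip_on_proj_swap: "ip J (on_proj J E f) g = ip J f (on_proj J E g)"
  unfolding on_proj_def ip_sum_left ip_sum_right by (simp add: ip_simps mult.commute ip_commute)

text \<open>Vectors of \<open>W\<close> that already lie in the span of their predecessors
  contribute nothing to \<open>E\<close>, hence only an inequality between the cardinalities;
  \<open>W\<close> may be linearly dependent.\<close>

lemma Gram_Schmidt:
  assumes "finite J" "finite W" "W \<subseteq> supp_on J"
  shows "\<exists>E. finite E \<and> card E \<le> card W \<and> orthonormal J E \<and> spn E = spn W"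
  using assms(2,3)
proof (induction W rule: finite_induct)
  case empty
  show ?case by (intro exI[of _ "{}"]) (auto simp: orthonormal_def)
next
  case (insert w W)
  then obtain E where E: "finite E" "card E \<le> card W" "orthonormal J E" "spn E = spn W"
    by auto
  have EJ: "spn E \<subseteq> supp_on J"
    using spn_subset_supp_on[of W J] insert.prems E(4) by simp
  let ?p = "on_proj J E w"
  define v where "v = w - ?p"
  have vE: "ip J v e = 0" if "e \<in> E" for e
    using ip_on_proj[OF E(1,3) that] by (simp add: v_def)
  have vJ: "v \<in> supp_on J"
    using insert.prems EJ on_proj_in_spn[of J E w] supp_on_diff[of w J ?p] by (auto simp: v_def)
  show ?case
  proof (cases "v = 0")
    case True
    then have "w \<in> spn W" using on_proj_in_spn[of J E w] E(4) by (simp add: v_def)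
    then have "spn (insert w W) = spn W" by (rule fun_vs.span_redundant)
    then show ?thesis using E insert.hyps by (intro exI[of _ E]) auto
  next
    case False
    then have pos: "ip J v v > 0"
      using ip_eq_0_supp_on[OF assms(1) vJ] ip_nonneg[of J v] by (metis less_eq_real_def)
    define e where "e = scal (1 / sqrt (ip J v v)) v"
    have ee: "ip J e e = 1" using pos by (simp add: e_def ip_simps)
    have eE: "ip J e e' = 0" "ip J e' e = 0" if "e' \<in> E" for e'
      using vE[OF that] by (simp_all add: e_def ip_simps ip_commute[of J e'])
    have on: "orthonormal J (insert e E)"
      using E(3) ee eE unfolding orthonormal_def by auto
    have v_e: "v = scal (sqrt (ip J v v)) e" using pos by (auto simp: e_def scal_def fun_eq_iff)
    have sub: "spn E \<subseteq> spn (insert e E)" "spn W \<subseteq> spn (insert w W)"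
      by (auto intro!: fun_vs.span_mono)
    have "v \<in> spn (insert e E)" by (subst v_e, intro spn_scal fun_vs.span_base) auto
    moreover have "?p \<in> spn (insert e E)" using sub on_proj_in_spn by blast
    ultimately have "v + ?p \<in> spn (insert e E)" by (rule fun_vs.span_add)
    then have "w \<in> spn (insert e E)" by (simp add: v_def)
    moreover have "W \<subseteq> spn (insert e E)" using sub E(4) fun_vs.span_superset by blast
    ultimately have 1: "insert w W \<subseteq> spn (insert e E)" by simp
    have "w \<in> spn (insert w W)" by (simp add: fun_vs.span_base)
    moreover have "?p \<in> spn (insert w W)" using sub on_proj_in_spn E(4) by blast
    ultimately have "v \<in> spn (insert w W)" unfolding v_def by (rule fun_vs.span_diff)
    then have "e \<in> spn (insert w W)" unfolding e_def by (rule spn_scal)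
    moreover have "E \<subseteq> spn (insert w W)" using sub E(4) fun_vs.span_superset by blast
    ultimately have 2: "insert e E \<subseteq> spn (insert w W)" by simp
    have "spn (insert e E) = spn (insert w W)" using 1 2 fun_vs.span_eq by blast
    moreover have "card (insert e E) \<le> card (insert w W)"
      using E insert.hyps by (simp add: card_insert_if)
    ultimately show ?thesis using E on by (intro exI[of _ "insert e E"]) auto
  qed
qed

section \<open>The one-dimensional dictionary\<close>

text \<open>Truncated subtraction makes \<open>bdiff f 0\<close> zero. With this convention Pascal's
  rule gives the alternating binomial sum of \<open>D_coord\<close> for its powers at every
  position, including those near 0.\<close>

definition bdiff :: "(nat \<Rightarrow> real) \<Rightarrow> nat \<Rightarrow> real" where
  "bdiff f j = f j - f (j - 1)"

lemma bdiff_pow_sum: "(bdiff ^^ k) f j = (\<Sum>l=0..k. (-1) ^ l * real (k choose l) * f (j - l))"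
proof (induction k arbitrary: f)
  case (Suc k)
  let ?a = "\<lambda>l. (-1) ^ l * real (k choose l)"
  have "(\<Sum>l=0..Suc k. (-1) ^ l * real (Suc k choose l) * f (j - l))
      = f j + (\<Sum>l=0..k. (-1) ^ Suc l * real (Suc k choose Suc l) * f (j - Suc l))"
    by (subst sum.atLeast0_atMost_Suc_shift) simp
  also have "\<dots> = f j + ((\<Sum>l=0..k. (-1) ^ Suc l * real (k choose Suc l) * f (j - Suc l))
                  - (\<Sum>l=0..k. ?a l * f (j - Suc l)))"
    by (simp add: algebra_simps sum.distrib sum_subtractf sum_negf)
  also have "f j + (\<Sum>l=0..k. (-1) ^ Suc l * real (k choose Suc l) * f (j - Suc l))
      = (\<Sum>l=0..Suc k. ?a l * f (j - l))"
    by (subst sum.atLeast0_atMost_Suc_shift) simp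
  hence "f j + ((\<Sum>l=0..k. (-1) ^ Suc l * real (k choose Suc l) * f (j - Suc l))
                  - (\<Sum>l=0..k. ?a l * f (j - Suc l)))
       = (\<Sum>l=0..Suc k. ?a l * f (j - l)) - (\<Sum>l=0..k. ?a l * f (j - Suc l))" by simp
  also have "(\<Sum>l=0..Suc k. ?a l * f (j - l)) = (\<Sum>l=0..k. ?a l * f (j - l))"
    by (simp add: binomial_eq_0)
  also have "(\<Sum>l=0..k. ?a l * f (j - l)) - (\<Sum>l=0..k. ?a l * f (j - Suc l)) = (\<Sum>l=0..k. ?a l * bdiff f (j - l))"
    by (simp add: bdiff_def sum_subtractf right_diff_distrib)
  also have "\<dots> = (bdiff ^^ Suc k) f j"
    using Suc[of "bdiff f"] by (simp add: funpow_swap1)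
  finally show ?case by simp
qed simp

lemma bdiff_pow_linear:
  "(bdiff ^^ k) (f + g) j = (bdiff ^^ k) f j + (bdiff ^^ k) g j"
  "(bdiff ^^ k) (f - g) j = (bdiff ^^ k) f j - (bdiff ^^ k) g j"
  "(bdiff ^^ k) (scal r f) j = r * (bdiff ^^ k) f j"
  "(bdiff ^^ k) 0 j = 0"
  by (simp_all add: bdiff_pow_sum scal_def algebra_simps sum.distrib sum_subtractf sum_distrib_left)

lemma bdiff_pow_cong:
  "(\<And>j. j \<le> N \<Longrightarrow> f j = g j) \<Longrightarrow> j \<le> N \<Longrightarrow> (bdiff ^^ k) f j = (bdiff ^^ k) g j"
  unfolding bdiff_pow_sum by (intro sum.cong) auto

section \<open>Closed form and differences of the discrete truncated powers\<close>

lemma phi_low: "r < k \<Longrightarrow> phi N k r = phi N r r" 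
proof (cases "k \<le> 1")
  case True
  assume "r < k"
  then show ?thesis using True by (simp add: phi.simps)
next
  case False
  assume "r < k"
  then show ?thesis by (subst phi.simps) (use False in auto)
qed

lemma phi_Suc:
  assumes "1 \<le> k" "k < r"
  shows "phi N (Suc k) r j = (\<Sum>l=r..N. phi N k l j) / real N"
  using assms by (subst phi.simps) auto

text \<open>Each cumulative summation raises the binomial degree by one (hockey-stick identity).
  Knots below k are frozen by the recursion and so excluded.\<close>

lemma phi_closed:
  assumes "1 \<le> k" "k \<le> r"
  shows "phi N k r j =
    (if r \<le> j \<and> j \<le> N then real ((k - 1 + (j - r)) choose (k - 1)) / real N ^ (k - 1) else 0)"
  using assms
proof (induction k arbitrary: r rule: dec_induct)
  case base
  then show ?case by (simp add: phi.simps)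
next
  case (step k)
  have kk: "Suc (k - 1) = k" using step by simp
  have "phi N (Suc k) r j = (\<Sum>l=r..N. phi N k l j) / real N"
    using step phi_Suc by simp
  also have "(\<Sum>l=r..N. phi N k l j) =
     (\<Sum>l=r..N. if l \<le> j \<and> j \<le> N then real ((k - 1 + (j - l)) choose (k - 1)) / real N ^ (k - 1) else 0)"
    using step by (intro sum.cong refl step.IH) auto
  also have "\<dots> = (if r \<le> j \<and> j \<le> N then real ((k + (j - r)) choose k) / real N ^ (k - 1) else 0)"
  proof (cases "r \<le> j \<and> j \<le> N")
    case True
    have "(\<Sum>l=r..N. if l \<le> j \<and> j \<le> N then real ((k - 1 + (j - l)) choose (k - 1)) / real N ^ (k - 1) else 0)
       = (\<Sum>l=r..j. real ((k - 1 + (j - l)) choose (k - 1)) / real N ^ (k - 1))"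
      using True by (intro sum.mono_neutral_cong_right) auto
    also have "\<dots> = (\<Sum>i\<le>j - r. real ((k - 1 + i) choose (k - 1)) / real N ^ (k - 1))"
      using True by (intro sum.reindex_bij_witness[of _ "\<lambda>i. j - i" "\<lambda>l. j - l"]) auto
    also have "\<dots> = real (\<Sum>i\<le>j - r. (k - 1 + i) choose (k - 1)) / real N ^ (k - 1)"
      by (simp add: sum_divide_distrib)
    also have "(\<Sum>i\<le>j - r. (k - 1 + i) choose (k - 1)) = (k + (j - r)) choose k"
      using kk by (subst choose_rising_sum) (simp add: algebra_simps)
    finally show ?thesis using True by simp
  next
    case False
    then show ?thesis by (intro trans[OF sum.neutral]) auto
  qed
  also have "\<dots> / real N = (if r \<le> j \<and> j \<le> N then real ((Suc k - 1 + (j - r)) choose (Suc k - 1)) / real N ^ (Suc k - 1) else 0)"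
    using step(1) by (cases k) auto
  finally show ?case .
qed

lemma phi_supp: "1 \<le> k \<Longrightarrow> 1 \<le> r \<Longrightarrow> phi N k r \<in> supp_on {1..N}"
  using phi_low[of r k N] phi_closed[of k r N] phi_closed[of r r N]
  by (cases "r < k") (auto simp: supp_on_def)

lemma phi_nonneg: "1 \<le> k \<Longrightarrow> k \<le> r \<Longrightarrow> 0 \<le> phi N k r j"
  by (simp add: phi_closed)

lemma choose_le_pow: "real ((t + m) choose t) \<le> (real m + 1) ^ t"
proof (induction t)
  case (Suc t)
  have "real (Suc t) * real ((Suc t + m) choose Suc t) = real (Suc t + m) * real ((t + m) choose t)"
    using Suc_times_binomial[of t "t + m"] by (metis add_Suc of_nat_mult)
  also have "\<dots> \<le> (real (Suc t) * (real m + 1)) * (real m + 1) ^ t"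
    by (intro mult_mono Suc) (auto simp: algebra_simps)
  finally show ?case by (simp add: mult.assoc del: binomial_Suc_Suc)
qed simp

lemma phi_le:
  assumes "1 \<le> k" "k \<le> r" "r \<le> j" "j \<le> N"
  shows "phi N k r j \<le> ((real (j - r) + 1) / real N) ^ (k - 1)"
  using assms choose_le_pow[of "k - 1" "j - r"]
  by (simp add: phi_closed power_divide divide_right_mono)

lemma choose_poly: "\<exists>p :: real poly. degree p \<le> t \<and> (\<forall>m. real (m choose t) = poly p (real m))"
proof -
  let ?p = "smult (1 / fact t) (\<Prod>i<t. [:- real i, 1:]) :: real poly"
  have "degree (\<Prod>i<t. [:- real i, 1:]) \<le> (\<Sum>i<t. degree [:- real i, 1:])"
    by (rule degree_prod_sum_le[unfolded o_def]) auto
  then have "degree ?p \<le> t" by simp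
  moreover have "real (m choose t) = poly ?p (real m)" for m
    by (simp add: binomial_gbinomial gbinomial_prod_rev poly_prod atLeast0LessThan algebra_simps)
  ultimately show ?thesis by blast
qed

lemma phi_poly:
  assumes "1 \<le> k" "k \<le> r"
  shows "\<exists>p. degree p < k \<and> (\<forall>j. r \<le> j \<and> j \<le> N \<longrightarrow> phi N k r j = poly p (real j))"
proof -
  obtain p :: "real poly" where p: "degree p \<le> k - 1" "\<And>m. real (m choose (k - 1)) = poly p (real m)"
    using choose_poly by blast
  let ?q = "smult (1 / real N ^ (k - 1)) (pcompose p [:real k - 1 - real r, 1:])"
  have "degree ?q \<le> k - 1" using p(1) by (simp add: degree_pcompose)
  then have "degree ?q < k" using assms by simp
  moreover have "phi N k r j = poly ?q (real j)" if "r \<le> j \<and> j \<le> N" for j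
    using that assms p(2)[of "k - 1 + (j - r)"]
    by (simp add: phi_closed poly_pcompose of_nat_diff algebra_simps)
  ultimately show ?thesis by blast
qed

lemma bdiff_phi:
  assumes "1 \<le> k" "k < r" "j \<le> N"
  shows "bdiff (phi N (Suc k) r) j = phi N k r j / real N"
proof -
  obtain k' where k: "k = Suc k'" using assms by (cases k) auto
  consider "j < r" | "j = r" | "r < j" by linarith
  then show ?thesis
  proof cases
    case 3
    then have "j - r = Suc (j - 1 - r)" by simp
    then obtain m where m: "j - r = Suc m" "j - 1 - r = m" by blast
    have "real ((k + Suc m) choose k) - real ((k + m) choose k) = real ((k' + Suc m) choose k')"
      by (simp add: k)
    moreover have "r \<le> j - 1" "j - 1 \<le> N" using 3 assms by auto
    ultimately show ?thesis using 3 assms m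
      by (simp add: bdiff_def phi_closed k field_simps)
  qed (use assms in \<open>auto simp: bdiff_def phi_closed k\<close>)
qed

lemma bdiff_pow_phi:
  assumes "1 \<le> k" "k + t \<le> r" "j \<le> N"
  shows "(bdiff ^^ t) (phi N (k + t) r) j = phi N k r j / real N ^ t"
  using assms(2,3)
proof (induction t arbitrary: j)
  case (Suc t)
  have "(bdiff ^^ Suc t) (phi N (k + Suc t) r) j = (bdiff ^^ t) (bdiff (phi N (Suc (k + t)) r)) j"
    by (simp add: funpow_swap1)
  also have "\<dots> = (bdiff ^^ t) (scal (1 / real N) (phi N (k + t) r)) j"
    by (rule bdiff_pow_cong[of N]) (use Suc.prems assms(1) in \<open>auto simp: bdiff_phi scal_def\<close>)
  also have "\<dots> = phi N k r j / real N ^ Suc t"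
    using Suc by (simp add: bdiff_pow_linear)
  finally show ?case .
qed simp

text \<open>After k - 1 differences only the unit step at r remains, scaled by 1 / N^(k - 1); the
  last difference locates its jump.\<close>

lemma bdiff_pow_phi_delta:
  assumes "1 \<le> k" "k \<le> r" "j \<le> N"
  shows "(bdiff ^^ k) (phi N k r) j = (if j = r then 1 / real N ^ (k - 1) else 0)"
proof -
  obtain t where t: "k = Suc t" using assms by (cases k) auto
  have "(bdiff ^^ k) (phi N k r) j = bdiff ((bdiff ^^ t) (phi N (1 + t) r)) j"
    by (simp add: t)
  also have "\<dots> = phi N 1 r j / real N ^ t - phi N 1 r (j - 1) / real N ^ t"
    using assms by (simp add: bdiff_def bdiff_pow_phi[of 1 t r, simplified] t)
  also have "\<dots> = (if j = r then 1 / real N ^ (k - 1) else 0)"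
    using assms by (auto simp: phi_closed t)
  finally show ?thesis .
qed

text \<open>The first l differences leave a spike at l. The remaining k - l differences at j > k
  read only positions from j - (k - l) > l on, so they miss the spike.\<close>

lemma bdiff_pow_phi_diag_eq_0:
  assumes "1 \<le> l" "l \<le> k" "k < j" "j \<le> N"
  shows "(bdiff ^^ k) (phi N l l) j = 0"
proof -
  have "(bdiff ^^ k) (phi N l l) j = (bdiff ^^ (k - l)) ((bdiff ^^ l) (phi N l l)) j"
    using assms(2) funpow_add[of "k - l" l bdiff] by simp
  also have "\<dots> = 0"
    unfolding bdiff_pow_sum[of "k - l"]
  proof (intro sum.neutral ballI)
    fix m assume "m \<in> {0..k - l}"
    then have "j - m \<noteq> l" "j - m \<le> N" using assms by auto
    then have "(bdiff ^^ l) (phi N l l) (j - m) = 0"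
      using assms by (simp add: bdiff_pow_phi_delta)
    then show "(-1) ^ m * real (k - l choose m) * (bdiff ^^ l) (phi N l l) (j - m) = 0" by simp
  qed
  finally show ?thesis .
qed

definition kdelta :: "'a \<Rightarrow> 'a \<Rightarrow> real" where
  "kdelta i j = of_bool (j = i)"

text \<open>Cumulative summation is inverted by differencing neighbouring knots, so every order
  spans what the previous one spans, down to steps and then unit vectors. Beyond the last knot N the
  neighbour is replaced by 0.\<close>

lemma kdelta_span_phi:
  assumes "1 \<le> k" "k \<le> N" "i \<in> {1..N}"
  shows "kdelta i \<in> spn (phi N k ` {1..N})"
  using assms(1,2)
proof (induction k rule: dec_induct)
  case base
  have *: "phi N 1 i \<in> spn (phi N 1 ` {1..N})" using assms by (intro fun_vs.span_base) auto
  have "(if i = N then 0 else phi N 1 (Suc i)) \<in> spn (phi N 1 ` {1..N})"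
    using assms by (auto intro!: fun_vs.span_base fun_vs.span_zero)
  from fun_vs.span_diff[OF * this]
  have "phi N 1 i - (if i = N then 0 else phi N 1 (Suc i)) \<in> spn (phi N 1 ` {1..N})" .
  also have "phi N 1 i - (if i = N then 0 else phi N 1 (Suc i)) = kdelta i"
    using assms by (auto simp: fun_eq_iff phi.simps kdelta_def)
  finally show ?case .
next
  case (step k)
  let ?S = "spn (phi N (Suc k) ` {1..N})"
  have "phi N k r \<in> ?S" if r: "r \<in> {1..N}" for r
  proof (cases "r \<le> k")
    case True
    then have "phi N k r = phi N (Suc k) r"
      using phi_low[of r k N] phi_low[of r "Suc k" N] by (cases "r = k") auto
    then show ?thesis using r by (auto intro!: fun_vs.span_base)
  next
    case False
    let ?g = "if r = N then 0 else phi N (Suc k) (Suc r)"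
    have "phi N (Suc k) r \<in> ?S" using r by (intro fun_vs.span_base) auto
    moreover have "?g \<in> ?S"
      using r by (auto intro!: fun_vs.span_base fun_vs.span_zero)
    ultimately have "phi N (Suc k) r - ?g \<in> ?S" by (rule fun_vs.span_diff)
    then have "scal (real N) (phi N (Suc k) r - ?g) \<in> ?S" by (rule spn_scal)
    also have "scal (real N) (phi N (Suc k) r - ?g) = phi N k r"
    proof
      fix j
      have "(\<Sum>l=r..N. phi N k l j) = phi N k r j + (\<Sum>l=Suc r..N. phi N k l j)"
        using r by (simp add: sum.atLeast_Suc_atMost)
      then show "scal (real N) (phi N (Suc k) r - ?g) j = phi N k r j"
        using r False step by (simp add: scal_def phi_Suc field_simps)
    qed
    finally show ?thesis .
  qed
  then have "phi N k ` {1..N} \<subseteq> ?S" by blast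
  then have "spn (phi N k ` {1..N}) \<subseteq> ?S"
    using fun_vs.span_mono fun_vs.span_span by metis
  then show ?case using step by auto
qed

text \<open>On 1..N the function \<open>phi N l l\<close> is the binomial (j - 1 choose l - 1)
  divided by N^(l - 1), so the span consists of the polynomials of degree below k restricted to
  1..N.\<close>

definition phid :: "nat \<Rightarrow> nat \<Rightarrow> (nat \<Rightarrow> real) set" where
  "phid N k = {phi N l l | l. l \<in> {1..k}}"

lemma phid_supp: "phid N k \<subseteq> supp_on {1..N}"
  by (auto simp: phid_def simp del: One_nat_def intro!: phi_supp)

lemma finite_phid: "finite (phid N k)"
  by (simp add: phid_def Setcompr_eq_image)

lemma phid_mono: "k \<le> m \<Longrightarrow> spn (phid N k) \<subseteq> spn (phid N m)"
  by (intro fun_vs.span_mono) (auto simp: phid_def)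

lemma bdiff_pow_phid_span:
  assumes "f \<in> spn (phid N k)" "k < j" "j \<le> N"
  shows "(bdiff ^^ k) f j = 0"
  using assms(1)
  by (induction rule: spn_induct)
     (use assms(2,3) in \<open>auto simp: phid_def bdiff_pow_linear bdiff_pow_phi_diag_eq_0 simp del: plus_fun_apply zero_fun_apply\<close>)

text \<open>The difference of order k - 1 at position k kills the lower functions but not
  \<open>phi N k k\<close>. Consequently the normalization in \<open>phit\<close> never divides by
  0.\<close>

lemma phi_diag_notin_span:
  assumes "1 \<le> k" "k \<le> N"
  shows "phi N k k \<notin> spn (phid N (k - 1))"
proof
  assume "phi N k k \<in> spn (phid N (k - 1))"
  then have "(bdiff ^^ (k - 1)) (phi N k k) k = 0"
    using assms by (intro bdiff_pow_phid_span) auto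
  moreover have "(bdiff ^^ (k - 1)) (phi N (1 + (k - 1)) k) k = phi N 1 k k / real N ^ (k - 1)"
    using assms by (intro bdiff_pow_phi) auto
  ultimately show False using assms by (simp add: phi.simps)
qed

section \<open>Orthogonalized dictionary vectors\<close>

lemma anti_proj_props:
  assumes "finite J" "finite W" "W \<subseteq> supp_on J" "f \<in> supp_on J"
  shows "f - anti_proj J W f \<in> spn W" "\<And>x. x \<in> spn W \<Longrightarrow> ip J (anti_proj J W f) x = 0"
    and "anti_proj J W f \<in> supp_on J"
    and "ip J (f - anti_proj J W f) (f - anti_proj J W f) \<le> ip J f f"
proof -
  obtain E where E: "finite E" "orthonormal J E" "spn E = spn W"
    using Gram_Schmidt[OF assms(1,2,3)] by blast
  have "orth_proj J W f = on_proj J E f"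
  proof (rule orth_proj_eqI[OF assms(1,3)])
    show "on_proj J E f \<in> spn W" using on_proj_in_spn E(3) by blast
    fix w assume "w \<in> W"
    then have "w \<in> spn E" using E(3) fun_vs.span_base by blast
    then show "ip J (f - on_proj J E f) w = 0" using E ip_on_proj_spn by blast
  qed
  then have *: "anti_proj J W f = f - on_proj J E f" by (simp add: anti_proj_def)
  show "f - anti_proj J W f \<in> spn W" using on_proj_in_spn E(3) by (auto simp: *)
  then show "anti_proj J W f \<in> supp_on J"
    using spn_subset_supp_on[OF assms(3)] supp_on_diff[of f J "f - anti_proj J W f"] assms(4) by auto
  show "ip J (anti_proj J W f) x = 0" if "x \<in> spn W" for x
    using that ip_on_proj_spn[OF E(1,2)] E(3) by (simp add: *)
  show "ip J (f - anti_proj J W f) (f - anti_proj J W f) \<le> ip J f f"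
    using Bessel[OF E(1,2), of f] ip_on_proj_self[OF E(1,2), of f] by (simp add: *)
qed

text \<open>The low vectors are discrete orthogonal polynomials of squared norm N. The last claim
  inverts one orthogonalization step, so that the \<open>phit\<close> vectors are seen to span all
  of \<open>phid\<close>.\<close>

lemma phit_low_props:
  assumes "1 \<le> j" "j \<le> k" "k \<le> N"
  shows "phit N k j \<in> spn (phid N j)"
    and "x \<in> spn (phid N (j - 1)) \<Longrightarrow> ip {1..N} (phit N k j) x = 0"
    and "ip {1..N} (phit N k j) (phit N k j) = real N"
    and "phi N j j \<in> spn (insert (phit N k j) (phid N (j - 1)))"
proof -
  define v where "v = anti_proj {1..N} (phid N (j - 1)) (phi N j j)"
  have supp: "phi N j j \<in> supp_on {1..N}" using assms by (intro phi_supp) auto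
  note ap = anti_proj_props[where W = "phid N (j - 1)", OF finite_atLeastAtMost finite_phid phid_supp supp, folded v_def]
  have "v \<noteq> 0" using ap(1) phi_diag_notin_span[of j N] assms by auto
  then have pos: "L2_set v {1..N} > 0"
    using ip_eq_0_supp_on[OF _ ap(3)] ip_nonneg[of "{1..N}" v]
    by (metis L2_set_ip finite_atLeastAtMost less_eq_real_def real_sqrt_gt_0_iff)
  have u: "phit N k j = scal (sqrt (real N) / L2_set v {1..N}) v"
    using assms by (simp add: phit_def v_def phid_def scal_def Let_def)
  have "phi N j j \<in> spn (phid N j)"
    using assms by (intro fun_vs.span_base) (auto simp: phid_def)
  moreover have "phi N j j - v \<in> spn (phid N j)" using ap(1) phid_mono[of "j - 1" j N] by auto
  ultimately have "phi N j j - (phi N j j - v) \<in> spn (phid N j)" by (rule fun_vs.span_diff)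
  then show "phit N k j \<in> spn (phid N j)" unfolding u by (intro spn_scal) simp
  show "ip {1..N} (phit N k j) x = 0" if "x \<in> spn (phid N (j - 1))"
    using ap(2)[OF that] by (simp add: u ip_simps)
  have "ip {1..N} (phit N k j) (phit N k j) = (sqrt (real N) / L2_set v {1..N})\<^sup>2 * ip {1..N} v v"
    by (simp add: u ip_simps power2_eq_square)
  also have "\<dots> = real N"
    unfolding L2_set_sq[symmetric] using pos by (simp add: power_divide)
  finally show "ip {1..N} (phit N k j) (phit N k j) = real N" .
  let ?S = "spn (insert (phit N k j) (phid N (j - 1)))"
  have "v = scal (L2_set v {1..N} / sqrt (real N)) (phit N k j)"
    using pos assms by (auto simp: u scal_def fun_eq_iff)
  moreover have "scal (L2_set v {1..N} / sqrt (real N)) (phit N k j) \<in> ?S"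
    by (intro spn_scal fun_vs.span_base) auto
  moreover have "phi N j j - v \<in> ?S" using ap(1) fun_vs.span_mono[of "phid N (j - 1)"] by blast
  ultimately have "phi N j j - v + v \<in> ?S" by (metis fun_vs.span_add)
  then show "phi N j j \<in> ?S" by simp
qed

lemma phit_low_ip:
  assumes "i \<in> {1..k}" "j \<in> {1..k}" "k \<le> N"
  shows "ip {1..N} (phit N k i) (phit N k j) = (if i = j then real N else 0)"
proof -
  have *: "ip {1..N} (phit N k i) (phit N k j) = 0" if "i < j" "j \<in> {1..k}" "i \<in> {1..k}" for i j
  proof -
    have "spn (phid N i) \<subseteq> spn (phid N (j - 1))" using that by (intro phid_mono) simp
    then have "phit N k i \<in> spn (phid N (j - 1))"
      using phit_low_props(1)[of i k N] that assms by auto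
    then have "ip {1..N} (phit N k j) (phit N k i) = 0"
      using phit_low_props(2)[of j k N] that assms by auto
    then show ?thesis by (simp add: ip_commute)
  qed
  show ?thesis
    using *[of i j] *[of j i] phit_low_props(3)[of i k N] assms
    by (cases i j rule: linorder_cases) (auto simp: ip_commute)
qed

lemma phid_subset_span_phit:
  assumes "j \<le> k" "k \<le> N"
  shows "phid N j \<subseteq> spn (phit N k ` {1..j})"
  using assms(1)
proof (induction j)
  case (Suc j)
  have sub: "spn (phit N k ` {1..j}) \<subseteq> spn (phit N k ` {1..Suc j})"
    by (intro fun_vs.span_mono) auto
  have "phi N (Suc j) (Suc j) \<in> spn (insert (phit N k (Suc j)) (phid N j))"
    using phit_low_props(4)[of "Suc j" k N] Suc assms by simp
  also have "insert (phit N k (Suc j)) (phid N j) \<subseteq> spn (phit N k ` {1..Suc j})"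
    using Suc sub by (auto intro: fun_vs.span_base)
  then have "spn (insert (phit N k (Suc j)) (phid N j)) \<subseteq> spn (phit N k ` {1..Suc j})"
    by (metis fun_vs.span_mono fun_vs.span_span)
  finally have "phi N (Suc j) (Suc j) \<in> spn (phit N k ` {1..Suc j})" .
  moreover have "phid N (Suc j) = insert (phi N (Suc j) (Suc j)) (phid N j)"
    by (auto simp: phid_def le_Suc_eq)
  ultimately show ?case using Suc sub by auto
qed (simp add: phid_def)

lemma phit_high_props:
  assumes "1 \<le> k" "k < r"
  shows "phi N k r - phit N k r \<in> spn (phid N k)"
    and "x \<in> spn (phid N k) \<Longrightarrow> ip {1..N} (phit N k r) x = 0"
    and "phit N k r \<in> supp_on {1..N}"
    and "ip {1..N} (phi N k r - phit N k r) (phi N k r - phit N k r) \<le> ip {1..N} (phi N k r) (phi N k r)"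
proof -
  have *: "phit N k r = anti_proj {1..N} (phid N k) (phi N k r)"
    using assms by (simp add: phit_def phid_def)
  have "phi N k r \<in> supp_on {1..N}" using assms by (intro phi_supp) auto
  note ap = anti_proj_props[where W = "phid N k", OF finite_atLeastAtMost finite_phid phid_supp this, folded *]
  show "phi N k r - phit N k r \<in> spn (phid N k)"
    and "x \<in> spn (phid N k) \<Longrightarrow> ip {1..N} (phit N k r) x = 0"
    and "phit N k r \<in> supp_on {1..N}"
    and "ip {1..N} (phi N k r - phit N k r) (phi N k r - phit N k r) \<le> ip {1..N} (phi N k r) (phi N k r)"
    using ap by auto
qed

lemma phit_low_span: "i \<in> {1..k} \<Longrightarrow> k \<le> N \<Longrightarrow> phit N k i \<in> spn (phid N k)"
  using phit_low_props(1)[of i k N] phid_mono[of i k N] by auto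

lemma phit_high_low_ip:
  assumes "k < r" "i \<in> {1..k}" "k \<le> N"
  shows "ip {1..N} (phit N k r) (phit N k i) = 0"
  using assms phit_high_props(2)[of k r] phit_low_span by auto

text \<open>\<open>phi\<close> and \<open>phit\<close> differ by a polynomial of degree below k,
  invisible to the k-th difference beyond position k; the factor of \<open>D_coord\<close> cancels
  the 1 / N^(k - 1) of \<open>bdiff_pow_phi_delta\<close>.\<close>

lemma bdiff_pow_phit:
  assumes "1 \<le> k" "k < r" "k < j" "j \<le> N"
  shows "real N ^ (k - 1) * (bdiff ^^ k) (phit N k r) j = of_bool (j = r)"
proof -
  have "(bdiff ^^ k) (phi N k r - phit N k r) j = 0"
    using assms phit_high_props(1) by (intro bdiff_pow_phid_span) auto
  then have "(bdiff ^^ k) (phit N k r) j = (bdiff ^^ k) (phi N k r) j"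
    by (simp add: bdiff_pow_linear)
  then show ?thesis using assms by (simp add: bdiff_pow_phi_delta)
qed

text \<open>The component orthogonal to the polynomials of degree below k: the division by N
  compensates for the squared norm of the low vectors.\<close>

definition hi_part :: "nat \<Rightarrow> nat \<Rightarrow> (nat \<Rightarrow> real) \<Rightarrow> nat \<Rightarrow> real" where
  "hi_part N k f = f - (\<Sum>r\<in>{1..k}. scal (ip {1..N} f (phit N k r) / real N) (phit N k r))"

lemma hi_part_linear:
  "hi_part N k (f + g) = hi_part N k f + hi_part N k g"
  "hi_part N k (scal c f) = scal c (hi_part N k f)"
  "hi_part N k 0 = 0"
proof -
  show "hi_part N k (f + g) = hi_part N k f + hi_part N k g"
    by (rule ext) (simp add: hi_part_def ip_simps fun_sum_apply scal_def add_divide_distrib algebra_simps sum.distrib)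
  show "hi_part N k (scal c f) = scal c (hi_part N k f)"
    by (rule ext) (simp add: hi_part_def ip_simps fun_sum_apply,
        simp add: scal_def fun_sum_apply sum_distrib_left algebra_simps)
  show "hi_part N k 0 = 0"
    by (rule ext) (simp add: hi_part_def ip_simps fun_sum_apply scal_def)
qed

lemma hi_part_low:
  assumes "k \<le> N" "0 < N" "f \<in> spn (phid N k)"
  shows "hi_part N k f = 0"
proof -
  have "f \<in> spn (phit N k ` {1..k})"
    using assms fun_vs.span_minimal[OF phid_subset_span_phit[of k k N] fun_vs.subspace_span] by auto
  then show ?thesis
  proof (induction rule: spn_induct)
    case (base w)
    then obtain i where i: "w = phit N k i" "i \<in> {1..k}" by auto
    have "(\<Sum>r\<in>{1..k}. scal (ip {1..N} (phit N k i) (phit N k r) / real N) (phit N k r))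
        = (\<Sum>r\<in>{1..k}. if r = i then phit N k i else 0)"
      by (intro sum.cong refl) (use i assms in \<open>auto simp: phit_low_ip scal_def fun_eq_iff simp del: One_nat_def\<close>)
    then show ?case using i by (simp add: hi_part_def)
  next
    case zero show ?case by (rule hi_part_linear(3))
  next
    case (add f g) then show ?case unfolding hi_part_linear by simp
  next
    case (scal r f) then show ?case unfolding hi_part_linear by (simp add: scal_def fun_eq_iff)
  qed
qed

text \<open>\<open>phi N k r\<close> is a polynomial for r up to k and otherwise equals
  \<open>phit N k r\<close> plus a polynomial. Together with \<open>kdelta_span_phi\<close> this
  shows that low and high dictionary vectors exhaust the whole space.\<close>

lemma hi_part_span:
  assumes "1 \<le> k" "k \<le> N" "f \<in> spn (phi N k ` {1..N})"
  shows "hi_part N k f \<in> spn (phit N k ` {k + 1..N})"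
  using assms(3)
proof (induction rule: spn_induct)
  case (base w)
  then obtain r where r: "w = phi N k r" "r \<in> {1..N}" by auto
  show ?case
  proof (cases "r \<le> k")
    case True
    then have "w = phi N r r" using r phi_low[of r k N] by (cases "r = k") auto
    then have "w \<in> spn (phid N k)"
      using r True by (auto simp: phid_def intro!: fun_vs.span_base)
    then have "hi_part N k w = 0" using assms by (intro hi_part_low) auto
    then show ?thesis by (simp only: fun_vs.span_zero)
  next
    case False
    have "hi_part N k (phi N k r - phit N k r) = 0"
      using False assms by (intro hi_part_low phit_high_props) auto
    moreover have "hi_part N k (phit N k r) = phit N k r"
    proof -
      have "(\<Sum>i\<in>{1..k}. scal (ip {1..N} (phit N k r) (phit N k i) / real N) (phit N k i)) = 0"
        using False assms by (intro sum.neutral) (auto simp: phit_high_low_ip scal_def fun_eq_iff simp del: One_nat_def)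
      then show ?thesis by (simp add: hi_part_def)
    qed
    moreover have "hi_part N k w = hi_part N k (phi N k r - phit N k r) + hi_part N k (phit N k r)"
      by (subst hi_part_linear(1)[symmetric]) (simp add: r)
    ultimately have *: "hi_part N k w = phit N k r" by simp
    show ?thesis
      unfolding * using False r by (intro fun_vs.span_base) auto
  qed
next
  case zero show ?case unfolding hi_part_linear by (rule fun_vs.span_zero)
next
  case (add f g) then show ?case unfolding hi_part_linear by (rule fun_vs.span_add)
next
  case (scal r f) then show ?case unfolding hi_part_linear by (rule spn_scal)
qed

lemma hi_part_kdelta_span:
  assumes "1 \<le> k" "k \<le> N" "i \<in> {1..N}"
  shows "hi_part N k (kdelta i) \<in> spn (phit N k ` {k + 1..N})"
  using assms hi_part_span kdelta_span_phi by blast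

section \<open>Multilevel decomposition of the dictionary\<close>

text \<open>Number of the dyadic subinterval of [0, 1) of length 2^(-l) that contains (j - 1) / N; N
  need not be a power of two.\<close>

definition blk :: "nat \<Rightarrow> nat \<Rightarrow> nat \<Rightarrow> nat" where
  "blk N l j = ((j - 1) * 2 ^ l) div N"

lemma blk_mono: "i \<le> j \<Longrightarrow> blk N l i \<le> blk N l j"
  unfolding blk_def by (intro div_le_mono mult_right_mono diff_le_mono) auto

lemma blk_less: "j \<in> {1..N} \<Longrightarrow> blk N l j < 2 ^ l"
  unfolding blk_def by (subst less_mult_imp_div_less) (auto simp: mult.commute)

lemma blk_eq_width:
  assumes "blk N l j = blk N l r" "1 \<le> r" "r \<le> j" "0 < N"
  shows "(j - r) * 2 ^ l < N"
proof -
  let ?a = "(j - 1) * 2 ^ l" and ?b = "(r - 1) * 2 ^ l"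
  define q where "q = ?b div N"
  have "?a div N = q" using assms(1) by (simp add: blk_def q_def)
  then have "?a = N * q + ?a mod N" "?b = N * q + ?b mod N"
    unfolding q_def by (metis mult_div_mod_eq, simp)
  moreover have "?a mod N < N" using assms(4) by simp
  ultimately have "?a < ?b + N" by linarith
  moreover have "?a = ?b + (j - r) * 2 ^ l"
    using assms by (simp add: add_mult_distrib[symmetric])
  ultimately show ?thesis by linarith
qed

text \<open>The function restricted to the blocks right of its knot, hence piecewise polynomial; it is exact
  once the blocks are singletons.\<close>

definition lev_approx :: "nat \<Rightarrow> nat \<Rightarrow> nat \<Rightarrow> nat \<Rightarrow> nat \<Rightarrow> real" where
  "lev_approx N k l r =
     (\<lambda>j. if N \<le> 2 ^ l \<or> blk N l r < blk N l j then phi N k r j else 0)"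

text \<open>Once the blocks are singletons the approximation has to be exact; unit vectors achieve
  this, and their number N is then at most 2^l, so both cases obey the same dimension bound.\<close>

definition lev_gen :: "nat \<Rightarrow> nat \<Rightarrow> nat \<Rightarrow> (nat \<Rightarrow> real) set" where
  "lev_gen N k l =
     (if N \<le> 2 ^ l then kdelta ` {1..N}
      else (\<lambda>(b, m) j. if j \<in> {1..N} \<and> blk N l j = b then real j ^ m else 0) ` ({..<2 ^ l} \<times> {..<k}))"

lemma lev_gen_props:
  assumes "1 \<le> k"
  shows "finite (lev_gen N k l)" "card (lev_gen N k l) \<le> k * 2 ^ l" "lev_gen N k l \<subseteq> supp_on {1..N}"
proof -
  show "finite (lev_gen N k l)" by (simp add: lev_gen_def)
  show "card (lev_gen N k l) \<le> k * 2 ^ l"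
  proof (cases "N \<le> 2 ^ l")
    case True
    have "card (kdelta ` {1..N}) \<le> N" by (rule order_trans[OF card_image_le]) auto
    also have "N \<le> k * 2 ^ l" using True assms by (metis le_trans mult_le_mono1 mult_1)
    finally show ?thesis using True by (simp add: lev_gen_def)
  next
    case False
    then show ?thesis
      unfolding lev_gen_def by (simp only: if_False)
       (rule order_trans[OF card_image_le], auto simp: mult.commute)
  qed
  show "lev_gen N k l \<subseteq> supp_on {1..N}"
    by (auto simp: lev_gen_def supp_on_def kdelta_def)
qed

lemma supp_on_span_kdelta:
  assumes "finite J" "f \<in> supp_on J"
  shows "f \<in> spn (kdelta ` J)"
proof -
  have "f = (\<Sum>i\<in>J. scal (f i) (kdelta i))"
  proof
    fix j
    show "f j = (\<Sum>i\<in>J. scal (f i) (kdelta i)) j"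
    proof -
      have "(\<Sum>i\<in>J. scal (f i) (kdelta i)) j = (\<Sum>i\<in>J. if i = j then f i else 0)"
        unfolding fun_sum_apply by (intro sum.cong) (auto simp: scal_def kdelta_def)
      also have "\<dots> = f j" using assms by (auto simp: supp_on_def)
      finally show ?thesis by simp
    qed
  qed
  moreover have "(\<Sum>i\<in>J. scal (f i) (kdelta i)) \<in> spn (kdelta ` J)"
    by (intro fun_vs.span_sum spn_scal fun_vs.span_base) auto
  ultimately show ?thesis by metis
qed

text \<open>One polynomial of degree below k represents \<open>phi N k r\<close> on all blocks to
  the right of the knot's block, so the coefficient of a block monomial depends on the block only
  through this order relation. The knot's own block, where the formula changes, has been cut
  out.\<close>

lemma lev_approx_span:
  assumes "1 \<le> k" "k \<le> r"
  shows "lev_approx N k l r \<in> spn (lev_gen N k l)"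
proof (cases "N \<le> 2 ^ l")
  case True
  have "lev_approx N k l r = phi N k r" using True by (simp add: lev_approx_def)
  moreover have "phi N k r \<in> spn (kdelta ` {1..N})"
    using assms by (intro supp_on_span_kdelta phi_supp) auto
  ultimately show ?thesis using True by (simp add: lev_gen_def)
next
  case False
  obtain p where p: "degree p < k" "\<And>j. r \<le> j \<Longrightarrow> j \<le> N \<Longrightarrow> phi N k r j = poly p (real j)"
    using phi_poly[OF assms] by blast
  define G where "G = (\<lambda>(b, m) j. if j \<in> {1..N} \<and> blk N l j = b then real j ^ m else 0)"
  define c where "c = (\<lambda>(b, m). if blk N l r < b then coeff p m else 0)"
  have "lev_approx N k l r = (\<Sum>x\<in>{..<2 ^ l} \<times> {..<k}. scal (c x) (G x))"
  proof
    fix j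
    have *: "(\<Sum>x\<in>{..<2 ^ l} \<times> {..<k}. scal (c x) (G x)) j
        = (\<Sum>b<2^l. \<Sum>m<k. c (b, m) * G (b, m) j)"
      by (simp add: fun_sum_apply scal_def sum.cartesian_product)
    show "lev_approx N k l r j = (\<Sum>x\<in>{..<2 ^ l} \<times> {..<k}. scal (c x) (G x)) j"
    proof (cases "j \<in> {1..N}")
      case True
      have "(\<Sum>b<2^l. \<Sum>m<k. c (b, m) * G (b, m) j)
          = (\<Sum>b<2^l. if b = blk N l j then \<Sum>m<k. c (b, m) * real j ^ m else 0)"
        using True by (intro sum.cong) (auto simp: G_def)
      also have "\<dots> = (\<Sum>m<k. c (blk N l j, m) * real j ^ m)"
        using blk_less[OF True, of l] by simp
      also have "\<dots> = lev_approx N k l r j"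
      proof (cases "blk N l r < blk N l j")
        case lt: True
        then have "r \<le> j" using blk_mono[of j r N l] by linarith
        then have "phi N k r j = poly p (real j)" using p(2) True by auto
        also have "\<dots> = (\<Sum>m<k. coeff p m * real j ^ m)"
          using p(1) by (simp add: poly_altdef, intro sum.mono_neutral_left) (auto simp: coeff_eq_0)
        finally show ?thesis using False lt by (simp add: lev_approx_def c_def)
      next
        case False
        then show ?thesis using \<open>\<not> N \<le> 2 ^ l\<close> by (simp add: lev_approx_def c_def)
      qed
      finally show ?thesis using * by simp
    next
      case out: False
      then have "phi N k r j = 0"
        using phi_supp[of k r N] assms unfolding supp_on_def by auto
      then show ?thesis unfolding * using out by (auto simp: lev_approx_def G_def)
    qed
  qed
  also have "\<dots> \<in> spn (G ` ({..<2 ^ l} \<times> {..<k}))"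
    by (intro fun_vs.span_sum spn_scal fun_vs.span_base) auto
  finally show ?thesis using False by (simp add: lev_gen_def G_def)
qed

text \<open>The error sits on at most N / 2^l + 1 entries next to the knot, where the truncated
  power is at most (2 / 2^l)^(k - 1). Since 2^l is below N in the nontrivial case, a factor 2 pays
  for each +1, and the squared norm is at most N (2 / 2^l)^(2 k - 1).\<close>

lemma lev_approx_err:
  assumes "1 \<le> k" "k < r" "r \<le> N"
  shows "L2_set (phi N k r - lev_approx N k l r) {1..N}
           \<le> sqrt (real N) * 2 powr ((real k - 1/2) * (1 - real l))"
proof (cases "N \<le> 2 ^ l")
  case True
  then show ?thesis by (simp add: lev_approx_def L2_set_def)
next
  case False
  then have big: "(2::real) ^ l \<le> real N" by (metis nat_le_linear of_nat_le_iff of_nat_numeral of_nat_power)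
  let ?e = "phi N k r - lev_approx N k l r" and ?x = "2 / 2 ^ l :: real"
  have e: "(?e j)\<^sup>2 \<le> (if j \<in> {r..r + N div 2 ^ l} then ?x ^ (2 * (k - 1)) else 0)"
    if j: "j \<in> {1..N}" for j
  proof (cases "blk N l j = blk N l r \<and> r \<le> j")
    case True
    have w: "(j - r) * 2 ^ l < N" using True assms by (intro blk_eq_width) auto
    then have "j - r \<le> N div 2 ^ l" using less_eq_div_iff_mult_less_eq[of "2 ^ l"] by simp
    then have jin: "j \<in> {r..r + N div 2 ^ l}" using True by auto
    have "real (j - r) * 2 ^ l \<le> real N"
      using w by (metis less_imp_le_nat of_nat_le_iff of_nat_mult of_nat_numeral of_nat_power)
    then have "(real (j - r) + 1) * 2 ^ l \<le> 2 * real N"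
      unfolding distrib_right using big by linarith
    then have "(real (j - r) + 1) / real N \<le> ?x"
      using assms by (simp add: field_simps)
    then have "((real (j - r) + 1) / real N) ^ (k - 1) \<le> ?x ^ (k - 1)"
      by (intro power_mono) auto
    then have "phi N k r j \<le> ?x ^ (k - 1)" using phi_le[of k r j N] True j assms by auto
    moreover have "0 \<le> phi N k r j" using phi_nonneg[of k r N j] assms by simp
    ultimately have "(phi N k r j)\<^sup>2 \<le> (?x ^ (k - 1))\<^sup>2" by (rule power_mono)
    moreover have "?e j = phi N k r j" using True False by (simp add: lev_approx_def)
    ultimately show ?thesis using jin by (simp add: power_mult[symmetric] mult.commute)
  next
    case ne: False
    have "?e j = 0"
    proof (cases "r \<le> j")
      case True
      then show ?thesis using blk_mono[of r j N l] ne by (auto simp: lev_approx_def)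
    next
      case False
      then show ?thesis using assms by (simp add: lev_approx_def phi_closed)
    qed
    then show ?thesis by simp
  qed
  have "(L2_set ?e {1..N})\<^sup>2 = (\<Sum>j\<in>{1..N}. (?e j)\<^sup>2)"
    by (simp add: L2_set_def sum_nonneg)
  also have "\<dots> \<le> (\<Sum>j\<in>{1..N}. if j \<in> {r..r + N div 2 ^ l} then ?x ^ (2 * (k - 1)) else 0)"
    by (intro sum_mono e)
  also have "\<dots> = (\<Sum>j\<in>{1..N} \<inter> {r..r + N div 2 ^ l}. ?x ^ (2 * (k - 1)))"
    by (subst sum.inter_restrict) auto
  also have "\<dots> \<le> (\<Sum>j\<in>{r..r + N div 2 ^ l}. ?x ^ (2 * (k - 1)))"
    by (intro sum_mono2) auto
  also have "\<dots> = (real (N div 2 ^ l) + 1) * ?x ^ (2 * (k - 1))" by simp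
  also have "\<dots> \<le> (real N * ?x) * ?x ^ (2 * (k - 1))"
  proof (intro mult_right_mono)
    have "real (N div 2 ^ l) \<le> real N / 2 ^ l"
      using of_nat_div_le_of_nat[where ?'a = real, of N "2 ^ l"] by simp
    moreover have "1 \<le> real N / 2 ^ l" using big by (simp add: field_simps)
    moreover have "real N * ?x = real N / 2 ^ l + real N / 2 ^ l" by simp
    ultimately show "real (N div 2 ^ l) + 1 \<le> real N * ?x" by linarith
  qed simp
  also have "\<dots> = real N * ?x ^ (2 * k - 1)"
    using assms(1) by (cases k) (auto simp: mult.assoc)
  finally have *: "(L2_set ?e {1..N})\<^sup>2 \<le> real N * ?x ^ (2 * k - 1)" .
  have "L2_set ?e {1..N} \<le> sqrt (real N * ?x ^ (2 * k - 1))"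
    using * by (intro real_le_rsqrt)
  also have "sqrt (?x ^ (2 * k - 1)) = 2 powr ((real k - 1/2) * (1 - real l))"
  proof -
    have x: "?x = 2 powr (1 - real l)" by (simp add: powr_diff powr_realpow)
    have "sqrt (?x ^ (2 * k - 1)) = (?x powr real (2 * k - 1)) powr (1/2)"
      by (simp add: powr_half_sqrt powr_realpow)
    also have "\<dots> = 2 powr ((1 - real l) * real (2 * k - 1) * (1/2))"
      unfolding x by (simp add: powr_powr)
    also have "(1 - real l) * real (2 * k - 1) * (1/2) = (real k - 1/2) * (1 - real l)"
      using assms(1) by (simp add: of_nat_diff field_simps)
    finally show ?thesis .
  qed
  then have "sqrt (real N * ?x ^ (2 * k - 1)) = sqrt (real N) * 2 powr ((real k - 1/2) * (1 - real l))"
    by (simp only: real_sqrt_mult)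
  finally show ?thesis .
qed

text \<open>Telescoping differences of the approximants. The polynomial parts do not decay with the
  level, so they are all placed at level 0.\<close>

definition lev_part :: "nat \<Rightarrow> nat \<Rightarrow> nat \<Rightarrow> nat \<Rightarrow> nat \<Rightarrow> real" where
  "lev_part N k l r =
     (if r \<le> k then (if l = 0 then phit N k r else 0)
      else (if l = 0 then phit N k r - phi N k r + lev_approx N k 0 r
            else lev_approx N k l r - lev_approx N k (l - 1) r))"

text \<open>Generators for a difference of two consecutive levels and for the polynomial part; at
  level 0 truncated subtraction merely lists the same generators twice.\<close>

definition lev_set :: "nat \<Rightarrow> nat \<Rightarrow> nat \<Rightarrow> (nat \<Rightarrow> real) set" where
  "lev_set N k l = phid N k \<union> lev_gen N k l \<union> lev_gen N k (l - 1)"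

text \<open>One constant for three bounds: 3 k for the number of generators, 2 + 2^g for the norm at
  level 0 and 2^g (2^g + 1) for the norm at later levels, where g = k - 1/2.\<close>

definition lev_const :: "nat \<Rightarrow> real" where
  "lev_const k = 3 * real k + 2 + 2 powr (real k - 1/2) * (2 powr (real k - 1/2) + 1)"

lemma lev_const_ge: "3 * real k \<le> lev_const k" "1 \<le> lev_const k"
  by (auto simp: lev_const_def intro: add_nonneg_nonneg)

lemma lev_set_props:
  assumes "1 \<le> k"
  shows "finite (lev_set N k l)" "real (card (lev_set N k l)) \<le> lev_const k * 2 ^ l"
    and "lev_set N k l \<subseteq> supp_on {1..N}"
proof -
  note g = lev_gen_props[OF assms]
  show "finite (lev_set N k l)" by (simp add: lev_set_def finite_phid g)
  show "lev_set N k l \<subseteq> supp_on {1..N}" using g(3) phid_supp by (auto simp: lev_set_def)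
  have "card (phid N k) \<le> k"
    unfolding phid_def Setcompr_eq_image using card_image_le[of "{1..k}" "\<lambda>l. phi N l l"] by simp
  moreover have "k \<le> k * 2 ^ l" by simp
  moreover have "k * 2 ^ (l - 1) \<le> k * (2 ^ l :: nat)" by (simp add: power_increasing)
  ultimately have "card (lev_set N k l) \<le> 3 * k * 2 ^ l"
    unfolding lev_set_def
    using card_Un_le[of "phid N k \<union> lev_gen N k l" "lev_gen N k (l - 1)"]
      card_Un_le[of "phid N k" "lev_gen N k l"] g(2)[of N l] g(2)[of N "l - 1"] by linarith
  then have "real (card (lev_set N k l)) \<le> 3 * real k * 2 ^ l"
    by (metis (no_types, lifting) of_nat_le_iff of_nat_mult of_nat_numeral of_nat_power)
  also have "\<dots> \<le> lev_const k * 2 ^ l" using lev_const_ge by (intro mult_right_mono) auto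
  finally show "real (card (lev_set N k l)) \<le> lev_const k * 2 ^ l" .
qed

lemma lev_part_span:
  assumes "1 \<le> k" "k \<le> N" "r \<in> {1..N}"
  shows "lev_part N k l r \<in> spn (lev_set N k l)"
proof -
  have sub: "spn (phid N k) \<subseteq> spn (lev_set N k l)" "spn (lev_gen N k l) \<subseteq> spn (lev_set N k l)"
     "spn (lev_gen N k (l - 1)) \<subseteq> spn (lev_set N k l)"
    by (auto simp: lev_set_def intro!: fun_vs.span_mono)
  show ?thesis
  proof (cases "r \<le> k")
    case True
    then have "phit N k r \<in> spn (phid N k)" using assms by (intro phit_low_span) auto
    then show ?thesis
      using sub(1) fun_vs.span_zero[of "lev_set N k l"] True unfolding lev_part_def by (cases "l = 0") auto
  next
    case False
    have "- (phi N k r - phit N k r) \<in> spn (phid N k)"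
      using phit_high_props(1)[of k r N] assms False by (intro fun_vs.span_neg) auto
    then have 1: "phit N k r - phi N k r \<in> spn (lev_set N k l)" using sub(1) by auto
    have 2: "lev_approx N k l r \<in> spn (lev_set N k l)" "lev_approx N k (l - 1) r \<in> spn (lev_set N k l)"
      using lev_approx_span[of k r N] assms False sub by (auto simp del: One_nat_def)
    show ?thesis
      using False fun_vs.span_add[OF 1 2(1)] fun_vs.span_diff[OF 2] unfolding lev_part_def by auto
  qed
qed

lemma L2_phi_le:
  assumes "1 \<le> k" "k < r"
  shows "L2_set (phi N k r) {1..N} \<le> sqrt (real N)"
proof -
  have "(phi N k r j)\<^sup>2 \<le> 1" if j: "j \<in> {1..N}" for j
  proof (cases "r \<le> j")
    case True
    have "((real (j - r) + 1) / real N) ^ (k - 1) \<le> 1"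
      using True j assms by (intro power_le_one) (auto simp: of_nat_diff field_simps)
    then have "phi N k r j \<le> 1" using phi_le[of k r j N] True j assms by auto
    then show ?thesis using phi_nonneg[of k r N j] assms by (simp add: power_le_one)
  qed (use assms in \<open>simp add: phi_closed\<close>)
  then have "(\<Sum>j\<in>{1..N}. (phi N k r j)\<^sup>2) \<le> (\<Sum>j\<in>{1..N}. 1)" by (intro sum_mono)
  then show ?thesis by (simp add: L2_set_def)
qed

lemma lev_part_norm:
  assumes "1 \<le> k" "k \<le> N" "r \<in> {1..N}"
  shows "L2_set (lev_part N k l r) {1..N} \<le> lev_const k * sqrt (real N) * 2 powr (- (real k - 1/2) * real l)"
proof -
  let ?g = "real k - 1/2" and ?n = "\<lambda>f. L2_set f {1..N}" and ?s = "sqrt (real N)"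
  show ?thesis
  proof (cases "r \<le> k")
    case True
    show ?thesis
    proof (cases "l = 0")
      case l: True
      have "?n (phit N k r) = ?s" using phit_low_ip[of r k r N] True assms by (simp add: L2_set_ip)
      also have "\<dots> \<le> lev_const k * ?s" using lev_const_ge(2)[of k] by (simp add: mult_le_cancel_right1)
      finally show ?thesis using True l by (simp add: lev_part_def)
    next
      case False
      then show ?thesis using True lev_const_ge(2)[of k] by (simp add: lev_part_def L2_set_def)
    qed
  next
    case False
    then have r: "k < r" "r \<le> N" using assms by auto
    let ?e = "\<lambda>l. phi N k r - lev_approx N k l r"
    note e = lev_approx_err[OF assms(1) r]
    show ?thesis
    proof (cases "l = 0")
      case True
      \<comment> \<open>The last difference is the projection of \<open>phi N k r\<close> onto the
        polynomials, so its norm is at most that of \<open>phi N k r\<close>.\<close>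
      have "lev_part N k l r = (phi N k r - ?e 0) - (phi N k r - phit N k r)"
        using True r by (simp add: lev_part_def)
      then have "?n (lev_part N k l r) = ?n ((phi N k r - ?e 0) - (phi N k r - phit N k r))"
        by (rule arg_cong)
      then have "?n (lev_part N k l r) \<le> ?n (phi N k r) + ?n (?e 0) + ?n (phi N k r - phit N k r)"
        using L2_set_fun_diff[of "phi N k r - ?e 0" "phi N k r - phit N k r" "{1..N}"]
          L2_set_fun_diff[of "phi N k r" "?e 0" "{1..N}"] by linarith
      also have "?n (phi N k r - phit N k r) \<le> ?n (phi N k r)"
        using phit_high_props(4)[OF assms(1) r(1), of N] by (simp add: L2_set_ip)
      also have "?n (phi N k r) \<le> ?s" by (rule L2_phi_le[OF assms(1) r(1)])
      also have "?n (?e 0) \<le> ?s * 2 powr ?g" using e[of 0] by simp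
      also have "?s + ?s * 2 powr ?g + ?s \<le> lev_const k * ?s"
      proof -
        have "2 + 2 powr ?g \<le> lev_const k"
          by (simp add: lev_const_def algebra_simps add_nonneg_nonneg)
        then have "(2 + 2 powr ?g) * ?s \<le> lev_const k * ?s" by (intro mult_right_mono) auto
        then show ?thesis by (simp add: algebra_simps)
      qed
      finally show ?thesis using True by simp
    next
      case l: False
      then obtain m where m: "l = Suc m" by (cases l) auto
      have ring: "g * (1 - real m) = g + g + (- g * real (Suc m))"
        "g * (1 - real l) = g + (- g * real l)" for g :: real
        by (simp_all add: algebra_simps)
      have "lev_part N k l r = ?e m - ?e l" using m r by (simp add: lev_part_def)
      then have "?n (lev_part N k l r) \<le> ?n (?e m) + ?n (?e l)"
        using L2_set_fun_diff[of "?e m" "?e l" "{1..N}"] by simp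
      also have "\<dots> \<le> ?s * 2 powr (?g * (1 - real m)) + ?s * 2 powr (?g * (1 - real l))"
        by (intro add_mono e)
      also have "?g * (1 - real m) = ?g + ?g + (- ?g * real l)"
        using ring[of ?g] by (simp only: m)
      also have "?g * (1 - real l) = ?g + (- ?g * real l)" by (rule ring)
      also have "?s * 2 powr (?g + ?g + (- ?g * real l)) + ?s * 2 powr (?g + (- ?g * real l))
          = (2 powr ?g * (2 powr ?g + 1)) * (?s * 2 powr (- ?g * real l))"
        unfolding powr_add by (simp add: algebra_simps)
      also have "\<dots> \<le> lev_const k * (?s * 2 powr (- ?g * real l))"
        by (intro mult_right_mono) (auto simp: lev_const_def)
      finally show ?thesis by (simp add: mult.assoc)
    qed
  qed
qed

lemma lev_part_sum:
  assumes "N \<le> 2 ^ L"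
  shows "(\<Sum>l\<le>L. lev_part N k l r) = phit N k r"
proof (cases "r \<le> k")
  case True
  then have "(\<Sum>l\<le>L. lev_part N k l r) = (\<Sum>l\<le>L. if l = 0 then phit N k r else 0)"
    by (intro sum.cong) (auto simp: lev_part_def)
  also have "\<dots> = phit N k r" by (subst sum.delta) auto
  finally show ?thesis .
next
  case False
  have "(\<Sum>l\<le>m. lev_part N k l r) = phit N k r - phi N k r + lev_approx N k m r" for m
    using False by (induction m) (auto simp: lev_part_def fun_eq_iff)
  moreover have "lev_approx N k L r = phi N k r" using assms by (simp add: lev_approx_def)
  ultimately show ?thesis by simp
qed

section \<open>Tensors and the ANOVA decomposition\<close>

declare One_nat_def [simp del]

lemma scal_of_bool: "scal (of_bool P) f = (if P then f else 0)"
  by (simp add: scal_def fun_eq_iff)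

definition tens :: "idx \<Rightarrow> nat set \<Rightarrow> (nat \<Rightarrow> nat \<Rightarrow> real) \<Rightarrow> tensor" where
  "tens n K f = (\<lambda>j. if j \<in> ibox n K then (\<Prod>i\<in>K. f i (j i)) else 0)"

lemma finite_ibox: "finite K \<Longrightarrow> finite (ibox n K)"
  unfolding ibox_def by (intro finite_PiE) auto

lemma card_ibox: "finite K \<Longrightarrow> card (ibox n K) = numel n K"
  by (simp add: ibox_def numel_def card_PiE)

lemma phit_tensor_tens: "phit_tensor n k K q = tens n K (\<lambda>i. phit (n i) k (q i))"
  by (simp add: phit_tensor_def tens_def)

lemma tens_supp: "tens n K f \<in> supp_on (ibox n K)"
  by (simp add: tens_def supp_on_def)

lemma ip_tens:
  assumes "finite K"
  shows "ip (ibox n K) (tens n K f) (tens n K g) = (\<Prod>i\<in>K. ip {1..n i} (f i) (g i))"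
proof -
  have "ip (ibox n K) (tens n K f) (tens n K g) = (\<Sum>j\<in>ibox n K. \<Prod>i\<in>K. f i (j i) * g i (j i))"
    unfolding ip_def tens_def by (intro sum.cong) (auto simp: prod.distrib)
  also have "\<dots> = (\<Prod>i\<in>K. ip {1..n i} (f i) (g i))"
    unfolding ip_def ibox_def by (rule prod_sum_PiE[symmetric]) (use assms in auto)
  finally show ?thesis .
qed

lemma tens_sum:
  assumes "finite K" "\<And>i. i \<in> K \<Longrightarrow> finite (S i)"
    and "\<And>i. i \<in> K \<Longrightarrow> f i = (\<Sum>s\<in>S i. scal (c i s) (v i s))"
  shows "tens n K f = (\<Sum>q\<in>PiE K S. scal (\<Prod>i\<in>K. c i (q i)) (tens n K (\<lambda>i. v i (q i))))"
proof
  fix j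
  have "(\<Prod>i\<in>K. f i (j i)) = (\<Prod>i\<in>K. \<Sum>s\<in>S i. c i s * v i s (j i))"
    by (intro prod.cong) (auto simp: assms(3) fun_sum_apply scal_def)
  also have "\<dots> = (\<Sum>q\<in>PiE K S. \<Prod>i\<in>K. c i (q i) * v i (q i) (j i))"
    by (rule prod_sum_PiE) (use assms in auto)
  finally show "tens n K f j = (\<Sum>q\<in>PiE K S. scal (\<Prod>i\<in>K. c i (q i)) (tens n K (\<lambda>i. v i (q i)))) j"
    by (simp add: tens_def fun_sum_apply scal_def prod.distrib)
qed

lemma span_image_coeffs:
  assumes "finite S" "f \<in> spn (v ` S)"
  shows "\<exists>c. f = (\<Sum>s\<in>S. scal (c s) (v s))"
  using assms(2)
proof (induction rule: spn_induct)
  case (base w)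
  then obtain s where s: "s \<in> S" "w = v s" by auto
  have "(\<Sum>t\<in>S. scal (of_bool (t = s)) (v t)) = (\<Sum>t\<in>S. if t = s then v s else 0)"
    by (intro sum.cong refl) (auto simp: scal_def fun_eq_iff)
  also have "\<dots> = w" using s assms(1) by simp
  finally have "w = (\<Sum>t\<in>S. scal (of_bool (t = s)) (v t))" by simp
  then show ?case by (rule exI[of _ "\<lambda>t. of_bool (t = s)"])
next
  case zero
  have "(\<Sum>s\<in>S. scal 0 (v s)) = 0" by (intro sum.neutral) (auto simp: scal_def fun_eq_iff)
  then have "0 = (\<Sum>s\<in>S. scal 0 (v s))" by (rule sym)
  then show ?case by (rule exI[of _ "\<lambda>_. 0"])
next
  case (add f g)
  then obtain c c' where "f = (\<Sum>s\<in>S. scal (c s) (v s))" "g = (\<Sum>s\<in>S. scal (c' s) (v s))" by blast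
  then have "f + g = (\<Sum>s\<in>S. scal (c s + c' s) (v s))"
    by (auto simp: fun_eq_iff fun_sum_apply scal_def algebra_simps sum.distrib)
  then show ?case by (rule exI[of _ "\<lambda>s. c s + c' s"])
next
  case (scal r f)
  then obtain c where c: "f = (\<Sum>s\<in>S. scal (c s) (v s))" ..
  have "scal r f = (\<Sum>s\<in>S. scal (r * c s) (v s))"
    unfolding c by (rule ext) (simp only: fun_sum_apply scal_def mult.assoc sum_distrib_left)
  then show ?case by (rule exI[of _ "\<lambda>s. r * c s"])
qed

lemma tens_span_idx:
  assumes "finite K" "\<And>i. i \<in> K \<Longrightarrow> finite (S i)" "\<And>i. i \<in> K \<Longrightarrow> f i \<in> spn (v i ` S i)"
  shows "tens n K f \<in> spn ((\<lambda>q. tens n K (\<lambda>i. v i (q i))) ` PiE K S)"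
proof -
  have "\<forall>i. \<exists>c. i \<in> K \<longrightarrow> f i = (\<Sum>s\<in>S i. scal (c s) (v i s))"
    using span_image_coeffs assms by blast
  then obtain c where c: "\<And>i. i \<in> K \<Longrightarrow> f i = (\<Sum>s\<in>S i. scal (c i s) (v i s))" by metis
  have "tens n K f = (\<Sum>q\<in>PiE K S. scal (\<Prod>i\<in>K. c i (q i)) (tens n K (\<lambda>i. v i (q i))))"
    by (rule tens_sum) (use assms c in auto)
  also have "\<dots> \<in> spn ((\<lambda>q. tens n K (\<lambda>i. v i (q i))) ` PiE K S)"
    by (intro fun_vs.span_sum spn_scal fun_vs.span_base) auto
  finally show ?thesis .
qed

text \<open>The projection kernels come from expanding the identity kernel, the product over the coordinates
  of \<open>hi_part\<close> plus the rank-one projections on the low vectors.\<close>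

definition comp_ker :: "nat \<Rightarrow> idx \<Rightarrow> nat \<Rightarrow> nat set \<Rightarrow> idx \<Rightarrow> idx \<Rightarrow> tensor" where
  "comp_ker d n k M h y = tens n {1..d}
     (\<lambda>i. if i \<in> M then hi_part (n i) k (kdelta (y i))
          else scal (phit (n i) k (h i) (y i) / real (n i)) (phit (n i) k (h i)))"

definition comp_gen :: "nat \<Rightarrow> idx \<Rightarrow> nat \<Rightarrow> nat set \<Rightarrow> idx \<Rightarrow> tensor set" where
  "comp_gen d n k M h = phit_tensor n k {1..d} ` anova_idx d n k M h"

lemma comp_gen_supp: "comp_gen d n k M h \<subseteq> supp_on (ibox n {1..d})"
  by (auto simp: comp_gen_def phit_tensor_tens tens_supp)

lemma h_range_mem: "h \<in> h_range d k M \<Longrightarrow> i \<in> {1..d} \<Longrightarrow> i \<notin> M \<Longrightarrow> h i \<in> {1..k}"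
  by (auto simp: h_range_def)

section \<open>Orthogonal decomposition of the tensors over a box\<close>

locale box =
  fixes d :: nat and n :: idx and k :: nat
  assumes k1: "1 \<le> k" and nk: "\<And>i. i \<in> {1..d} \<Longrightarrow> k + 1 \<le> n i"
begin

abbreviation "B \<equiv> ibox n {1..d}"

abbreviation "vol \<equiv> real (numel n {1..d})"

abbreviation "psi \<equiv> phit_tensor n k {1..d}"
abbreviation "psis \<equiv> phit_tensor n k"
abbreviation "DD \<equiv> D_set n k"
abbreviation "pen \<equiv> D_norm1 n k"
abbreviation "bars \<equiv> bar_space n k"
abbreviation "abar \<equiv> anova_bar d n k"
abbreviation "fit \<equiv> bar_est d n k"
abbreviation "gens \<equiv> comp_gen d n k"

lemma nk': "i \<in> {1..d} \<Longrightarrow> k \<le> n i" "i \<in> {1..d} \<Longrightarrow> 0 < n i"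
  using nk[of i] by auto

lemma finite_B [simp]: "finite B"
  by (simp add: finite_ibox)

lemma comp_ker_span:
  assumes "M \<subseteq> {1..d}" "h \<in> h_range d k M" "y \<in> B"
  shows "comp_ker d n k M h y \<in> spn (gens M h)"
proof -
  have "comp_ker d n k M h y \<in> spn ((\<lambda>q. tens n {1..d} (\<lambda>i. phit (n i) k (q i))) `
          PiE {1..d} (\<lambda>i. if i \<in> M then {k + 1..n i} else {h i}))"
    unfolding comp_ker_def
  proof (rule tens_span_idx[where v = "\<lambda>i. phit (n i) k"])
    fix i assume i: "i \<in> {1..d}"
    have yi: "y i \<in> {1..n i}" using assms(3) i by (auto simp: ibox_def)
    show "(if i \<in> M then hi_part (n i) k (kdelta (y i))
          else scal (phit (n i) k (h i) (y i) / real (n i)) (phit (n i) k (h i)))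
       \<in> spn (phit (n i) k ` (if i \<in> M then {k + 1..n i} else {h i}))"
      using hi_part_kdelta_span[OF k1 nk'(1)[OF i] yi]
        spn_scal[OF fun_vs.span_base[of "phit (n i) k (h i)" "phit (n i) k ` {h i}"]]
      by (cases "i \<in> M") (simp_all del: One_nat_def)
  qed auto
  then show ?thesis by (simp add: comp_gen_def anova_idx_def phit_tensor_tens)
qed

text \<open>Inner products of product tensors factorize, so one orthogonal coordinate suffices:
  where the sets M differ a high vector meets a low one, and where they agree some two low indices
  differ.\<close>

lemma comp_gen_orth:
  assumes "M \<subseteq> {1..d}" "h \<in> h_range d k M" "M' \<subseteq> {1..d}" "h' \<in> h_range d k M'"
    and "(M, h) \<noteq> (M', h')" "x \<in> spn (gens M h)" "y \<in> spn (gens M' h')"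
  shows "ip B x y = 0"
  using assms(6,7)
proof (rule ip_spn_spn_eq_0)
  fix w v assume "w \<in> gens M h" "v \<in> gens M' h'"
  then obtain q q' where q: "w = psi q" "q \<in> anova_idx d n k M h"
    and q': "v = psi q'" "q' \<in> anova_idx d n k M' h'"
    by (auto simp: comp_gen_def)
  have qi: "q i \<in> (if i \<in> M then {k + 1..n i} else {h i})"
     "q' i \<in> (if i \<in> M' then {k + 1..n i} else {h' i})" if "i \<in> {1..d}" for i
    using PiE_mem[OF q(2)[unfolded anova_idx_def] that] PiE_mem[OF q'(2)[unfolded anova_idx_def] that] by auto
  have "\<exists>i\<in>{1..d}. ip {1..n i} (phit (n i) k (q i)) (phit (n i) k (q' i)) = 0"
  proof (cases "M = M'")
    case True
    then have "h \<noteq> h'" using assms(5) by auto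
    then obtain i where "h i \<noteq> h' i" by auto
    have i: "i \<in> {1..d} - M"
    proof (rule ccontr)
      assume "i \<notin> {1..d} - M"
      then have "h i = undefined" "h' i = undefined"
        using PiE_arb[OF assms(2)[unfolded h_range_def], of i] PiE_arb[OF assms(4)[unfolded h_range_def], of i] True
        by blast+
      then show False using \<open>h i \<noteq> h' i\<close> by simp
    qed
    then have "q i = h i" "q' i = h' i" "h i \<in> {1..k}" "h' i \<in> {1..k}"
      using qi[of i] True assms(2,4) h_range_mem[of h d k M i] h_range_mem[of h' d k M' i] by auto
    then have "ip {1..n i} (phit (n i) k (q i)) (phit (n i) k (q' i)) = 0"
      using \<open>h i \<noteq> h' i\<close> phit_low_ip[of "h i" k "h' i" "n i"] nk'(1)[of i] i by simp
    then show ?thesis using i by blast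
  next
    case False
    then obtain i where i: "i \<in> M \<and> i \<notin> M' \<or> i \<in> M' \<and> i \<notin> M" by auto
    then have id: "i \<in> {1..d}" using assms by auto
    have "ip {1..n i} (phit (n i) k (q i)) (phit (n i) k (q' i)) = 0"
      using i
    proof
      assume "i \<in> M \<and> i \<notin> M'"
      then have "k < q i" "q' i \<in> {1..k}"
        using qi[OF id] h_range_mem[OF assms(4) id] by auto
      then show ?thesis using phit_high_low_ip nk'(1)[OF id] by blast
    next
      assume "i \<in> M' \<and> i \<notin> M"
      then have "k < q' i" "q i \<in> {1..k}"
        using qi[OF id] h_range_mem[OF assms(2) id] by auto
      then show ?thesis using phit_high_low_ip nk'(1)[OF id] by (subst ip_commute) blast
    qed
    then show ?thesis using id by blast
  qed
  then show "ip B w v = 0"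
    unfolding q(1) q'(1) phit_tensor_tens by (subst ip_tens) auto
qed

lemma comp_ker_sum:
  assumes "y \<in> B" "j \<in> B"
  shows "(\<Sum>M\<in>Pow {1..d}. \<Sum>h\<in>h_range d k M. comp_ker d n k M h y j) = kdelta y j"
proof -
  let ?D = "{1..d}"
  define a where "a i = hi_part (n i) k (kdelta (y i)) (j i)" for i
  define b where "b i r = phit (n i) k r (y i) / real (n i) * phit (n i) k r (j i)" for i r
  have y: "y i \<in> {1..n i}" if "i \<in> ?D" for i using assms(1) that by (auto simp: ibox_def)
  have comp: "comp_ker d n k M h y j = (\<Prod>i\<in>M. a i) * (\<Prod>i\<in>?D - M. b i (h i))" if "M \<subseteq> ?D" for M h
  proof -
    have "comp_ker d n k M h y j = (\<Prod>i\<in>?D. if i \<in> M then a i else b i (h i))"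
      using assms(2) by (auto simp: comp_ker_def tens_def a_def b_def scal_def intro!: prod.cong)
    also have "\<dots> = (\<Prod>i\<in>M. a i) * (\<Prod>i\<in>?D - M. b i (h i))"
      using that by (subst prod.If_cases) (auto simp: Int_absorb1 Diff_eq)
    finally show ?thesis .
  qed
  have "(\<Sum>M\<in>Pow ?D. \<Sum>h\<in>h_range d k M. comp_ker d n k M h y j)
      = (\<Sum>M\<in>Pow ?D. (\<Prod>i\<in>M. a i) * (\<Sum>h\<in>h_range d k M. \<Prod>i\<in>?D - M. b i (h i)))"
    by (intro sum.cong) (auto simp: comp sum_distrib_left)
  \<comment> \<open>Distributivity is used twice: the sum over h factorizes over the coordinates
    outside M, and then M becomes the set of coordinates in which \<open>a\<close> is picked from a
    sum of two terms.\<close>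
  also have "\<dots> = (\<Sum>M\<in>Pow ?D. (\<Prod>i\<in>M. a i) * (\<Prod>i\<in>?D - M. \<Sum>r\<in>{1..k}. b i r))"
    unfolding h_range_def by (subst prod_sum_PiE) auto
  also have "\<dots> = (\<Prod>i\<in>?D. a i + (\<Sum>r\<in>{1..k}. b i r))"
    by (subst prod_add) auto
  also have "\<dots> = (\<Prod>i\<in>?D. kdelta (y i) (j i))"
  proof (intro prod.cong refl)
    fix i assume i: "i \<in> ?D"
    have "ip {1..n i} (kdelta (y i)) f = f (y i)" for f
    proof -
      have "ip {1..n i} (kdelta (y i)) f = (\<Sum>x\<in>{1..n i}. if x = y i then f x else 0)"
        unfolding ip_def by (intro sum.cong) (auto simp: kdelta_def)
      then show ?thesis using y[OF i] by simp
    qed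
    then show "a i + (\<Sum>r\<in>{1..k}. b i r) = kdelta (y i) (j i)"
      by (simp add: a_def b_def hi_part_def fun_sum_apply scal_def del: One_nat_def)
  qed
  also have "\<dots> = kdelta y j"
  proof (cases "j = y")
    case False
    then obtain i where "j i \<noteq> y i" by auto
    then have "i \<in> ?D" using assms unfolding ibox_def by (metis PiE_arb)
    then have "(\<Prod>i\<in>?D. kdelta (y i) (j i)) = 0"
      using \<open>j i \<noteq> y i\<close> by (auto simp: kdelta_def)
    then show ?thesis using False by (simp add: kdelta_def)
  qed (simp add: kdelta_def)
  finally show ?thesis .
qed

text \<open>The true signal is an arbitrary function, possibly nonzero off the box, whereas the
  components vanish there; only the values on the box are recovered.\<close>

definition box_cut :: "tensor \<Rightarrow> tensor" where
  "box_cut f = (\<lambda>j. if j \<in> B then f j else 0)"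

definition comp_proj :: "nat set \<Rightarrow> idx \<Rightarrow> tensor \<Rightarrow> tensor" where
  "comp_proj M h f = (\<Sum>y\<in>B. scal (f y) (comp_ker d n k M h y))"

lemma box_cut_decomp: "box_cut f = (\<Sum>M\<in>Pow {1..d}. \<Sum>h\<in>h_range d k M. comp_proj M h f)"
proof
  fix j
  show "box_cut f j = (\<Sum>M\<in>Pow {1..d}. \<Sum>h\<in>h_range d k M. comp_proj M h f) j"
  proof (cases "j \<in> B")
    case True
    have "(\<Sum>M\<in>Pow {1..d}. \<Sum>h\<in>h_range d k M. comp_proj M h f) j
        = (\<Sum>M\<in>Pow {1..d}. \<Sum>h\<in>h_range d k M. \<Sum>y\<in>B. f y * comp_ker d n k M h y j)"
      by (simp add: fun_sum_apply comp_proj_def scal_def)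
    also have "\<dots> = (\<Sum>M\<in>Pow {1..d}. \<Sum>y\<in>B. \<Sum>h\<in>h_range d k M. f y * comp_ker d n k M h y j)"
      by (rule sum.cong[OF refl]) (rule sum.swap)
    also have "\<dots> = (\<Sum>y\<in>B. \<Sum>M\<in>Pow {1..d}. \<Sum>h\<in>h_range d k M. f y * comp_ker d n k M h y j)"
      by (rule sum.swap)
    also have "\<dots> = (\<Sum>y\<in>B. f y * kdelta y j)"
      by (intro sum.cong refl) (simp add: sum_distrib_left[symmetric] comp_ker_sum True del: Pow_insert)
    also have "\<dots> = (\<Sum>y\<in>B. if y = j then f y else 0)"
      by (intro sum.cong) (auto simp: kdelta_def)
    finally show ?thesis using True by (simp add: box_cut_def)
  next
    case False
    then show ?thesis by (simp add: box_cut_def fun_sum_apply comp_proj_def scal_def comp_ker_def tens_def)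
  qed
qed

lemma comp_proj_span:
  assumes "M \<subseteq> {1..d}" "h \<in> h_range d k M"
  shows "comp_proj M h f \<in> spn (gens M h)"
  unfolding comp_proj_def by (intro fun_vs.span_sum spn_scal comp_ker_span assms)

lemma finite_h_range: "finite (h_range d k M)"
  unfolding h_range_def by (intro finite_PiE) auto

text \<open>Expanding \<open>f\<close> into its components, all but the one with the same label are
  orthogonal to \<open>x\<close>. This is the defining property of the projection, obtained without
  computing the kernel.\<close>

lemma ip_comp_proj:
  assumes "M \<subseteq> {1..d}" "h \<in> h_range d k M" "x \<in> spn (gens M h)"
  shows "ip B (comp_proj M h f) x = ip B f x"
proof -
  have "ip B f x = ip B (box_cut f) x" by (rule ip_cong) (auto simp: box_cut_def)
  also have "\<dots> = (\<Sum>M'\<in>Pow {1..d}. \<Sum>h'\<in>h_range d k M'. ip B (comp_proj M' h' f) x)"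
    unfolding box_cut_decomp ip_sum_left ..
  also have "\<dots> = (\<Sum>M'\<in>Pow {1..d}. \<Sum>h'\<in>h_range d k M'.
      if M' = M \<and> h' = h then ip B (comp_proj M h f) x else 0)"
  proof (intro sum.cong refl)
    fix M' h' assume "M' \<in> Pow {1..d}" "h' \<in> h_range d k M'"
    then show "ip B (comp_proj M' h' f) x = (if M' = M \<and> h' = h then ip B (comp_proj M h f) x else 0)"
      using comp_gen_orth[of M' h' M h "comp_proj M' h' f" x] assms comp_proj_span by auto
  qed
  also have "\<dots> = (\<Sum>M'\<in>Pow {1..d}. if M' = M then ip B (comp_proj M h f) x else 0)"
  proof (intro sum.cong refl)
    fix M'
    have "(\<Sum>h'\<in>h_range d k M'. if M' = M \<and> h' = h then ip B (comp_proj M h f) x else 0)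
       = (if M' = M then \<Sum>h'\<in>h_range d k M. if h' = h then ip B (comp_proj M h f) x else 0 else 0)"
      by auto
    then show "(\<Sum>h'\<in>h_range d k M'. if M' = M \<and> h' = h then ip B (comp_proj M h f) x else 0)
       = (if M' = M then ip B (comp_proj M h f) x else 0)"
      using assms(2) finite_h_range by simp
  qed
  also have "\<dots> = ip B (comp_proj M h f) x" using assms(1) by (subst sum.delta) auto
  finally show ?thesis by simp
qed

lemma anova_proj_eq:
  assumes "M \<subseteq> {1..d}" "h \<in> h_range d k M"
  shows "anova_proj d n k M h f = comp_proj M h f"
proof -
  have "orth_proj B (gens M h) f = comp_proj M h f"
  proof (rule orth_proj_eqI)
    fix w assume "w \<in> gens M h"
    then have "w \<in> spn (gens M h)" by (rule fun_vs.span_base)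
    then show "ip B (f - comp_proj M h f) w = 0" using ip_comp_proj[OF assms] by (simp add: ip_simps)
  qed (use assms comp_proj_span comp_gen_supp in auto)
  then show ?thesis by (simp add: anova_proj_def comp_gen_def)
qed

section \<open>Reduced tensors and their embedding into the box\<close>

abbreviation fl :: "nat set \<Rightarrow> idx \<Rightarrow> tensor \<Rightarrow> tensor" where
  "fl \<equiv> fill d n k"

lemma fl_linear:
  "fl M h (f + g) = fl M h f + fl M h g" "fl M h (f - g) = fl M h f - fl M h g"
  "fl M h (scal c f) = scal c (fl M h f)" "fl M h 0 = 0"
  by (auto simp: fill_def fun_eq_iff scal_def algebra_simps)

lemma fl_sum: "fl M h (\<Sum>i\<in>A. f i) = (\<Sum>i\<in>A. fl M h (f i))"
proof (induction A rule: infinite_finite_induct)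
  case (insert x F)
  then show ?case by (simp add: fl_linear(1) del: plus_fun_apply)
qed (use fl_linear(4) in \<open>simp_all add: zero_fun_def\<close>)

lemma restrict_ibox: "j \<in> B \<Longrightarrow> M \<subseteq> {1..d} \<Longrightarrow> restrict j M \<in> ibox n M"
  by (auto simp: ibox_def)

definition merge_idx :: "nat set \<Rightarrow> idx \<Rightarrow> idx \<Rightarrow> idx" where
  "merge_idx M q h = (\<lambda>i\<in>{1..d}. if i \<in> M then q i else h i)"

lemma fl_phit_tensor:
  assumes "M \<subseteq> {1..d}"
  shows "fl M h (psis M q) = psi (merge_idx M q h)"
proof
  fix j
  show "fl M h (psis M q) j = psi (merge_idx M q h) j"
  proof (cases "j \<in> B")
    case True
    have "(\<Prod>i\<in>{1..d}. phit (n i) k (merge_idx M q h i) (j i))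
        = (\<Prod>i\<in>{1..d} - M. phit (n i) k (merge_idx M q h i) (j i)) * (\<Prod>i\<in>M. phit (n i) k (merge_idx M q h i) (j i))"
      using assms by (intro prod.subset_diff) auto
    also have "(\<Prod>i\<in>{1..d} - M. phit (n i) k (merge_idx M q h i) (j i)) = (\<Prod>i\<in>{1..d} - M. phit (n i) k (h i) (j i))"
      by (intro prod.cong) (auto simp: merge_idx_def)
    also have "(\<Prod>i\<in>M. phit (n i) k (merge_idx M q h i) (j i)) = (\<Prod>i\<in>M. phit (n i) k (q i) (restrict j M i))"
      using assms by (intro prod.cong) (auto simp: merge_idx_def)
    finally show ?thesis
      using True restrict_ibox[OF True assms] by (simp add: fill_def phit_tensor_def mult.commute)
  qed (simp add: fill_def phit_tensor_def)
qed

definition high_idx :: "nat set \<Rightarrow> idx set" where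
  "high_idx M = PiE M (\<lambda>i. {k + 1..n i})"

lemma finite_high_idx: "M \<subseteq> {1..d} \<Longrightarrow> finite (high_idx M)"
  unfolding high_idx_def by (intro finite_PiE) (auto dest: finite_subset)

lemma bar_space_eq: "bars M = spn (psis M ` high_idx M)"
  by (simp add: bar_space_def high_idx_def)

lemma merge_idx_anova: "M \<subseteq> {1..d} \<Longrightarrow> q \<in> high_idx M \<Longrightarrow> merge_idx M q h \<in> anova_idx d n k M h"
  unfolding merge_idx_def anova_idx_def high_idx_def by (auto split: if_splits)

lemma merge_idx_B:
  assumes "M \<subseteq> {1..d}" "h \<in> h_range d k M" "q \<in> high_idx M"
  shows "merge_idx M q h \<in> B"
proof -
  have "merge_idx M q h i \<in> {1..n i}" if i: "i \<in> {1..d}" for i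
    using assms i h_range_mem[OF assms(2) i] nk'(1)[OF i]
    by (cases "i \<in> M") (auto simp: merge_idx_def high_idx_def PiE_iff)
  then show ?thesis by (auto simp: ibox_def merge_idx_def)
qed

lemma fl_bar_space:
  assumes "M \<subseteq> {1..d}" "g \<in> bars M"
  shows "fl M h g \<in> spn (gens M h)"
  using assms(2) unfolding bar_space_eq
proof (induction rule: spn_induct)
  case (base w)
  then show ?case
    using assms(1) by (auto simp: fl_phit_tensor comp_gen_def intro!: fun_vs.span_base merge_idx_anova)
next
  case zero show ?case unfolding fl_linear by (rule fun_vs.span_zero)
next
  case (add f g) then show ?case unfolding fl_linear by (rule fun_vs.span_add)
next
  case (scal r f) then show ?case unfolding fl_linear by (rule spn_scal)
qed

lemma fl_bar_space_surj:
  assumes "M \<subseteq> {1..d}" "x \<in> spn (gens M h)"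
  shows "\<exists>g\<in>bars M. fl M h g = x"
  using assms(2)
proof (induction rule: spn_induct)
  case (base w)
  then obtain q where q: "w = psi q" "q \<in> anova_idx d n k M h"
    by (auto simp: comp_gen_def)
  note q2 = q(2)[unfolded anova_idx_def]
  have "merge_idx M (restrict q M) h = q"
  proof
    fix i
    show "merge_idx M (restrict q M) h i = q i"
    proof (cases "i \<in> {1..d}")
      case True
      show ?thesis using PiE_mem[OF q2 True] True by (cases "i \<in> M") (auto simp: merge_idx_def)
    next
      case False
      show ?thesis using PiE_arb[OF q2 False] False by (auto simp: merge_idx_def)
    qed
  qed
  then have "fl M h (psis M (restrict q M)) = w"
    using fl_phit_tensor[OF assms(1), of h "restrict q M"] q(1) by simp
  moreover have "restrict q M \<in> high_idx M"
  proof -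
    have "q i \<in> {k + 1..n i}" if "i \<in> M" for i
      using PiE_mem[OF q2, of i] that assms(1) by auto
    then show ?thesis by (auto simp: high_idx_def)
  qed
  then have "psis M (restrict q M) \<in> bars M"
    unfolding bar_space_eq by (auto intro: fun_vs.span_base)
  ultimately show ?case by blast
next
  case zero
  show ?case using fl_linear(4) fun_vs.span_zero unfolding bar_space_eq by blast
next
  case (add f g)
  then obtain u v where "u \<in> bars M" "v \<in> bars M" "fl M h u = f" "fl M h v = g" by blast
  then show ?case
    by (intro bexI[of _ "u + v"]) (simp_all only: fl_linear bar_space_eq fun_vs.span_add)
next
  case (scal r f)
  then obtain u where "u \<in> bars M" "fl M h u = f" by blast
  then show ?case
    by (intro bexI[of _ "scal r u"]) (simp_all only: fl_linear bar_space_eq spn_scal)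
qed

lemma bar_space_supp:
  assumes "g \<in> bars M"
  shows "g \<in> supp_on (ibox n M)"
proof -
  have "psis M ` high_idx M \<subseteq> supp_on (ibox n M)" by (auto simp: phit_tensor_tens tens_supp)
  then show ?thesis using assms spn_subset_supp_on unfolding bar_space_eq by blast
qed

lemma tensors_supp: "tensors n M = supp_on (ibox n M)"
  by (simp add: tensors_def supp_on_def)

text \<open>The low vectors have positive norm, hence a nonzero entry each; evaluating at an index
  that passes through such entries outside M allows cancellation.\<close>

lemma fl_inj:
  assumes "M \<subseteq> {1..d}" "h \<in> h_range d k M" "f \<in> tensors n M" "g \<in> tensors n M" "fl M h f = fl M h g"
  shows "f = g"
proof
  fix x
  show "f x = g x"
  proof (cases "x \<in> ibox n M")
    case True
    have "\<exists>z\<in>{1..n i}. phit (n i) k (h i) z \<noteq> 0" if i: "i \<in> {1..d} - M" for i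
    proof (rule ccontr)
      assume "\<not> ?thesis"
      then have "ip {1..n i} (phit (n i) k (h i)) (phit (n i) k (h i)) = 0"
        by (simp add: ip_def)
      then show False
        using phit_low_ip[of "h i" k "h i" "n i"] h_range_mem[OF assms(2), of i] nk'[of i] i by simp
    qed
    then obtain z where z: "\<And>i. i \<in> {1..d} - M \<Longrightarrow> z i \<in> {1..n i} \<and> phit (n i) k (h i) (z i) \<noteq> 0"
      by metis
    define j where "j = merge_idx M x z"
    have jB: "j \<in> B" using z True assms(1) by (auto simp: j_def merge_idx_def ibox_def PiE_iff split: if_splits)
    have "restrict j M = x"
      using True assms(1) by (fastforce simp: j_def merge_idx_def ibox_def restrict_def fun_eq_iff PiE_iff extensional_def)
    moreover have "(\<Prod>i\<in>{1..d} - M. phit (n i) k (h i) (j i)) \<noteq> 0"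
      using z by (auto simp: j_def merge_idx_def)
    moreover have "fl M h f j = fl M h g j" using assms(5) by simp
    ultimately show ?thesis using jB by (simp add: fill_def)
  next
    case False
    then show ?thesis using assms(3,4) by (simp add: tensors_def)
  qed
qed

text \<open>Existence in the description of \<open>anova_bar\<close> comes from
  \<open>fl_bar_space_surj\<close>, uniqueness from \<open>fl_inj\<close>. Membership in
  \<open>bars M\<close> makes the reduced data comparable with the fit.\<close>

lemma anova_bar_props:
  assumes "M \<subseteq> {1..d}" "h \<in> h_range d k M"
  shows "abar M h f \<in> bars M" "fl M h (abar M h f) = comp_proj M h f"
proof -
  obtain g where g: "g \<in> bars M" "fl M h g = comp_proj M h f"
    using fl_bar_space_surj[OF assms(1) comp_proj_span[OF assms]] by blast
  have "abar M h f = g"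
    unfolding anova_bar_def anova_proj_eq[OF assms]
  proof (rule the_equality)
    show "g \<in> tensors n M \<and> comp_proj M h f = fl M h g"
      using g bar_space_supp by (simp add: tensors_supp)
    fix g' assume "g' \<in> tensors n M \<and> comp_proj M h f = fl M h g'"
    then show "g' = g"
      using fl_inj[OF assms, of g' g] g bar_space_supp by (simp add: tensors_supp)
  qed
  then show "abar M h f \<in> bars M" "fl M h (abar M h f) = comp_proj M h f"
    using g by auto
qed

text \<open>Each filled coordinate contributes the factor \<open>n i\<close>, the squared norm of a
  low vector, so \<open>fl\<close> is an isometry for inner products divided by the number of
  entries.\<close>

lemma ip_fl:
  assumes "M \<subseteq> {1..d}" "h \<in> h_range d k M" "f \<in> bars M" "g \<in> bars M"
  shows "ip B (fl M h f) (fl M h g) * real (numel n M) = ip (ibox n M) f g * vol"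
proof -
  have fin: "finite M" using assms(1) finite_subset by blast
  have basic: "ip B (fl M h (psis M q)) (fl M h (psis M q')) * real (numel n M)
     = ip (ibox n M) (psis M q) (psis M q') * vol" for q q'
  proof -
    let ?p = "\<lambda>q q' i. ip {1..n i} (phit (n i) k (q i)) (phit (n i) k (q' i))"
    have "ip B (fl M h (psis M q)) (fl M h (psis M q'))
       = (\<Prod>i\<in>{1..d}. ?p (merge_idx M q h) (merge_idx M q' h) i)"
      unfolding fl_phit_tensor[OF assms(1)] unfolding phit_tensor_tens by (rule ip_tens) simp
    also have "\<dots> = (\<Prod>i\<in>{1..d} - M. ?p (merge_idx M q h) (merge_idx M q' h) i)
                  * (\<Prod>i\<in>M. ?p (merge_idx M q h) (merge_idx M q' h) i)"
      using assms(1) by (intro prod.subset_diff) auto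
    also have "(\<Prod>i\<in>{1..d} - M. ?p (merge_idx M q h) (merge_idx M q' h) i) = (\<Prod>i\<in>{1..d} - M. real (n i))"
    proof (intro prod.cong refl)
      fix i assume i: "i \<in> {1..d} - M"
      then show "?p (merge_idx M q h) (merge_idx M q' h) i = real (n i)"
        using phit_low_ip[of "h i" k "h i" "n i"] h_range_mem[OF assms(2), of i] nk'(1)[of i]
        by (simp add: merge_idx_def)
    qed
    also have "(\<Prod>i\<in>M. ?p (merge_idx M q h) (merge_idx M q' h) i) = (\<Prod>i\<in>M. ?p q q' i)"
      using assms(1) by (intro prod.cong) (auto simp: merge_idx_def)
    also have "(\<Prod>i\<in>M. ?p q q' i) = ip (ibox n M) (psis M q) (psis M q')"
      unfolding phit_tensor_tens by (rule ip_tens[OF fin, symmetric])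
    finally have 1: "ip B (fl M h (psis M q)) (fl M h (psis M q'))
      = (\<Prod>i\<in>{1..d} - M. real (n i)) * ip (ibox n M) (psis M q) (psis M q')" .
    have "vol = (\<Prod>i\<in>{1..d} - M. real (n i)) * real (numel n M)"
      unfolding numel_def of_nat_prod using assms(1) by (intro prod.subset_diff) auto
    then show ?thesis using 1 by simp
  qed
  define P where "P x y \<longleftrightarrow> ip B (fl M h x) (fl M h y) * real (numel n M) = ip (ibox n M) x y * vol" for x y
  have 1: "P f (psis M q')" for q'
    using assms(3) unfolding bar_space_eq
  proof (induction rule: spn_induct)
    case (base w) then show ?case using basic by (auto simp: P_def)
  qed (unfold P_def fl_linear ip_simps, simp_all only: distrib_right mult.assoc mult_zero_left)
  have "P f g"
    using assms(4) unfolding bar_space_eq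
  proof (induction rule: spn_induct)
    case (base w) then show ?case using 1 by auto
  qed (unfold P_def fl_linear ip_simps, simp_all only: distrib_right mult.assoc mult_zero_left)
  then show ?thesis by (simp add: P_def)
qed

lemma numel_pos: "M \<subseteq> {1..d} \<Longrightarrow> 0 < numel n M"
  unfolding numel_def using nk'(2) by (intro prod_pos) auto

lemma bar_space_closed:
  "f \<in> bars M \<Longrightarrow> g \<in> bars M \<Longrightarrow> f + g \<in> bars M"
  "f \<in> bars M \<Longrightarrow> g \<in> bars M \<Longrightarrow> f - g \<in> bars M"
  "f \<in> bars M \<Longrightarrow> scal c f \<in> bars M"
  "0 \<in> bars M"
  unfolding bar_space_eq by (auto intro: fun_vs.span_add fun_vs.span_diff spn_scal fun_vs.span_zero simp del: zero_fun_apply plus_fun_apply)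

lemma mse_fl:
  assumes "M \<subseteq> {1..d}" "h \<in> h_range d k M" "f \<in> bars M" "g \<in> bars M"
  shows "mse n M f g = ip B (fl M h f - fl M h g) (fl M h f - fl M h g) / vol"
proof -
  have "f - g \<in> bars M" using assms bar_space_closed by blast
  then have "ip B (fl M h (f - g)) (fl M h (f - g)) * real (numel n M)
      = ip (ibox n M) (f - g) (f - g) * vol"
    by (intro ip_fl assms)
  then show ?thesis
    using numel_pos[OF assms(1)] numel_pos[of "{1..d}"]
    unfolding mse_def L2_set_sq fl_linear by (simp add: frac_eq_eq mult.commute)
qed

section \<open>Differences as coefficient functionals of the dictionary\<close>

lemma D_coord_linear:
  "D_coord n k i (f + g) = D_coord n k i f + D_coord n k i g"
  "D_coord n k i (scal c f) = scal c (D_coord n k i f)"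
  "D_coord n k i 0 = 0"
  by (auto simp: D_coord_def fun_eq_iff scal_def algebra_simps sum.distrib sum_distrib_left)

lemma D_set_linear:
  "DD M (f + g) = DD M f + DD M g"
  "DD M (scal c f) = scal c (DD M f)"
  "DD M 0 = 0"
proof -
  have "foldr (D_coord n k) xs (f + g) = foldr (D_coord n k) xs f + foldr (D_coord n k) xs g" for xs
    by (induction xs) (auto simp: D_coord_linear simp del: plus_fun_apply)
  moreover have "foldr (D_coord n k) xs (scal c f) = scal c (foldr (D_coord n k) xs f)" for xs
    by (induction xs) (auto simp: D_coord_linear)
  moreover have "foldr (D_coord n k) xs 0 = 0" for xs
    by (induction xs) (auto simp: D_coord_linear simp del: zero_fun_apply)
  ultimately show
    "DD M (f + g) = DD M f + DD M g"
    "DD M (scal c f) = scal c (DD M f)"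
    "DD M 0 = 0" by (auto simp only: D_set_def)
qed

definition D_factor :: "nat \<Rightarrow> (nat \<Rightarrow> real) \<Rightarrow> nat \<Rightarrow> real" where
  "D_factor N f x = (if x \<in> {k + 1..N} then real N ^ (k - 1) * (bdiff ^^ k) f x else 0)"

text \<open>Each operator acts on its own factor only. The induction runs over the list of operators
  applied so far and keeps \<open>j\<close> arbitrary, because the next one evaluates the tensor at
  shifted positions.\<close>

lemma D_tens:
  assumes "finite M" "distinct xs" "set xs \<subseteq> M" "j \<in> ibox n M"
  shows "foldr (D_coord n k) xs (tens n M f) j =
     (\<Prod>i\<in>M. if i \<in> set xs then D_factor (n i) (f i) (j i)
            else f i (j i))"
  using assms(2-4)
proof (induction xs arbitrary: j)
  case Nil
  then show ?case by (simp add: tens_def)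
next
  case (Cons a xs)
  let ?F = "foldr (D_coord n k) xs (tens n M f)"
  let ?w = "\<lambda>ys j i. if i \<in> set ys then D_factor (n i) (f i) (j i)
            else f i (j i)"
  have a: "a \<in> M" "a \<notin> set xs" using Cons.prems by auto
  have rest: "(\<Prod>i\<in>M - {a}. ?w xs (j(a := x)) i) = (\<Prod>i\<in>M - {a}. ?w (a # xs) j i)" for x
    by (intro prod.cong refl) auto
  show ?case
  proof (cases "j a \<in> {k + 1..n a}")
    case True
    have "?F (j(a := j a - l)) = f a (j a - l) * (\<Prod>i\<in>M - {a}. ?w (a # xs) j i)" if l: "l \<in> {0..k}" for l
    proof -
      \<comment> \<open>The cutoff at k + 1 in \<open>D_coord\<close> keeps all shifts by at most k
        inside the box.\<close>
      have "j a - l \<in> {1..n a}" using True l by auto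
      then have "j(a := j a - l) \<in> ibox n M"
        using Cons.prems(3) a(1) by (auto simp: ibox_def PiE_iff extensional_def)
      then have "?F (j(a := j a - l)) = (\<Prod>i\<in>M. ?w xs (j(a := j a - l)) i)"
        using Cons.IH Cons.prems by simp
      also have "\<dots> = ?w xs (j(a := j a - l)) a * (\<Prod>i\<in>M - {a}. ?w xs (j(a := j a - l)) i)"
        using assms(1) a(1) by (rule prod.remove)
      finally show ?thesis unfolding rest using a(2) by simp
    qed
    then have "foldr (D_coord n k) (a # xs) (tens n M f) j =
       real (n a) ^ (k - 1) * (\<Sum>l=0..k. (-1) ^ l * real (k choose l) * (f a (j a - l) * (\<Prod>i\<in>M - {a}. ?w (a # xs) j i)))"
      using True by (simp add: D_coord_def)
    also have "\<dots> = real (n a) ^ (k - 1) * (bdiff ^^ k) (f a) (j a) * (\<Prod>i\<in>M - {a}. ?w (a # xs) j i)"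
      by (simp add: bdiff_pow_sum sum_distrib_right mult.assoc)
    also have "\<dots> = ?w (a # xs) j a * (\<Prod>i\<in>M - {a}. ?w (a # xs) j i)" using True by (simp add: D_factor_def)
    also have "\<dots> = (\<Prod>i\<in>M. ?w (a # xs) j i)"
      using assms(1) a(1) by (rule prod.remove[symmetric])
    finally show ?thesis .
  next
    case False
    then have "(\<Prod>i\<in>M. ?w (a # xs) j i) = 0" using a assms(1) by (intro prod_zero) (auto simp: D_factor_def)
    moreover have "foldr (D_coord n k) (a # xs) (tens n M f) j = 0" using False by (auto simp: D_coord_def)
    ultimately show ?thesis by simp
  qed
qed

lemma high_idx_ibox: "high_idx M \<subseteq> ibox n M"
  unfolding high_idx_def ibox_def by (rule PiE_mono) auto

lemma D_set_phit_tensor: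
  assumes "M \<subseteq> {1..d}" "q \<in> high_idx M" "j \<in> high_idx M"
  shows "DD M (psis M q) j = of_bool (j = q)"
proof -
  have fin: "finite M" using assms(1) finite_subset by blast
  have "DD M (psis M q) j =
     (\<Prod>i\<in>M. if i \<in> set (sorted_list_of_set M) then D_factor (n i) (phit (n i) k (q i)) (j i)
            else phit (n i) k (q i) (j i))"
    unfolding D_set_def phit_tensor_tens
    by (rule D_tens) (use fin assms high_idx_ibox in auto)
  also have "\<dots> = (\<Prod>i\<in>M. of_bool (j i = q i))"
  proof (intro prod.cong refl)
    fix i assume i: "i \<in> M"
    then have "j i \<in> {k + 1..n i}" "q i \<in> {k + 1..n i}" using assms by (auto simp: high_idx_def PiE_iff)
    then show "(if i \<in> set (sorted_list_of_set M) then D_factor (n i) (phit (n i) k (q i)) (j i)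
            else phit (n i) k (q i) (j i)) = of_bool (j i = q i)"
      using i fin bdiff_pow_phit[OF k1, of "q i" "j i" "n i"] by (auto simp: D_factor_def)
  qed
  also have "\<dots> = of_bool (j = q)"
  proof (cases "j = q")
    case False
    then obtain i where "j i \<noteq> q i" by auto
    then have "i \<in> M" using assms unfolding high_idx_def by (metis PiE_arb)
    then show ?thesis using False \<open>j i \<noteq> q i\<close> fin by (auto intro: prod_zero)
  qed simp
  finally show ?thesis .
qed

text \<open>By biorthogonality \<open>DD M\<close> reads off the dictionary coefficients. Hence
  \<open>pen M\<close> is their l1 norm, and the penalized fit is a lasso over the dictionary
  tensors.\<close>

lemma bar_space_expand:
  assumes "M \<subseteq> {1..d}" "g \<in> bars M"
  shows "g = (\<Sum>q\<in>high_idx M. scal (DD M g q) (psis M q))"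
  using assms(2) unfolding bar_space_eq
proof (induction rule: spn_induct)
  case (base w)
  then obtain q where q: "q \<in> high_idx M" "w = psis M q" by auto
  have "(\<Sum>j\<in>high_idx M. scal (DD M w j) (psis M j)) = (\<Sum>j\<in>high_idx M. if j = q then w else 0)"
    by (intro sum.cong refl) (auto simp: q(2) D_set_phit_tensor[OF assms(1) q(1)] scal_of_bool)
  also have "\<dots> = w" using q finite_high_idx[OF assms(1)] by simp
  finally show ?case by simp
next
  case zero
  have "(\<Sum>j\<in>high_idx M. scal (DD M 0 j) (psis M j)) = 0"
    unfolding D_set_linear by (intro sum.neutral) (auto simp: scal_def fun_eq_iff)
  then show ?case by (rule sym)
next
  case (add f g)
  have "(\<Sum>j\<in>high_idx M. scal (DD M (f + g) j) (psis M j))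
     = (\<Sum>j\<in>high_idx M. scal (DD M f j) (psis M j)) + (\<Sum>j\<in>high_idx M. scal (DD M g j) (psis M j))"
    unfolding D_set_linear by (auto simp: scal_def fun_eq_iff fun_sum_apply algebra_simps sum.distrib)
  also have "\<dots> = f + g" using add by (simp only:)
  finally show ?case by (rule sym)
next
  case (scal r f)
  have "(\<Sum>j\<in>high_idx M. scal (DD M (scal r f) j) (psis M j))
     = scal r (\<Sum>j\<in>high_idx M. scal (DD M f j) (psis M j))"
    unfolding D_set_linear by (rule ext) (simp only: fun_sum_apply scal_def mult.assoc sum_distrib_left)
  also have "\<dots> = scal r f" using scal by (simp only:)
  finally show ?case by (rule sym)
qed

end

section \<open>The penalized estimator\<close>

lemma on_proj_linear:
  "on_proj J E (f + g) = on_proj J E f + on_proj J E g"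
  "on_proj J E (f - g) = on_proj J E f - on_proj J E g"
  "on_proj J E (scal c f) = scal c (on_proj J E f)"
  "on_proj J E 0 = 0"
proof -
  show "on_proj J E (f + g) = on_proj J E f + on_proj J E g"
    "on_proj J E (f - g) = on_proj J E f - on_proj J E g" "on_proj J E 0 = 0"
    by (rule ext, simp add: on_proj_def ip_simps fun_sum_apply scal_def algebra_simps sum.distrib sum_subtractf)+
  show "on_proj J E (scal c f) = scal c (on_proj J E f)"
    by (rule ext) (simp add: on_proj_def ip_simps fun_sum_apply,
        simp only: scal_def fun_sum_apply sum_distrib_left mult.assoc)
qed

lemma on_proj_sum: "on_proj J E (\<Sum>i\<in>A. f i) = (\<Sum>i\<in>A. on_proj J E (f i))"
proof (induction A rule: infinite_finite_induct)
  case (insert x F)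
  then show ?case by (simp add: on_proj_linear(1) del: plus_fun_apply)
qed (simp_all add: on_proj_linear(4) del: zero_fun_apply)

lemma ip_sum_orth:
  assumes "finite P" "\<And>p q. p \<in> P \<Longrightarrow> q \<in> P \<Longrightarrow> p \<noteq> q \<Longrightarrow> ip J (v p) (v q) = 0"
  shows "ip J (\<Sum>p\<in>P. v p) (\<Sum>p\<in>P. v p) = (\<Sum>p\<in>P. ip J (v p) (v p))"
proof -
  have "ip J (\<Sum>p\<in>P. v p) (\<Sum>p\<in>P. v p) = (\<Sum>p\<in>P. \<Sum>q\<in>P. ip J (v p) (v q))"
    unfolding ip_sum_left unfolding ip_sum_right ..
  also have "\<dots> = (\<Sum>p\<in>P. \<Sum>q\<in>P. if q = p then ip J (v p) (v p) else 0)"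
    using assms(2) by (intro sum.cong refl) auto
  finally show ?thesis using assms(1) by simp
qed

text \<open>A first-order optimality condition without derivatives: at t = min(1, -A / (2 D)) a
  negative A would outweigh the quadratic term.\<close>

lemma linear_term_nonneg:
  fixes A D :: real
  assumes "\<And>t. 0 < t \<Longrightarrow> t \<le> 1 \<Longrightarrow> 0 \<le> t * A + t\<^sup>2 * D"
  shows "0 \<le> A"
proof (rule ccontr)
  assume "\<not> 0 \<le> A"
  then have A: "A < 0" by simp
  have D: "D > 0" using assms[of 1] A by simp
  define t where "t = min 1 (- A / (2 * D))"
  have t: "0 < t" "t \<le> 1" "t \<le> - A / (2 * D)" using A D by (auto simp: t_def divide_neg_pos)
  have "0 \<le> t * (A + t * D)" using assms[OF t(1,2)] by (simp add: power2_eq_square algebra_simps)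
  then have "0 \<le> A + t * D" using t(1) by (simp add: zero_le_mult_iff)
  moreover have "t * D \<le> - A / 2" using t(3) D by (simp add: field_simps)
  ultimately show False using A by simp
qed

text \<open>Coefficient families are functions on all indices, so compactness is Tychonoff's
  theorem; the coordinates outside \<open>A\<close> are pinned to 0.\<close>

lemma compact_coefficient_box: "compact {\<beta> :: 'a \<Rightarrow> real. \<forall>q. if q \<in> A then \<bar>\<beta> q\<bar> \<le> R else \<beta> q = 0}"
proof -
  let ?S = "\<lambda>q. if q \<in> A then {- R..R} else {0}"
  have "compactin (product_topology (\<lambda>_. euclidean) UNIV) (PiE UNIV ?S)"
    by (subst compactin_PiE) auto
  then have "compact (PiE UNIV ?S)" by (simp add: euclidean_product_topology)
  also have "PiE UNIV ?S = {\<beta>. \<forall>q. if q \<in> A then \<bar>\<beta> q\<bar> \<le> R else \<beta> q = 0}"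
    by (auto simp: PiE_iff abs_le_iff split: if_splits) (metis minus_le_iff singletonD atLeastAtMost_iff)+
  finally show ?thesis .
qed

section \<open>Minimizers of the penalized objective\<close>

context box
begin

lemma mse_ip: "mse n M f g = ip (ibox n M) (f - g) (f - g) / real (numel n M)"
  by (simp add: mse_def L2_set_sq)

lemma pen_eq: "pen M g = (\<Sum>q\<in>high_idx M. \<bar>DD M g q\<bar>)"
  by (simp add: D_norm1_def high_idx_def)

lemma pen_nonneg: "0 \<le> pen M g"
  by (simp add: pen_eq sum_nonneg)

lemma pen_zero: "pen M 0 = 0"
  by (simp add: pen_eq D_set_linear)

lemma mse_nonneg: "0 \<le> mse n M f g"
  by (simp add: mse_ip)

lemma pen_convex:
  assumes "0 \<le> t" "t \<le> 1"
  shows "pen M (x + scal t (g - x)) \<le> (1 - t) * pen M x + t * pen M g"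
proof -
  have "pen M (x + scal t (g - x)) \<le> (\<Sum>q\<in>high_idx M. (1 - t) * \<bar>DD M x q\<bar> + t * \<bar>DD M g q\<bar>)"
    unfolding pen_eq
  proof (rule sum_mono)
    fix q
    have "g = (g - x) + x" by simp
    then have "DD M g = DD M (g - x) + DD M x"
      by (metis D_set_linear(1))
    moreover have "DD M (x + scal t (g - x)) = DD M x + scal t (DD M (g - x))"
      by (simp only: D_set_linear)
    ultimately have "DD M (x + scal t (g - x)) q = (1 - t) * DD M x q + t * DD M g q"
      by (simp add: scal_def algebra_simps)
    also have "\<bar>\<dots>\<bar> \<le> \<bar>(1 - t) * DD M x q\<bar> + \<bar>t * DD M g q\<bar>" by (rule abs_triangle_ineq)
    finally show "\<bar>DD M (x + scal t (g - x)) q\<bar> \<le> (1 - t) * \<bar>DD M x q\<bar> + t * \<bar>DD M g q\<bar>"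
      using assms by (simp add: abs_mult)
  qed
  also have "\<dots> = (1 - t) * pen M x + t * pen M g"
    by (simp add: pen_eq sum.distrib sum_distrib_left)
  finally show ?thesis .
qed

definition pen_obj :: "real \<Rightarrow> nat set \<Rightarrow> tensor \<Rightarrow> tensor \<Rightarrow> real" where
  "pen_obj lam M u g = mse n M u g + 2 * lam * pen M g"

lemma pen_obj_attains_min:
  assumes "M \<subseteq> {1..d}" "0 < lam"
  shows "\<exists>x\<in>bars M. \<forall>g\<in>bars M. pen_obj lam M u x \<le> pen_obj lam M u g"
proof -
  let ?psi = "psis M"
  define G where "G \<beta> = (\<Sum>q\<in>high_idx M. scal (\<beta> q) (?psi q))" for \<beta>
  \<comment> \<open>Any coefficient beyond this radius makes the penalty alone exceed the objective
    at 0, so the search may be confined to a compact box of coefficients.\<close>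
  define R where "R = pen_obj lam M u 0 / (2 * lam)"
  define C where "C = {\<beta>. \<forall>q. if q \<in> high_idx M then \<bar>\<beta> q\<bar> \<le> R else \<beta> q = (0::real)}"
  have fin: "finite (high_idx M)" using finite_high_idx assms by blast
  have Gbar: "G \<beta> \<in> bars M" for \<beta>
    unfolding G_def bar_space_eq by (intro fun_vs.span_sum spn_scal fun_vs.span_base) auto
  have DG: "DD M (G \<beta>) q = \<beta> q" if q: "q \<in> high_idx M" for \<beta> q
  proof -
    have "DD M (\<Sum>q\<in>A. scal (\<beta> q) (?psi q)) = (\<Sum>q\<in>A. scal (\<beta> q) (DD M (?psi q)))" for A
    proof (induction A rule: infinite_finite_induct)
      case (insert x F)
      then show ?case by (simp add: D_set_linear(1,2) del: plus_fun_apply)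
    qed (simp_all add: D_set_linear(3) del: zero_fun_apply)
    then have "DD M (G \<beta>) q = (\<Sum>p\<in>high_idx M. \<beta> p * DD M (?psi p) q)"
      by (simp add: G_def fun_sum_apply scal_def)
    also have "\<dots> = (\<Sum>p\<in>high_idx M. if p = q then \<beta> p else 0)"
      using q by (intro sum.cong) (auto simp: D_set_phit_tensor[OF assms(1)])
    finally show ?thesis using q fin by simp
  qed
  have objG: "pen_obj lam M u (G \<beta>) = (\<Sum>j\<in>ibox n M. (u j - (\<Sum>q\<in>high_idx M. \<beta> q * ?psi q j))\<^sup>2) / real (numel n M)
       + 2 * lam * (\<Sum>q\<in>high_idx M. \<bar>\<beta> q\<bar>)" for \<beta>
    by (simp add: pen_obj_def mse_ip ip_def pen_eq DG power2_eq_square)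
       (simp add: G_def fun_sum_apply scal_def)
  have "continuous_on C (\<lambda>\<beta>. pen_obj lam M u (G \<beta>))"
    unfolding objG using numel_pos[OF assms(1)]
    by (intro continuous_intros continuous_on_subset[OF continuous_on_product_coordinates]) auto
  moreover have "compact C" unfolding C_def by (rule compact_coefficient_box)
  moreover have R0: "0 \<le> R"
    unfolding R_def using assms by (simp add: pen_obj_def mse_nonneg pen_nonneg)
  then have zero: "(\<lambda>_. 0) \<in> C" by (simp add: C_def)
  ultimately obtain \<beta> where \<beta>: "\<beta> \<in> C" "\<And>\<gamma>. \<gamma> \<in> C \<Longrightarrow> pen_obj lam M u (G \<beta>) \<le> pen_obj lam M u (G \<gamma>)"
    using continuous_attains_inf[of C "\<lambda>\<beta>. pen_obj lam M u (G \<beta>)"] by blast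
  have G0: "G (\<lambda>_. 0) = 0" unfolding G_def by (intro sum.neutral) (auto simp: scal_def fun_eq_iff)
  have "pen_obj lam M u (G \<beta>) \<le> pen_obj lam M u g" if g: "g \<in> bars M" for g
  proof (cases "\<forall>q\<in>high_idx M. \<bar>DD M g q\<bar> \<le> R")
    case True
    define \<gamma> where "\<gamma> q = (if q \<in> high_idx M then DD M g q else 0)" for q
    have "\<gamma> \<in> C" using True by (simp add: C_def \<gamma>_def)
    moreover have "G \<gamma> = g"
    proof -
      have "G \<gamma> = (\<Sum>q\<in>high_idx M. scal (DD M g q) (?psi q))"
        unfolding G_def \<gamma>_def by (intro sum.cong) auto
      then show ?thesis using bar_space_expand[OF assms(1) g] by simp
    qed
    ultimately show ?thesis using \<beta>(2) by metis
  next
    case False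
    then obtain q where q: "q \<in> high_idx M" "R < \<bar>DD M g q\<bar>" by auto
    have "\<bar>DD M g q\<bar> \<le> pen M g"
      unfolding pen_eq by (rule member_le_sum) (use q fin in auto)
    then have "R < pen M g" using q by simp
    then have "pen_obj lam M u 0 < 2 * lam * pen M g"
      using assms(2) by (simp add: R_def field_simps)
    also have "\<dots> \<le> pen_obj lam M u g" by (simp add: pen_obj_def mse_nonneg)
    finally show ?thesis using \<beta>(2)[OF zero] unfolding G0 by linarith
  qed
  then show ?thesis using Gbar by blast
qed

text \<open>The choice behind \<open>arg_min_on\<close> returns a minimizer only once one is known
  to exist, which is \<open>pen_obj_attains_min\<close>.\<close>

lemma bar_est_props:
  assumes "M \<subseteq> {1..d}" "0 < lam"
  shows "fit lam M h Y \<in> bars M"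
    and "g \<in> bars M \<Longrightarrow>
      pen_obj lam M (abar M h Y) (fit lam M h Y) \<le> pen_obj lam M (abar M h Y) g"
proof -
  let ?u = "abar M h Y"
  have eq: "fit lam M h Y = arg_min_on (pen_obj lam M ?u) (bars M)"
    by (simp add: bar_est_def pen_obj_def[abs_def])
  obtain x where "x \<in> bars M" "\<forall>g\<in>bars M. pen_obj lam M ?u x \<le> pen_obj lam M ?u g"
    using pen_obj_attains_min[OF assms] by blast
  then have "is_arg_min (pen_obj lam M ?u) (\<lambda>x. x \<in> bars M) x"
    unfolding is_arg_min_def by (auto simp: not_less)
  then have "is_arg_min (pen_obj lam M ?u) (\<lambda>x. x \<in> bars M) (fit lam M h Y)"
    unfolding eq arg_min_on_def arg_min_def
    by (rule someI[where P = "is_arg_min (pen_obj lam M ?u) (\<lambda>x. x \<in> bars M)"])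
  then show "fit lam M h Y \<in> bars M"
    and "g \<in> bars M \<Longrightarrow>
      pen_obj lam M ?u (fit lam M h Y) \<le> pen_obj lam M ?u g"
    unfolding is_arg_min_def by (auto simp: not_less)
qed

text \<open>Along the segment from \<open>x\<close> to \<open>g\<close> the objective is at most a
  quadratic in t, with leading coefficient \<open>mse n M x g\<close> and nonnegative slope at the
  minimizer; t = 1 gives the claim. This is the source of the term that later absorbs the noise in
  \<open>S\<close>.\<close>

lemma min_two_point:
  assumes "x \<in> bars M" "g \<in> bars M" "0 < lam"
    and min: "\<And>g. g \<in> bars M \<Longrightarrow> pen_obj lam M u x \<le> pen_obj lam M u g"
  shows "pen_obj lam M u x + mse n M x g \<le> pen_obj lam M u g"
proof -
  let ?ip = "ip (ibox n M)" and ?N = "real (numel n M)" and ?p = "pen M"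
  have expand: "mse n M u (x + scal t (g - x))
     = mse n M u x - 2 * t * (?ip (u - x) (g - x) / ?N) + t\<^sup>2 * mse n M x g" for t
  proof -
    have "?ip (u - (x + scal t (g - x))) (u - (x + scal t (g - x)))
      = ?ip (u - x) (u - x) - 2 * t * ?ip (u - x) (g - x) + t\<^sup>2 * ?ip (x - g) (x - g)"
      by (simp add: ip_simps ip_commute[of _ x u] ip_commute[of _ g u] ip_commute[of _ g x]
          power2_eq_square algebra_simps)
    then show ?thesis by (simp add: mse_ip add_divide_distrib diff_divide_distrib)
  qed
  define A where "A = - 2 * (?ip (u - x) (g - x) / ?N) + 2 * lam * (?p g - ?p x)"
  have "0 \<le> A"
  proof (rule linear_term_nonneg)
    fix t :: real assume t: "0 < t" "t \<le> 1"
    have "x + scal t (g - x) \<in> bars M"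
      using assms(1,2) by (intro bar_space_closed)
    then have "pen_obj lam M u x \<le> pen_obj lam M u (x + scal t (g - x))" by (rule min)
    also have "\<dots> \<le> mse n M u x - 2 * t * (?ip (u - x) (g - x) / ?N) + t\<^sup>2 * mse n M x g
        + 2 * lam * ((1 - t) * ?p x + t * ?p g)"
      unfolding pen_obj_def expand using pen_convex[of t M x g] t assms(3) by (simp add: mult_left_mono)
    finally show "0 \<le> t * A + t\<^sup>2 * mse n M x g"
      by (simp add: pen_obj_def A_def algebra_simps)
  qed
  moreover have "x + scal 1 (g - x) = g" by (simp add: scal_def fun_eq_iff)
  then have "mse n M u g = mse n M u x - 2 * (?ip (u - x) (g - x) / ?N) + mse n M x g"
    using expand[of 1] by simp
  ultimately show ?thesis by (simp add: pen_obj_def A_def algebra_simps)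
qed

text \<open>The fit is a proximal map. Adding the two-point inequalities of \<open>x\<close> and
  \<open>x'\<close> against each other cancels the penalties, and the square of (u - u') - (x - x')
  bounds what remains.\<close>

lemma bar_est_nonexpansive:
  assumes "M \<subseteq> {1..d}" "0 < lam"
  shows "mse n M (fit lam M h Y) (fit lam M h Y')
       \<le> mse n M (abar M h Y) (abar M h Y')"
proof -
  let ?x = "fit lam M h Y" and ?x' = "fit lam M h Y'"
  let ?u = "abar M h Y" and ?u' = "abar M h Y'"
  let ?ip = "ip (ibox n M)" and ?N = "real (numel n M)"
  have 1: "pen_obj lam M ?u ?x + mse n M ?x ?x' \<le> pen_obj lam M ?u ?x'"
    "pen_obj lam M ?u' ?x' + mse n M ?x' ?x \<le> pen_obj lam M ?u' ?x"
    using bar_est_props[OF assms] by (auto intro!: min_two_point assms)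
  have N: "?N > 0" using numel_pos[OF assms(1)] by simp
  have "0 \<le> ?ip ((?u - ?u') - (?x - ?x')) ((?u - ?u') - (?x - ?x')) / ?N" using N by simp
  also have "\<dots> = mse n M ?u ?u' + mse n M ?x ?x'
     - (mse n M ?u ?x' - mse n M ?u ?x + mse n M ?u' ?x - mse n M ?u' ?x')"
    unfolding mse_ip add_divide_distrib[symmetric] diff_divide_distrib[symmetric]
    by (simp add: ip_simps ip_commute[of _ ?u' ?u] ip_commute[of _ ?x ?u] ip_commute[of _ ?x ?u']
        ip_commute[of _ ?x' ?u] ip_commute[of _ ?x' ?u'] ip_commute[of _ ?x' ?x] algebra_simps)
  moreover have "mse n M ?x' ?x = mse n M ?x ?x'"
    by (simp add: mse_def L2_set_diff_commute)
  ultimately show ?thesis using 1 unfolding pen_obj_def by linarith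
qed

section \<open>Component errors and regularity of the full estimator\<close>

definition est_comp :: "real \<Rightarrow> nat set \<Rightarrow> idx \<Rightarrow> tensor \<Rightarrow> tensor" where
  "est_comp lam M h Y =
     (if M = {} then anova_proj d n k M h Y else fl M h (fit lam M h Y))"

definition comp_index :: "(nat set \<times> idx) set" where
  "comp_index = Sigma (Pow {1..d}) (h_range d k)"

lemma finite_comp_index: "finite comp_index"
  by (simp add: comp_index_def finite_h_range finite_SigmaI)

lemma comp_indexD: "p \<in> comp_index \<Longrightarrow> fst p \<subseteq> {1..d}" "p \<in> comp_index \<Longrightarrow> snd p \<in> h_range d k (fst p)"
  by (auto simp: comp_index_def)

lemma sum_comp_index: "(\<Sum>M\<in>Pow {1..d}. \<Sum>h\<in>h_range d k M. f M h) = (\<Sum>p\<in>comp_index. f (fst p) (snd p))"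
  unfolding comp_index_def by (subst sum.Sigma) (auto simp: finite_h_range case_prod_beta)

lemma tf_estimator_comp_index: "tf_estimator d n k (\<lambda>M h. lam) Y = (\<Sum>p\<in>comp_index. est_comp lam (fst p) (snd p) Y)"
  unfolding tf_estimator_def est_comp_def[symmetric] by (rule sum_comp_index)

lemma box_cut_comp_index: "box_cut f = (\<Sum>p\<in>comp_index. comp_proj (fst p) (snd p) f)"
  unfolding box_cut_decomp by (rule sum_comp_index)

lemma est_comp_span:
  assumes "M \<subseteq> {1..d}" "h \<in> h_range d k M" "0 < lam"
  shows "est_comp lam M h Y \<in> spn (gens M h)"
proof (cases "M = {}")
  case True
  then show ?thesis using comp_proj_span[OF assms(1,2)] anova_proj_eq[OF assms(1,2)] by (simp add: est_comp_def)
next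
  case False
  then show ?thesis
    using fl_bar_space[OF assms(1) bar_est_props(1)[OF assms(1,3)]] by (simp add: est_comp_def)
qed

lemma comp_proj_diff:
  "comp_proj M h (f - g) = comp_proj M h f - comp_proj M h g" "comp_proj M h (f + g) = comp_proj M h f + comp_proj M h g"
  by (auto simp: fun_eq_iff comp_proj_def fun_sum_apply scal_def algebra_simps sum_subtractf sum.distrib)

lemma ip_comp_proj_le:
  assumes "M \<subseteq> {1..d}" "h \<in> h_range d k M"
  shows "ip B (comp_proj M h f) (comp_proj M h f) \<le> ip B f f"
proof -
  have "ip B (comp_proj M h f) (comp_proj M h f) = ip B f (comp_proj M h f)"
    by (intro ip_comp_proj assms comp_proj_span)
  moreover have "0 \<le> ip B (f - comp_proj M h f) (f - comp_proj M h f)" by simp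
  ultimately show ?thesis by (simp add: ip_simps ip_commute[of B "comp_proj M h f" f])
qed

lemma est_comp_nonexpansive:
  assumes "M \<subseteq> {1..d}" "h \<in> h_range d k M" "0 < lam"
  shows "ip B (est_comp lam M h Y - est_comp lam M h Y') (est_comp lam M h Y - est_comp lam M h Y')
     \<le> ip B (Y - Y') (Y - Y')"
proof (cases "M = {}")
  case True
  then show ?thesis
    using ip_comp_proj_le[OF assms(1,2), of "Y - Y'"] assms(2) by (simp add: est_comp_def anova_proj_eq comp_proj_diff)
next
  case False
  let ?x = "fit lam M h Y" and ?x' = "fit lam M h Y'"
  let ?u = "abar M h Y" and ?u' = "abar M h Y'"
  note x = bar_est_props(1)[OF assms(1,3), of h] and u = anova_bar_props[OF assms(1,2)]
  have "ip B (fl M h ?x - fl M h ?x') (fl M h ?x - fl M h ?x') / vol = mse n M ?x ?x'"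
    by (rule mse_fl[symmetric, OF assms(1,2) x x])
  also have "\<dots> \<le> mse n M ?u ?u'" by (rule bar_est_nonexpansive[OF assms(1,3)])
  also have "\<dots> = ip B (fl M h ?u - fl M h ?u') (fl M h ?u - fl M h ?u') / vol"
    by (rule mse_fl[OF assms(1,2) u(1) u(1)])
  also have "fl M h ?u - fl M h ?u' = comp_proj M h (Y - Y')" by (simp only: u(2) comp_proj_diff)
  finally have "ip B (fl M h ?x - fl M h ?x') (fl M h ?x - fl M h ?x') \<le> ip B (comp_proj M h (Y - Y')) (comp_proj M h (Y - Y'))"
    using numel_pos[of "{1..d}"] by (simp add: divide_le_cancel del: minus_apply)
  also have "\<dots> \<le> ip B (Y - Y') (Y - Y')" by (rule ip_comp_proj_le[OF assms(1,2)])
  finally show ?thesis using False by (simp add: est_comp_def)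
qed

text \<open>Summing the nonexpansive components gives a crude constant, which is enough for the
  measurability of the estimator in the noise.\<close>

lemma tf_estimator_lipschitz:
  assumes "j \<in> B" "0 < lam"
  shows "\<bar>tf_estimator d n k (\<lambda>M h. lam) Y j - tf_estimator d n k (\<lambda>M h. lam) Y' j\<bar>
      \<le> real (card comp_index) * L2_set (Y - Y') B"
proof -
  let ?c = "\<lambda>p Y. est_comp lam (fst p) (snd p) Y"
  have "\<bar>?c p Y j - ?c p Y' j\<bar> \<le> L2_set (Y - Y') B" if p: "p \<in> comp_index" for p
  proof -
    have "\<bar>(?c p Y - ?c p Y') j\<bar> \<le> L2_set (?c p Y - ?c p Y') B"
    proof -
      have "((?c p Y - ?c p Y') j)\<^sup>2 \<le> (\<Sum>i\<in>B. ((?c p Y - ?c p Y') i)\<^sup>2)"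
        by (rule member_le_sum) (use assms in auto)
      then show ?thesis unfolding L2_set_def by (intro real_le_rsqrt) simp
    qed
    also have "\<dots> \<le> L2_set (Y - Y') B"
      using est_comp_nonexpansive[OF comp_indexD[OF p] assms(2)] by (simp add: L2_set_ip)
    finally show ?thesis by simp
  qed
  then have "(\<Sum>p\<in>comp_index. \<bar>?c p Y j - ?c p Y' j\<bar>) \<le> real (card comp_index) * L2_set (Y - Y') B"
    by (rule sum_bounded_above)
  moreover have "tf_estimator d n k (\<lambda>M h. lam) Y j - tf_estimator d n k (\<lambda>M h. lam) Y' j
     = (\<Sum>p\<in>comp_index. ?c p Y j - ?c p Y' j)"
    by (simp add: tf_estimator_comp_index fun_sum_apply sum_subtractf)
  ultimately show ?thesis using sum_abs[of "\<lambda>p. ?c p Y j - ?c p Y' j" comp_index] by linarith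
qed

text \<open>The component errors lie in mutually orthogonal spaces, so there are no cross terms and
  each component can be treated with its own competitor.\<close>

lemma mse_decomp:
  assumes "0 < lam"
  shows "mse n {1..d} (tf_estimator d n k (\<lambda>M h. lam) Y) f0
     = (\<Sum>p\<in>comp_index. ip B (est_comp lam (fst p) (snd p) Y - comp_proj (fst p) (snd p) f0)
                    (est_comp lam (fst p) (snd p) Y - comp_proj (fst p) (snd p) f0)) / vol"
proof -
  let ?v = "\<lambda>p. est_comp lam (fst p) (snd p) Y - comp_proj (fst p) (snd p) f0"
  let ?T = "tf_estimator d n k (\<lambda>M h. lam) Y"
  have "ip B (?T - f0) (?T - f0) = ip B (?T - box_cut f0) (?T - box_cut f0)"
    by (rule ip_cong) (auto simp: box_cut_def)
  also have "?T - box_cut f0 = (\<Sum>p\<in>comp_index. ?v p)"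
    unfolding tf_estimator_comp_index box_cut_comp_index by (simp add: sum_subtractf)
  also have "ip B (\<Sum>p\<in>comp_index. ?v p) (\<Sum>p\<in>comp_index. ?v p) = (\<Sum>p\<in>comp_index. ip B (?v p) (?v p))"
  proof (rule ip_sum_orth[OF finite_comp_index])
    fix p q assume pq: "p \<in> comp_index" "q \<in> comp_index" "p \<noteq> q"
    have span: "?v p \<in> spn (gens (fst p) (snd p))" if "p \<in> comp_index" for p
      using comp_indexD[OF that] by (intro fun_vs.span_diff est_comp_span comp_proj_span assms)
    show "ip B (?v p) (?v q) = 0"
      using pq comp_indexD[OF pq(1)] comp_indexD[OF pq(2)] span[OF pq(1)] span[OF pq(2)]
      by (intro comp_gen_orth[of "fst p" "snd p" "fst q" "snd q"]) (auto simp: prod_eq_iff)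
  qed
  finally show ?thesis by (simp only: mse_ip)
qed

text \<open>For an orthonormal basis \<open>E\<close> of the subspace \<open>S\<close> this is the
  squared norm of the projection of the noise onto \<open>S\<close>.\<close>

definition noise_energy :: "tensor set \<Rightarrow> tensor \<Rightarrow> real" where
  "noise_energy E eps = (\<Sum>e\<in>E. (ip B eps e)\<^sup>2)"

section \<open>Oracle bounds for one noise vector with small residual correlations\<close>

context
  fixes E :: "tensor set" and eps :: tensor and lam :: real
  assumes E: "finite E" "orthonormal B E" and lam: "0 < lam"
    and resid: "\<And>q. q \<in> B \<Longrightarrow>
      \<bar>ip B eps (psi q - on_proj B E (psi q))\<bar> \<le> vol * lam"
begin

text \<open>The contribution of \<open>S\<close> is kept as a Cauchy-Schwarz product because it is
  used in two ways: \<open>oracle_component\<close> completes the square,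
  \<open>empty_component\<close> divides by the norm.\<close>

lemma noise_bound:
  assumes "M \<subseteq> {1..d}" "h \<in> h_range d k M" "g \<in> bars M"
  shows "ip B eps (fl M h g) \<le> sqrt (noise_energy E eps) * L2_set (fl M h g) B + vol * lam * pen M g"
proof -
  let ?V = "fl M h g" and ?psi = "\<lambda>q. psi (merge_idx M q h)" and ?b = "DD M g"
  let ?N = "vol"
  have "fl M h (\<Sum>q\<in>high_idx M. scal (DD M g q) (psis M q)) = (\<Sum>q\<in>high_idx M. scal (?b q) (?psi q))"
    unfolding fl_sum fl_linear fl_phit_tensor[OF assms(1)] ..
  then have V: "?V = (\<Sum>q\<in>high_idx M. scal (?b q) (?psi q))"
    using bar_space_expand[OF assms(1,3)] by simp
  have "?V - on_proj B E ?V = (\<Sum>q\<in>high_idx M. scal (?b q) (?psi q - on_proj B E (?psi q)))"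
    unfolding V on_proj_sum on_proj_linear sum_subtractf[symmetric]
    by (intro sum.cong refl) (simp add: scal_def fun_eq_iff algebra_simps)
  then have "ip B eps (?V - on_proj B E ?V) = (\<Sum>q\<in>high_idx M. ?b q * ip B eps (?psi q - on_proj B E (?psi q)))"
    by (simp only: ip_sum_right ip_simps)
  also have "\<dots> \<le> (\<Sum>q\<in>high_idx M. \<bar>?b q\<bar> * (?N * lam))"
  proof (rule sum_mono)
    fix q assume "q \<in> high_idx M"
    then have "\<bar>ip B eps (?psi q - on_proj B E (?psi q))\<bar> \<le> ?N * lam"
      by (intro resid merge_idx_B assms)
    then have "\<bar>?b q\<bar> * \<bar>ip B eps (?psi q - on_proj B E (?psi q))\<bar> \<le> \<bar>?b q\<bar> * (?N * lam)"
      by (rule mult_left_mono) simp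
    then show "?b q * ip B eps (?psi q - on_proj B E (?psi q)) \<le> \<bar>?b q\<bar> * (?N * lam)"
      unfolding abs_mult[symmetric] by linarith
  qed
  also have "\<dots> = ?N * lam * pen M g"
    by (simp add: pen_eq sum_distrib_left mult.commute)
  finally have 1: "ip B eps (?V - on_proj B E ?V) \<le> ?N * lam * pen M g" .
  have "ip B eps (on_proj B E ?V) = ip B (on_proj B E eps) ?V" by (simp add: ip_on_proj_swap)
  also have "\<dots> \<le> L2_set (on_proj B E eps) B * L2_set ?V B" by (rule Cauchy_ip)
  also have "L2_set (on_proj B E eps) B = sqrt (noise_energy E eps)"
    by (simp add: L2_set_ip ip_on_proj_self[OF E] noise_energy_def)
  finally show ?thesis using 1 by (simp add: ip_simps)
qed

lemma oracle_component:
  assumes "M \<subseteq> {1..d}" "M \<noteq> {}" "h \<in> h_range d k M" "g \<in> bars M"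
  shows "mse n M (abar M h f0) (fit lam M h (f0 + eps))
     \<le> mse n M (abar M h f0) g + noise_energy E eps / vol + 4 * lam * pen M g"
proof -
  let ?N = "vol" and ?Y = "f0 + eps" and ?p = "pen M"
  define x where "x = fit lam M h ?Y"
  define u where "u = abar M h ?Y"
  define u0 where "u0 = abar M h f0"
  have xb: "x \<in> bars M" unfolding x_def by (rule bar_est_props(1)[OF assms(1) lam])
  have ub: "u \<in> bars M" "u0 \<in> bars M" "fl M h u = comp_proj M h ?Y" "fl M h u0 = comp_proj M h f0"
    unfolding u_def u0_def using anova_bar_props[OF assms(1,3)] by auto
  have N: "?N > 0" using numel_pos[of "{1..d}"] by simp
  have "pen_obj lam M u x + mse n M x g \<le> pen_obj lam M u g"
    unfolding u_def x_def
    by (rule min_two_point[OF bar_est_props(1)[OF assms(1) lam] assms(4) lam]) (rule bar_est_props(2)[OF assms(1) lam])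
  then have tp: "mse n M u x + mse n M x g + 2 * lam * ?p x \<le> mse n M u g + 2 * lam * ?p g"
    by (simp add: pen_obj_def)
  define X G F0 Ep where "X = fl M h x" and "G = fl M h g" and "F0 = comp_proj M h f0" and "Ep = comp_proj M h eps"
  have m: "mse n M u x = ip B (F0 + Ep - X) (F0 + Ep - X) / ?N" "mse n M u g = ip B (F0 + Ep - G) (F0 + Ep - G) / ?N"
    "mse n M x g = ip B (X - G) (X - G) / ?N" "mse n M u0 x = ip B (F0 - X) (F0 - X) / ?N"
    "mse n M u0 g = ip B (F0 - G) (F0 - G) / ?N"
    using mse_fl[OF assms(1,3)] xb ub assms(4) by (simp_all add: X_def G_def F0_def Ep_def comp_proj_diff(2)[symmetric])
  have "X - G = fl M h (x - g)" by (simp add: X_def G_def fl_linear)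
  have xg: "x - g \<in> bars M" using xb assms(4) bar_space_closed by blast
  have XG: "ip B Ep (X - G) = ip B eps (X - G)"
    unfolding Ep_def \<open>X - G = _\<close> by (rule ip_comp_proj[OF assms(1,3) fl_bar_space[OF assms(1) xg]])
  have D: "?p (x - g) \<le> ?p x + ?p g"
  proof -
    have xdec: "x = (x - g) + g" by simp
    have dx: "DD M x = DD M (x - g) + DD M g"
      using D_set_linear(1)[of M "x - g" g] xdec by simp
    show ?thesis
      unfolding pen_eq sum.distrib[symmetric] by (rule sum_mono) (simp add: dx)
  qed
  have "ip B eps (X - G) \<le> sqrt (noise_energy E eps) * L2_set (X - G) B + ?N * lam * ?p (x - g)"
    using noise_bound[OF assms(1,3) xg] by (simp add: \<open>X - G = _\<close>)
  also have "?N * lam * ?p (x - g) \<le> ?N * lam * (?p x + ?p g)"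
    using D N lam by (intro mult_left_mono) auto
  finally have cross: "ip B eps (X - G) \<le> sqrt (noise_energy E eps) * L2_set (X - G) B + ?N * lam * (?p x + ?p g)"
    by (simp del: minus_apply)
  \<comment> \<open>The arithmetic-geometric inequality with weight 1: the squared norm of
    \<open>X - G\<close> produced here is exactly the one on the left of the two-point
    inequality.\<close>
  have "2 * (sqrt (noise_energy E eps) * L2_set (X - G) B) \<le> noise_energy E eps + ip B (X - G) (X - G)"
  proof -
    have "0 \<le> noise_energy E eps" by (simp add: noise_energy_def sum_nonneg)
    then show ?thesis
      using sum_squares_bound[of "sqrt (noise_energy E eps)" "L2_set (X - G) B"] by (simp add: L2_set_sq)
  qed
  then have "2 * ip B eps (X - G) \<le> noise_energy E eps + ip B (X - G) (X - G) + 2 * ?N * lam * (?p x + ?p g)"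
    using cross by (simp add: algebra_simps)
  moreover
  have "ip B (F0 + Ep - X) (F0 + Ep - X) + ip B (X - G) (X - G) + 2 * ?N * lam * ?p x
     \<le> ip B (F0 + Ep - G) (F0 + Ep - G) + 2 * ?N * lam * ?p g"
  proof -
    have "(ip B (F0 + Ep - X) (F0 + Ep - X) + ip B (X - G) (X - G) + 2 * ?N * lam * ?p x) / ?N
       \<le> (ip B (F0 + Ep - G) (F0 + Ep - G) + 2 * ?N * lam * ?p g) / ?N"
      using tp N unfolding m by (simp add: add_divide_distrib del: minus_apply)
    then show ?thesis using N by (simp only: divide_le_cancel)
  qed
  then have "ip B (F0 - X) (F0 - X) + ip B (X - G) (X - G) + 2 * ?N * lam * ?p x
     \<le> ip B (F0 - G) (F0 - G) + 2 * ip B Ep (X - G) + 2 * ?N * lam * ?p g"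
    by (simp add: ip_simps ip_commute[of B Ep F0] ip_commute[of B X F0] ip_commute[of B X Ep]
        ip_commute[of B G F0] ip_commute[of B G Ep] ip_commute[of B G X])
  \<comment> \<open>The penalty of the fit cancels exactly, since the threshold for the residual
    correlations is \<open>lam\<close> itself; the penalty of \<open>g\<close> arises twice with the
    factor 2, hence the 4.\<close>
  ultimately have "ip B (F0 - X) (F0 - X) \<le> ip B (F0 - G) (F0 - G) + noise_energy E eps + 4 * ?N * lam * ?p g"
    unfolding XG by (simp add: algebra_simps)
  then have "ip B (F0 - X) (F0 - X) / ?N \<le> (ip B (F0 - G) (F0 - G) + noise_energy E eps + 4 * ?N * lam * ?p g) / ?N"
    using N by (simp add: divide_right_mono)
  also have "\<dots> = ip B (F0 - G) (F0 - G) / ?N + noise_energy E eps / ?N + 4 * lam * ?p g"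
    using N by (simp add: add_divide_distrib)
  finally show ?thesis unfolding m(4,5)[symmetric] x_def u0_def .
qed

lemma oracle_component_INF:
  assumes "M \<subseteq> {1..d}" "M \<noteq> {}" "h \<in> h_range d k M" "0 < c" "c \<le> b"
  shows "ip B (est_comp lam M h (f0 + eps) - comp_proj M h f0) (est_comp lam M h (f0 + eps) - comp_proj M h f0) / vol
     \<le> oracle_err d n k M h c f0 + (noise_energy E eps / vol + 4 * lam * b)"
proof -
  let ?N = "vol"
  let ?x = "fit lam M h (f0 + eps)" and ?u0 = "abar M h f0"
  have "ip B (est_comp lam M h (f0 + eps) - comp_proj M h f0) (est_comp lam M h (f0 + eps) - comp_proj M h f0) / ?N = mse n M ?x ?u0"
    using mse_fl[OF assms(1,3) bar_est_props(1)[OF assms(1) lam] anova_bar_props(1)[OF assms(1,3)]]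
      anova_bar_props(2)[OF assms(1,3)] assms(2) by (simp add: est_comp_def)
  also have "\<dots> = mse n M ?u0 ?x" by (simp add: mse_def L2_set_diff_commute)
  also have "\<dots> \<le> oracle_err d n k M h c f0 + (noise_energy E eps / ?N + 4 * lam * b)"
  proof -
    have "mse n M ?u0 ?x - (noise_energy E eps / ?N + 4 * lam * b) \<le> oracle_err d n k M h c f0"
      unfolding oracle_err_def
    proof (rule cINF_greatest)
      show "{g \<in> bars M. pen M g \<le> c} \<noteq> {}"
        using bar_space_closed(4) pen_zero assms(4) by (metis (mono_tags, lifting) empty_iff less_eq_real_def mem_Collect_eq)
      fix g assume g: "g \<in> {g \<in> bars M. pen M g \<le> c}"
      have "4 * lam * pen M g \<le> 4 * lam * b" using g assms lam by simp
      then show "mse n M ?u0 ?x - (noise_energy E eps / ?N + 4 * lam * b) \<le> mse n M ?u0 g"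
        using oracle_component[OF assms(1-3), of g f0] g by auto
    qed
    then show ?thesis by simp
  qed
  finally show ?thesis .
qed

text \<open>Here the space is one-dimensional and \<open>pen {} g\<close> is the modulus t of the
  single coefficient, so the squared error equals \<open>vol\<close> t^2. Then
  \<open>noise_bound\<close> is a quadratic inequality in t, which yields t at most
  \<open>sqrt (noise_energy E eps / vol) + lam\<close>.\<close>

lemma empty_component:
  assumes "h \<in> h_range d k {}"
  shows "ip B (est_comp lam {} h (f0 + eps) - comp_proj {} h f0) (est_comp lam {} h (f0 + eps) - comp_proj {} h f0) / vol
     \<le> 2 * (noise_energy E eps / vol) + 2 * lam\<^sup>2"
proof -
  let ?N = "vol"
  have N: "?N > 0" using numel_pos[of "{1..d}"] by simp
  have M: "{} \<subseteq> {1..d}" by simp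
  obtain q where high_idx: "high_idx {} = {q}" by (auto simp: high_idx_def)
  define g where "g = abar {} h eps"
  have g: "g \<in> bars {}" "fl {} h g = comp_proj {} h eps"
    unfolding g_def by (rule anova_bar_props[OF M assms])+
  let ?V = "comp_proj {} h eps" and ?t = "pen {} g"
  have V: "est_comp lam {} h (f0 + eps) - comp_proj {} h f0 = ?V"
    by (simp add: est_comp_def anova_proj_eq[OF M assms] comp_proj_diff)
  have "ip B ?V ?V = ip B eps ?V" by (intro ip_comp_proj M assms comp_proj_span)
  also have "\<dots> \<le> sqrt (noise_energy E eps) * L2_set ?V B + ?N * lam * ?t"
    using noise_bound[OF M assms g(1)] by (simp add: g(2))
  finally have 1: "ip B ?V ?V \<le> sqrt (noise_energy E eps) * L2_set ?V B + ?N * lam * ?t" .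
  have "ip (ibox n {}) (psis {} q) (psis {} q) = 1"
    unfolding phit_tensor_tens by (subst ip_tens) auto
  moreover have "g = scal (DD {} g q) (psis {} q)"
    using bar_space_expand[OF M g(1)] by (simp add: high_idx)
  ultimately have "ip (ibox n {}) g g = (DD {} g q)\<^sup>2"
    by (metis ip_simps(5,6) mult.right_neutral power2_eq_square)
  then have "ip B ?V ?V = ?N * ?t\<^sup>2"
    using ip_fl[OF M assms g(1) g(1)] by (simp add: g(2) pen_eq high_idx numel_def mult.commute)
  then have V2: "ip B ?V ?V = ?N * ?t\<^sup>2" and L: "L2_set ?V B = sqrt ?N * ?t"
    using pen_nonneg[of "{}" g] by (simp_all add: L2_set_ip real_sqrt_mult)
  have t0: "0 \<le> ?t" by (rule pen_nonneg)
  have tau0: "0 \<le> noise_energy E eps" by (simp add: noise_energy_def sum_nonneg)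
  have "?t \<le> sqrt (noise_energy E eps / ?N) + lam"
  proof (cases "?t = 0")
    case False
    then have t: "?t > 0" using t0 by simp
    have "?N * ?t * ?t \<le> (sqrt (noise_energy E eps) * sqrt ?N + ?N * lam) * ?t"
      using 1 unfolding V2 L by (simp add: power2_eq_square algebra_simps)
    then have "?N * ?t \<le> sqrt (noise_energy E eps) * sqrt ?N + ?N * lam" using t by simp
    also have "sqrt (noise_energy E eps) * sqrt ?N = ?N * sqrt (noise_energy E eps / ?N)"
      using N by (simp add: real_sqrt_divide field_simps)
    finally have "?N * ?t \<le> ?N * (sqrt (noise_energy E eps / ?N) + lam)" by (simp add: algebra_simps)
    then show ?thesis using N by simp
  qed (use tau0 N lam in simp)
  then have "?t\<^sup>2 \<le> (sqrt (noise_energy E eps / ?N) + lam)\<^sup>2" using t0 by (rule power_mono)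
  also have "\<dots> \<le> 2 * (sqrt (noise_energy E eps / ?N))\<^sup>2 + 2 * lam\<^sup>2"
    using sum_squares_bound[of "sqrt (noise_energy E eps / ?N)" lam] by (simp add: power2_sum)
  also have "(sqrt (noise_energy E eps / ?N))\<^sup>2 = noise_energy E eps / ?N" using tau0 N by simp
  finally show ?thesis unfolding V V2 using N by simp
qed

lemma deterministic_bound:
  assumes "\<And>M h. M \<in> Pow {1..d} - {{}} \<Longrightarrow> h \<in> h_range d k M \<Longrightarrow> 0 < c M h \<and> c M h \<le> b" "0 \<le> b"
  shows "mse n {1..d} (tf_estimator d n k (\<lambda>M h. lam) (f0 + eps)) f0
     \<le> (\<Sum>M\<in>Pow {1..d} - {{}}. \<Sum>h\<in>h_range d k M. oracle_err d n k M h (c M h) f0)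
       + real (card comp_index) * (2 * (noise_energy E eps / vol) + 4 * lam * b + 2 * lam\<^sup>2)"
proof -
  let ?N = "vol"
  \<comment> \<open>One remainder for both kinds of component: the factor 2 and \<open>lam\<close>
    squared come from M = {}, the term with \<open>b\<close> from the penalized ones.\<close>
  let ?R = "2 * (noise_energy E eps / ?N) + 4 * lam * b + 2 * lam\<^sup>2"
  let ?v = "\<lambda>M h. ip B (est_comp lam M h (f0 + eps) - comp_proj M h f0) (est_comp lam M h (f0 + eps) - comp_proj M h f0) / ?N"
  let ?o = "\<lambda>M h. if M = {} then 0 else oracle_err d n k M h (c M h) f0"
  have t0: "0 \<le> noise_energy E eps / ?N" by (simp add: noise_energy_def sum_nonneg)
  have b0: "0 \<le> 4 * lam * b" using lam assms(2) by simp
  have "mse n {1..d} (tf_estimator d n k (\<lambda>M h. lam) (f0 + eps)) f0 = (\<Sum>p\<in>comp_index. ?v (fst p) (snd p))"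
    by (simp add: mse_decomp[OF lam] sum_divide_distrib)
  also have "\<dots> \<le> (\<Sum>p\<in>comp_index. ?o (fst p) (snd p) + ?R)"
  proof (rule sum_mono)
    fix p assume p: "p \<in> comp_index"
    obtain M h where p_eq: "p = (M, h)" by fastforce
    have M: "M \<subseteq> {1..d}" "h \<in> h_range d k M" using comp_indexD[OF p] by (simp_all add: p_eq)
    have "?v M h \<le> ?o M h + ?R"
    proof (cases "M = {}")
      case True
      then have e: "?v {} h \<le> 2 * (noise_energy E eps / ?N) + 2 * lam\<^sup>2"
        using empty_component[of h f0] M(2) by simp
      have "?v M h \<le> 0 + ?R" unfolding True using e b0 by linarith
      then show ?thesis using True by simp
    next
      case False
      then have "?v M h \<le> oracle_err d n k M h (c M h) f0 + (noise_energy E eps / ?N + 4 * lam * b)"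
        using assms(1)[of M h] M by (intro oracle_component_INF) auto
      also have "\<dots> \<le> oracle_err d n k M h (c M h) f0 + ?R"
        using t0 zero_le_power2[of lam] by linarith
      finally show ?thesis using False by simp
    qed
    then show "?v (fst p) (snd p) \<le> ?o (fst p) (snd p) + ?R" by (simp only: p_eq fst_conv snd_conv)
  qed
  also have "\<dots> = (\<Sum>p\<in>comp_index. ?o (fst p) (snd p)) + real (card comp_index) * ?R"
    by (subst sum.distrib) simp
  also have "(\<Sum>p\<in>comp_index. ?o (fst p) (snd p)) = (\<Sum>M\<in>Pow {1..d}. \<Sum>h\<in>h_range d k M. ?o M h)"
    by (rule sum_comp_index[symmetric])
  also have "(\<Sum>M\<in>Pow {1..d}. \<Sum>h\<in>h_range d k M. ?o M h)
      = (\<Sum>M\<in>Pow {1..d} - {{}}. \<Sum>h\<in>h_range d k M. ?o M h)"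
    by (rule sum.mono_neutral_right) auto
  also have "\<dots> = (\<Sum>M\<in>Pow {1..d} - {{}}. \<Sum>h\<in>h_range d k M. oracle_err d n k M h (c M h) f0)"
    by (intro sum.cong refl) auto
  finally show ?thesis .
qed

end

end

section \<open>Gaussian noise\<close>

lemma nn_integral_normal_density:
  assumes "0 < s"
  shows "(\<integral>\<^sup>+x. ennreal (normal_density m s x) \<partial>lborel) = 1"
  using assms by (subst nn_integral_eq_integral) auto

lemma normal_exp_nn:
  assumes "0 < s"
  shows "(\<integral>\<^sup>+x. ennreal (normal_density 0 s x) * ennreal (exp (t * x)) \<partial>lborel) = ennreal (exp (s\<^sup>2 * t\<^sup>2 / 2))"
proof -
  have "normal_density 0 s x * exp (t * x) = exp (s\<^sup>2 * t\<^sup>2 / 2) * normal_density (s\<^sup>2 * t) s x" for x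
  proof -
    have "- (x - 0)\<^sup>2 / (2 * s\<^sup>2) + t * x = s\<^sup>2 * t\<^sup>2 / 2 + (- (x - s\<^sup>2 * t)\<^sup>2 / (2 * s\<^sup>2))"
      using assms by (simp add: field_simps power2_eq_square)
    then have "exp (- (x - 0)\<^sup>2 / (2 * s\<^sup>2)) * exp (t * x) = exp (s\<^sup>2 * t\<^sup>2 / 2) * exp (- (x - s\<^sup>2 * t)\<^sup>2 / (2 * s\<^sup>2))"
      by (simp only: exp_add[symmetric])
    then show ?thesis by (simp add: normal_density_def)
  qed
  then have "(\<integral>\<^sup>+x. ennreal (normal_density 0 s x) * ennreal (exp (t * x)) \<partial>lborel)
     = (\<integral>\<^sup>+x. ennreal (exp (s\<^sup>2 * t\<^sup>2 / 2)) * ennreal (normal_density (s\<^sup>2 * t) s x) \<partial>lborel)"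
    by (simp add: ennreal_mult[symmetric])
  also have "\<dots> = ennreal (exp (s\<^sup>2 * t\<^sup>2 / 2))"
    using assms by (subst nn_integral_cmult) (auto simp: nn_integral_normal_density)
  finally show ?thesis .
qed

text \<open>The weight 3/8 turns exp(-x^2 / 2) into exp(-x^2 / 8), the kernel of a normal density of
  standard deviation 2, so the value is exactly 2.\<close>

lemma normal_chi_nn:
  "(\<integral>\<^sup>+x. ennreal (std_normal_density x) * ennreal (exp (3 / 8 * x\<^sup>2)) \<partial>lborel) = 2"
proof -
  have "std_normal_density x * exp (3 / 8 * x\<^sup>2) = 2 * normal_density 0 2 x" for x :: real
  proof -
    have "- x\<^sup>2 / 2 + 3 / 8 * x\<^sup>2 = - x\<^sup>2 / 8" by simp
    then have "exp (- x\<^sup>2 / 2) * exp (3 / 8 * x\<^sup>2) = exp (- x\<^sup>2 / 8)"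
      by (simp only: exp_add[symmetric])
    moreover have sq: "sqrt (2 * pi * 2\<^sup>2) = 2 * sqrt (2 * pi)" by (subst real_sqrt_mult) simp
    have "normal_density 0 2 x = exp (- x\<^sup>2 / 8) / (2 * sqrt (2 * pi))"
      unfolding normal_density_def sq by simp
    moreover have "std_normal_density x = exp (- x\<^sup>2 / 2) / sqrt (2 * pi)"
      by (simp add: normal_density_def)
    ultimately show ?thesis by simp
  qed
  then have "(\<integral>\<^sup>+x. ennreal (std_normal_density x) * ennreal (exp (3 / 8 * x\<^sup>2)) \<partial>lborel)
     = (\<integral>\<^sup>+x. 2 * ennreal (normal_density 0 2 x) \<partial>lborel)"
    by (simp add: ennreal_mult[symmetric] ennreal_mult)
  also have "\<dots> = 2" by (subst nn_integral_cmult) (auto simp: nn_integral_normal_density)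
  finally show ?thesis .
qed

text \<open>Chernoff's bound: Markov's inequality for \<open>exp (f om)\<close>, whose integrability
  is implied by the bound on its nonnegative integral.\<close>

lemma (in prob_space) exp_tail:
  assumes "f \<in> borel_measurable M" "(\<integral>\<^sup>+om. ennreal (exp (f om)) \<partial>M) \<le> ennreal K" "0 \<le> K"
  shows "prob {om \<in> space M. c \<le> f om} \<le> K * exp (- c)"
proof -
  let ?A = "{om \<in> space M. c \<le> f om}"
  have A: "?A \<in> sets M" using assms(1) by measurable
  have "emeasure M ?A = (\<integral>\<^sup>+om. indicator ?A om \<partial>M)" using A by simp
  also have "\<dots> \<le> (\<integral>\<^sup>+om. ennreal (exp (f om)) * ennreal (exp (- c)) \<partial>M)"
  proof (rule nn_integral_mono)
    fix om assume "om \<in> space M"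
    show "indicator ?A om \<le> ennreal (exp (f om)) * ennreal (exp (- c))"
    proof (cases "om \<in> ?A")
      case True
      then have "1 \<le> exp (f om) * exp (- c)" by (simp add: exp_add[symmetric])
      then show ?thesis using True by (simp add: ennreal_mult[symmetric])
    qed simp
  qed
  also have "\<dots> = (\<integral>\<^sup>+om. ennreal (exp (f om)) \<partial>M) * ennreal (exp (- c))"
    using assms(1) by (intro nn_integral_multc) auto
  also have "\<dots> \<le> ennreal K * ennreal (exp (- c))" by (intro mult_right_mono assms) auto
  also have "\<dots> = ennreal (K * exp (- c))" using assms(3) by (simp add: ennreal_mult)
  finally show ?thesis using assms(3) by (simp add: emeasure_eq_measure)
qed

section \<open>Exponential moments and tails of linear and quadratic forms in the noise\<close>

locale gauss = prob_space M for M :: "'w measure" +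
  fixes J :: "idx set" and eps :: "idx \<Rightarrow> 'w \<Rightarrow> real" and sd :: real
  assumes finJ: "finite J" and sd: "0 < sd"
    and indep: "indep_vars (\<lambda>_. borel) eps J"
    and normal: "\<And>j. j \<in> J \<Longrightarrow> distributed M lborel (eps j) (\<lambda>x. ennreal (normal_density 0 sd x))"
begin

abbreviation lin :: "tensor \<Rightarrow> 'w \<Rightarrow> real" where
  "lin v om \<equiv> ip J v (\<lambda>j. eps j om)"

lemma eps_measurable [measurable]: "j \<in> J \<Longrightarrow> eps j \<in> borel_measurable M"
  using distributed_measurable[OF normal] by simp

lemma lin_measurable [measurable]: "(\<lambda>om. lin v om) \<in> borel_measurable M"
  unfolding ip_def by measurable

lemma lin_mgf: "(\<integral>\<^sup>+om. ennreal (exp (lin v om)) \<partial>M) = ennreal (exp (sd\<^sup>2 / 2 * ip J v v))"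
proof -
  have "(\<integral>\<^sup>+om. ennreal (exp (lin v om)) \<partial>M) = (\<integral>\<^sup>+om. (\<Prod>j\<in>J. ennreal (exp (v j * eps j om))) \<partial>M)"
    by (simp add: ip_def exp_sum finJ prod_ennreal)
  also have "\<dots> = (\<Prod>j\<in>J. \<integral>\<^sup>+om. ennreal (exp (v j * eps j om)) \<partial>M)"
    by (intro indep_vars_nn_integral finJ indep_vars_compose2[OF indep]) auto
  also have "\<dots> = (\<Prod>j\<in>J. ennreal (exp (sd\<^sup>2 * (v j)\<^sup>2 / 2)))"
  proof (rule prod.cong[OF refl])
    fix j assume j: "j \<in> J"
    show "(\<integral>\<^sup>+om. ennreal (exp (v j * eps j om)) \<partial>M) = ennreal (exp (sd\<^sup>2 * (v j)\<^sup>2 / 2))"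
      unfolding normal_exp_nn[OF sd, symmetric]
      by (rule distributed_nn_integral[OF normal[OF j], symmetric]) measurable
  qed
  also have "\<dots> = ennreal (exp (sd\<^sup>2 / 2 * ip J v v))"
    by (simp add: prod_ennreal exp_sum[symmetric] finJ ip_def sum_distrib_left power2_eq_square mult.assoc)
  finally show ?thesis .
qed

text \<open>Induction over \<open>E\<close>: the square of a linear form is linearized by an auxiliary standard normal
  variable, so that no rotation invariance of the noise is needed.\<close>

lemma chi_mgf:
  assumes "finite E" "orthonormal J E" "\<And>e. e \<in> E \<Longrightarrow> ip J t e = 0"
  shows "(\<integral>\<^sup>+om. ennreal (exp (3 / (8 * sd\<^sup>2) * (\<Sum>e\<in>E. (lin e om)\<^sup>2) + lin t om)) \<partial>M)
       = ennreal (2 ^ card E * exp (sd\<^sup>2 / 2 * ip J t t))"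
  using assms
proof (induction E arbitrary: t rule: finite_induct)
  case empty
  then show ?case by (simp add: lin_mgf)
next
  case (insert e E)
  \<comment> \<open>Chosen so that averaging exp(a y Z) over a standard normal Z gives exp(3 y^2 /
    (8 sd^2)), the factor belonging to the new vector \<open>e\<close>.\<close>
  define a where "a = sqrt 3 / (2 * sd)"
  have a2: "a\<^sup>2 = 3 / (4 * sd\<^sup>2)" by (simp add: a_def power_divide power_mult_distrib)
  let ?S = "\<lambda>om. 3 / (8 * sd\<^sup>2) * (\<Sum>e\<in>E. (lin e om)\<^sup>2)"
  let ?n = "std_normal_density"
  let ?F = "\<lambda>x om. ennreal (?n x) * ennreal (exp (?S om + lin (t + scal (x * a) e) om))"
  have on: "orthonormal J E" "ip J e e = 1" "\<And>e'. e' \<in> E \<Longrightarrow> ip J e e' = 0"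
    using insert.prems(1) insert.hyps unfolding orthonormal_def by auto
  have te: "ip J t e = 0" "ip J e t = 0" using insert.prems(2)[of e] by (auto simp: ip_commute)
  interpret pair_sigma_finite M lborel ..
  have "(\<integral>\<^sup>+om. ennreal (exp (3 / (8 * sd\<^sup>2) * (\<Sum>e\<in>insert e E. (lin e om)\<^sup>2) + lin t om)) \<partial>M)
     = (\<integral>\<^sup>+om. (\<integral>\<^sup>+x. ?F x om \<partial>lborel) \<partial>M)"
  proof (rule nn_integral_cong)
    fix om
    have "3 / (8 * sd\<^sup>2) * (lin e om)\<^sup>2 = 1\<^sup>2 * (a * lin e om)\<^sup>2 / 2"
      by (simp add: power_mult_distrib a2)
    then have "ennreal (exp (3 / (8 * sd\<^sup>2) * (lin e om)\<^sup>2))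
        = (\<integral>\<^sup>+x. ennreal (?n x) * ennreal (exp (a * lin e om * x)) \<partial>lborel)"
      using normal_exp_nn[of 1 "a * lin e om"] by simp
    then have "ennreal (exp (?S om + lin t om)) * ennreal (exp (3 / (8 * sd\<^sup>2) * (lin e om)\<^sup>2))
        = ennreal (exp (?S om + lin t om)) * (\<integral>\<^sup>+x. ennreal (?n x) * ennreal (exp (a * lin e om * x)) \<partial>lborel)"
      by simp
    also have "\<dots> = (\<integral>\<^sup>+x. ennreal (exp (?S om + lin t om)) * (ennreal (?n x) * ennreal (exp (a * lin e om * x))) \<partial>lborel)"
      by (rule nn_integral_cmult[symmetric]) measurable
    also have "\<dots> = (\<integral>\<^sup>+x. ?F x om \<partial>lborel)"
    proof (rule nn_integral_cong)
      fix x :: real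
      have "exp (?S om + lin t om) * (?n x * exp (a * lin e om * x)) = ?n x * exp (?S om + lin (t + scal (x * a) e) om)"
        by (simp add: ip_simps exp_add ac_simps)
      then show "ennreal (exp (?S om + lin t om)) * (ennreal (?n x) * ennreal (exp (a * lin e om * x)))
         = ?F x om"
        by (simp add: ennreal_mult[symmetric])
    qed
    finally have "ennreal (exp (?S om + lin t om)) * ennreal (exp (3 / (8 * sd\<^sup>2) * (lin e om)\<^sup>2))
       = (\<integral>\<^sup>+x. ?F x om \<partial>lborel)" .
    moreover have "exp (3 / (8 * sd\<^sup>2) * (\<Sum>e\<in>insert e E. (lin e om)\<^sup>2) + lin t om)
       = exp (?S om + lin t om) * exp (3 / (8 * sd\<^sup>2) * (lin e om)\<^sup>2)"
      using insert.hyps by (simp add: exp_add[symmetric] distrib_left)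
    ultimately show "ennreal (exp (3 / (8 * sd\<^sup>2) * (\<Sum>e\<in>insert e E. (lin e om)\<^sup>2) + lin t om))
       = (\<integral>\<^sup>+x. ?F x om \<partial>lborel)"
      by (simp add: ennreal_mult)
  qed
  also have "\<dots> = (\<integral>\<^sup>+x. (\<integral>\<^sup>+om. ?F x om \<partial>M) \<partial>lborel)"
  proof (rule Fubini'[symmetric])
    have eq: "lin (t + scal (x * a) e) om = lin t om + x * a * lin e om" for x om
      by (simp add: ip_simps)
    show "(\<lambda>(om, x). ?F x om)
        \<in> borel_measurable (M \<Otimes>\<^sub>M lborel)"
      unfolding eq by measurable
  qed
  also have "\<dots> = (\<integral>\<^sup>+x. ennreal (2 ^ card E * exp (sd\<^sup>2 / 2 * ip J t t)) * (ennreal (?n x) * ennreal (exp (3 / 8 * x\<^sup>2))) \<partial>lborel)"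
  proof (rule nn_integral_cong)
    fix x :: real
    \<comment> \<open>The linear term shifted along \<open>e\<close> is still orthogonal to
      \<open>E\<close>; to make this step possible the statement carries a general
      \<open>t\<close>.\<close>
    have orth: "ip J (t + scal (x * a) e) e' = 0" if "e' \<in> E" for e'
      using insert.prems(2)[of e'] on(3)[OF that] that by (simp add: ip_simps)
    have "ip J (t + scal (x * a) e) (t + scal (x * a) e) = ip J t t + a\<^sup>2 * x\<^sup>2"
      by (simp add: ip_simps te on(2) power2_eq_square)
    then have ex: "sd\<^sup>2 / 2 * ip J (t + scal (x * a) e) (t + scal (x * a) e) = sd\<^sup>2 / 2 * ip J t t + 3 / 8 * x\<^sup>2"
      using sd by (simp add: a2 field_simps)
    have "(\<integral>\<^sup>+om. ?F x om \<partial>M)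
       = ennreal (?n x) * (\<integral>\<^sup>+om. ennreal (exp (?S om + lin (t + scal (x * a) e) om)) \<partial>M)"
      by (rule nn_integral_cmult) measurable
    also have "(\<integral>\<^sup>+om. ennreal (exp (?S om + lin (t + scal (x * a) e) om)) \<partial>M)
       = ennreal (2 ^ card E * exp (sd\<^sup>2 / 2 * ip J t t + 3 / 8 * x\<^sup>2))"
      by (rule trans[OF insert.IH[OF on(1) orth]]) (simp_all only: ex)
    finally show "(\<integral>\<^sup>+om. ?F x om \<partial>M)
       = ennreal (2 ^ card E * exp (sd\<^sup>2 / 2 * ip J t t)) * (ennreal (?n x) * ennreal (exp (3 / 8 * x\<^sup>2)))"
      by (simp add: ennreal_mult[symmetric] exp_add ac_simps del: plus_fun_apply)
  qed
  also have "\<dots> = ennreal (2 ^ card E * exp (sd\<^sup>2 / 2 * ip J t t)) * 2"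
  proof -
    have meas: "(\<lambda>x. ennreal (?n x) * ennreal (exp (3 / 8 * x\<^sup>2))) \<in> borel_measurable lborel" by measurable
    show ?thesis by (simp only: nn_integral_cmult[OF meas] normal_chi_nn)
  qed
  also have "\<dots> = ennreal (2 ^ card (insert e E) * exp (sd\<^sup>2 / 2 * ip J t t))"
    using insert.hyps by (simp add: ennreal_mult'' ac_simps flip: ennreal_numeral)
  finally show ?case .
qed

text \<open>The exponential moment is 2^m for m = \<open>card E\<close>, and 2 is at most e; so m in
  the threshold offsets the dimension and only exp(-u) is left.\<close>

lemma chi_tail:
  assumes "finite E" "orthonormal J E"
  shows "prob {om \<in> space M. 8 * sd\<^sup>2 / 3 * (real (card E) + u) \<le> (\<Sum>e\<in>E. (lin e om)\<^sup>2)} \<le> exp (- u)"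
proof -
  let ?f = "\<lambda>om. 3 / (8 * sd\<^sup>2) * (\<Sum>e\<in>E. (lin e om)\<^sup>2)"
  have "(\<integral>\<^sup>+om. ennreal (exp (?f om)) \<partial>M) = ennreal (2 ^ card E)"
    using chi_mgf[OF assms, of 0] by (simp add: ip_simps)
  then have "prob {om \<in> space M. real (card E) + u \<le> ?f om} \<le> 2 ^ card E * exp (- (real (card E) + u))"
    by (intro exp_tail) auto
  also have "\<dots> = (2 / exp 1) ^ card E * exp (- u)"
  proof -
    have "exp (- (real (card E) + u)) = exp (- u) / exp (real (card E))"
      by (simp add: exp_diff[symmetric] algebra_simps)
    also have "exp (real (card E)) = exp 1 ^ card E" using exp_of_nat_mult[of "card E" "1::real"] by simp
    finally show ?thesis by (simp add: power_divide)
  qed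
  also have "\<dots> \<le> 1 * exp (- u)"
    using exp_ge_add_one_self[of 1] by (intro mult_right_mono power_le_one) (auto simp: field_simps)
  also have "{om \<in> space M. real (card E) + u \<le> ?f om} = {om \<in> space M. 8 * sd\<^sup>2 / 3 * (real (card E) + u) \<le> (\<Sum>e\<in>E. (lin e om)\<^sup>2)}"
    using sd by (simp add: field_simps)
  finally show ?thesis by simp
qed

text \<open>\<open>w\<close> is a positive bound on the variance rather than the variance itself,
  which covers forms that vanish identically. The exponent is optimized at the scaling x /
  w.\<close>

lemma lin_tail:
  assumes "sd\<^sup>2 * ip J v v \<le> w" "0 < w" "0 \<le> x"
  shows "prob {om \<in> space M. x \<le> \<bar>lin v om\<bar>} \<le> 2 * exp (- (x\<^sup>2 / (2 * w)))"
proof -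
  have one: "prob {om \<in> space M. x \<le> lin v om} \<le> exp (- (x\<^sup>2 / (2 * w)))"
    if v: "sd\<^sup>2 * ip J v v \<le> w" for v
  proof (cases "x = 0")
    case False
    then have x: "0 < x" using assms(3) by simp
    let ?t = "x / w"
    have "sd\<^sup>2 / 2 * ip J (scal t v) (scal t v) = t\<^sup>2 / 2 * (sd\<^sup>2 * ip J v v)" for t
      by (simp add: ip_simps power2_eq_square)
    from this[of ?t] have "sd\<^sup>2 / 2 * ip J (scal ?t v) (scal ?t v) = ?t\<^sup>2 / 2 * (sd\<^sup>2 * ip J v v)" .
    also have "\<dots> \<le> ?t\<^sup>2 / 2 * w" using v by (intro mult_left_mono) auto
    also have "\<dots> = x\<^sup>2 / (2 * w)" using assms(2) by (simp add: power2_eq_square field_simps)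
    finally have "(\<integral>\<^sup>+om. ennreal (exp (lin (scal ?t v) om)) \<partial>M) \<le> ennreal (exp (x\<^sup>2 / (2 * w)))"
      unfolding lin_mgf by (intro ennreal_leI) simp
    then have "prob {om \<in> space M. x\<^sup>2 / w \<le> lin (scal ?t v) om} \<le> exp (x\<^sup>2 / (2 * w)) * exp (- (x\<^sup>2 / w))"
      by (intro exp_tail) auto
    also have "\<dots> = exp (- (x\<^sup>2 / (2 * w)))"
      by (simp add: exp_add[symmetric] field_simps)
    also have "{om \<in> space M. x\<^sup>2 / w \<le> lin (scal ?t v) om} = {om \<in> space M. x \<le> lin v om}"
      using x assms(2) by (auto simp: ip_simps power2_eq_square field_simps)
    finally show ?thesis .
  qed (simp add: prob_le_1)
  have "{om \<in> space M. x \<le> \<bar>lin v om\<bar>} = {om \<in> space M. x \<le> lin v om} \<union> {om \<in> space M. x \<le> lin (- v) om}"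
    by (auto simp: ip_def sum_negf abs_if)
  then have "prob {om \<in> space M. x \<le> \<bar>lin v om\<bar>} \<le> prob {om \<in> space M. x \<le> lin v om} + prob {om \<in> space M. x \<le> lin (- v) om}"
    by (simp only:) (rule measure_Un_le; measurable)
  also have "\<dots> \<le> exp (- (x\<^sup>2 / (2 * w))) + exp (- (x\<^sup>2 / (2 * w)))"
    using assms(1) by (intro add_mono one) (auto simp: ip_def)
  finally show ?thesis by simp
qed

end

text \<open>The Borel sets of \<open>'i \<Rightarrow> real\<close> are of no use here, the index type being uncountable; instead
  \<open>X\<close> is approximated by random vectors with countably many values.\<close>

lemma lipschitz_measurable:
  fixes Phi :: "('i \<Rightarrow> real) \<Rightarrow> real" and X :: "'i \<Rightarrow> 'w \<Rightarrow> real"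
  assumes fin: "finite J" and X: "\<And>j. j \<in> J \<Longrightarrow> X j \<in> borel_measurable M"
    and lip: "\<And>f g. \<bar>Phi f - Phi g\<bar> \<le> K * L2_set (f - g) J" and K: "0 \<le> K"
  shows "(\<lambda>om. Phi (\<lambda>j. X j om)) \<in> borel_measurable M"
proof -
  \<comment> \<open>\<open>I m\<close> rounds the coordinates to a grid of mesh 1 / (m + 1) and
    records the grid point as a tuple of integers; \<open>V m\<close> returns the point.\<close>
  define I where "I m om = (\<lambda>j\<in>J. \<lfloor>real (Suc m) * X j om\<rfloor>)" for m om
  define V where "V m z = (\<lambda>j. if j \<in> J then real_of_int (z j) / real (Suc m) else 0)" for m and z :: "'i \<Rightarrow> int"
  have I: "I m \<in> measurable M (count_space (PiE J (\<lambda>_. UNIV)))" for m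
  proof (subst measurable_count_space_eq_countable)
    show "countable (PiE J (\<lambda>_. UNIV :: int set))" using fin by (intro countable_PiE) auto
    have "I m -` {a} \<inter> space M \<in> sets M" if a: "a \<in> PiE J (\<lambda>_. UNIV)" for a
    proof -
      have "I m -` {a} \<inter> space M = {om \<in> space M. \<forall>j\<in>J. \<lfloor>real (Suc m) * X j om\<rfloor> = a j}"
      proof -
        have "I m om = a \<longleftrightarrow> (\<forall>j\<in>J. \<lfloor>real (Suc m) * X j om\<rfloor> = a j)" for om
          using a by (auto simp: I_def fun_eq_iff PiE_iff extensional_def restrict_def)
        then show ?thesis by auto
      qed
      also have "\<dots> \<in> sets M"
      proof (rule sets.sets_Collect_finite_All[OF _ fin])
        fix j assume j: "j \<in> J"
        have [measurable]: "X j \<in> borel_measurable M" by (rule X[OF j])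
        show "{om \<in> space M. \<lfloor>real (Suc m) * X j om\<rfloor> = a j} \<in> sets M" by measurable
      qed
      finally show ?thesis .
    qed
    then show "I m \<in> space M \<rightarrow> PiE J (\<lambda>_. UNIV) \<and> (\<forall>a\<in>PiE J (\<lambda>_. UNIV). I m -` {a} \<inter> space M \<in> sets M)"
      by (auto simp: I_def)
  qed
  \<comment> \<open>On a countable discrete space every function is measurable, so nothing about a
    sigma-algebra on the domain of \<open>Phi\<close> is required.\<close>
  have meas: "(\<lambda>om. Phi (V m (I m om))) \<in> borel_measurable M" for m
    by (rule measurable_compose[OF I]) simp
  have lim: "(\<lambda>m. Phi (V m (I m om))) \<longlonglongrightarrow> Phi (\<lambda>j. X j om)" for om
  proof -
    have close: "\<bar>(V m (I m om) - (\<lambda>j. X j om)) j\<bar> \<le> 1 / real (Suc m)" if j: "j \<in> J" for m j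
    proof -
      have "(V m (I m om) - (\<lambda>j. X j om)) j = (real_of_int \<lfloor>real (Suc m) * X j om\<rfloor> - real (Suc m) * X j om) / real (Suc m)"
        using j by (simp add: V_def I_def diff_divide_distrib)
      moreover have "\<bar>real_of_int \<lfloor>real (Suc m) * X j om\<rfloor> - real (Suc m) * X j om\<bar> \<le> 1" by linarith
      ultimately show ?thesis by (simp add: divide_right_mono)
    qed
    have bound: "\<bar>Phi (V m (I m om)) - Phi (\<lambda>j. X j om)\<bar> \<le> K * (real (card J) * (1 / real (Suc m)))" for m
    proof -
      have "L2_set (V m (I m om) - (\<lambda>j. X j om)) J \<le> (\<Sum>j\<in>J. \<bar>(V m (I m om) - (\<lambda>j. X j om)) j\<bar>)"
        by (rule L2_set_le_sum_abs)
      also have "\<dots> \<le> real (card J) * (1 / real (Suc m))" by (rule sum_bounded_above) (rule close)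
      finally show ?thesis using lip[of "V m (I m om)" "\<lambda>j. X j om"] K by (meson mult_left_mono order_trans)
    qed
    have "(\<lambda>m. K * (real (card J) * inverse (real (Suc m)))) \<longlonglongrightarrow> K * (real (card J) * 0)"
      by (intro tendsto_mult tendsto_const LIMSEQ_inverse_real_of_nat)
    then have null: "(\<lambda>m. K * (real (card J) * inverse (real (Suc m)))) \<longlonglongrightarrow> 0"
      by (simp only: mult_zero_right)
    have "\<forall>\<^sub>F m in sequentially. norm (Phi (V m (I m om)) - Phi (\<lambda>j. X j om)) \<le> K * (real (card J) * inverse (real (Suc m)))"
      using bound by (intro always_eventually allI) (simp only: real_norm_def inverse_eq_divide)
    then have "(\<lambda>m. Phi (V m (I m om)) - Phi (\<lambda>j. X j om)) \<longlonglongrightarrow> 0"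
      using null by (rule Lim_null_comparison)
    then show ?thesis by (rule LIM_zero_cancel)
  qed
  show ?thesis
    by (rule borel_measurable_LIMSEQ_real[OF lim meas])
qed

section \<open>The hyperbolic cross\<close>

lemma L2_set_tens:
  assumes "finite K"
  shows "L2_set (tens n K f) (ibox n K) = (\<Prod>i\<in>K. L2_set (f i) {1..n i})"
proof -
  have "sqrt (\<Prod>i\<in>K. ip {1..n i} (f i) (f i)) = (\<Prod>i\<in>K. sqrt (ip {1..n i} (f i) (f i)))"
    using assms by (induction K rule: finite_induct) (auto simp: real_sqrt_mult)
  then show ?thesis by (simp add: L2_set_ip ip_tens[OF assms])
qed

definition levels :: "nat \<Rightarrow> nat \<Rightarrow> idx set" where
  "levels d m = PiE {1..d} (\<lambda>_. {..m})"

definition lsum :: "nat \<Rightarrow> idx \<Rightarrow> nat" where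
  "lsum d l = (\<Sum>i\<in>{1..d}. l i)"

lemma finite_levels [simp]: "finite (levels d m)"
  unfolding levels_def by (intro finite_PiE) auto

lemma powr_lsum: "2 powr (c * real (lsum d l)) = (\<Prod>i\<in>{1..d}. 2 powr (c * real (l i)))"
  by (simp add: lsum_def sum_distrib_left powr_sum)

lemma geometric_powr_bound:
  assumes "c < 0"
  shows "(\<Sum>l\<le>m. 2 powr (c * real l)) \<le> 1 / (1 - 2 powr c)"
proof -
  have q: "0 < 2 powr c" "2 powr c < 1" using assms by (auto simp: powr_less_one)
  have "(\<Sum>l\<le>m. 2 powr (c * real l)) = (\<Sum>l<Suc m. (2 powr c) ^ l)"
    by (simp add: powr_powr[symmetric] powr_realpow lessThan_Suc_atMost)
  also have "\<dots> = (1 - (2 powr c) ^ Suc m) / (1 - 2 powr c)"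
    using q minus_divide_divide[of "(2 powr c) ^ Suc m - 1" "2 powr c - 1"]
    by (subst geometric_sum) (auto simp: algebra_simps)
  also have "\<dots> \<le> 1 / (1 - 2 powr c)" using q by (intro divide_right_mono) auto
  finally show ?thesis .
qed

lemma sum_levels_bound:
  assumes "c < 0"
  shows "(\<Sum>l\<in>levels d m. 2 powr (c * real (lsum d l))) \<le> (1 / (1 - 2 powr c)) ^ d"
proof -
  have "(\<Sum>l\<in>levels d m. 2 powr (c * real (lsum d l))) = (\<Prod>i\<in>{1..d}. \<Sum>l\<le>m. 2 powr (c * real l))"
    unfolding powr_lsum levels_def by (rule prod_sum_PiE[symmetric]) auto
  also have "\<dots> \<le> (\<Prod>i\<in>{1..d}. 1 / (1 - 2 powr c))"
    by (intro prod_mono conjI geometric_powr_bound assms sum_nonneg) auto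
  finally show ?thesis by simp
qed

lemma sum_levels_1: "(\<Sum>l\<in>levels 1 m. f (lsum 1 l)) = (\<Sum>x\<le>m. f x :: real)"
proof -
  have "(\<Prod>i\<in>{1::nat}. \<Sum>x\<le>m. f x) = (\<Sum>l\<in>PiE {1::nat} (\<lambda>_. {..m}). \<Prod>i\<in>{1::nat}. f (l i))"
    by (rule prod_sum_PiE[where f = "\<lambda>_. f" and B = "\<lambda>_. {..m}"]) auto
  then show ?thesis by (simp add: levels_def lsum_def)
qed

lemma harm_ge_1: "1 \<le> d \<Longrightarrow> 1 \<le> (harm d :: real)"
  using harm_mono[of 1 d, where ?'a = real] by (simp add: harm_expand One_nat_def)

lemma harm_gt_1:
  assumes "2 \<le> d"
  shows "1 < (harm d :: real)"
proof -
  have "harm 2 \<le> (harm d :: real)" using assms by (rule harm_mono)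
  moreover have "harm 2 = (1 + 1 / 2 :: real)"
    unfolding numeral_2_eq_2 harm_Suc by (simp add: harm_def)
  ultimately show ?thesis by simp
qed

text \<open>For \<open>d \<ge> 2\<close> the cardinality exponent exceeds 1 and the error exponent stays below \<open>g\<close>, which makes
  the sums over all level vectors products of convergent geometric series.\<close>

lemma cross_sums:
  fixes g :: real
  assumes "1 \<le> d" "0 < g"
  shows "\<exists>C\<ge>1. \<forall>m L.
     (\<Sum>l | l \<in> levels d m \<and> lsum d l \<le> L. 2 powr real (lsum d l)) \<le> C * 2 powr (sqrt (harm d) * real L) \<and>
     (\<Sum>l | l \<in> levels d m \<and> L < lsum d l. 2 powr (- g * real (lsum d l))) \<le> C * 2 powr (- (g / sqrt (harm d)) * real L)"
proof (cases "d = 1")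
  case True
  \<comment> \<open>Here H(1) = 1 and the exponents leave no slack, but the sums are plain geometric
    ones: 2 bounds the increasing sum up to L, the other value the decreasing tail.\<close>
  define C where "C = max 2 (1 / (1 - 2 powr (- g)))"
  have "(\<Sum>l | l \<in> levels 1 m \<and> lsum 1 l \<le> L. 2 powr real (lsum 1 l)) \<le> C * 2 powr (real L)" for m L
  proof -
    have "(\<Sum>l | l \<in> levels 1 m \<and> lsum 1 l \<le> L. 2 powr real (lsum 1 l))
       = (\<Sum>l\<in>levels 1 m. if lsum 1 l \<le> L then 2 powr real (lsum 1 l) else 0)"
      by (rule sum.inter_filter) simp
    also have "\<dots> = (\<Sum>x\<le>m. if x \<le> L then 2 powr real x else 0)"
      by (rule sum_levels_1)
    also have "\<dots> = (\<Sum>x | x \<in> {..m} \<and> x \<le> L. 2 powr real x)"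
      by (rule sum.inter_filter[symmetric]) simp
    also have "\<dots> \<le> (\<Sum>x<Suc L. 2 powr real x)"
      by (rule sum_mono2) auto
    also have "\<dots> = 2 ^ Suc L - 1"
      using geometric_sum[of "2::real" "Suc L"] by (simp add: powr_realpow)
    also have "\<dots> \<le> 2 * 2 powr real L" by (simp add: powr_realpow)
    also have "\<dots> \<le> C * 2 powr real L" by (simp add: C_def)
    finally show ?thesis .
  qed
  moreover have "(\<Sum>l | l \<in> levels 1 m \<and> L < lsum 1 l. 2 powr (- g * real (lsum 1 l))) \<le> C * 2 powr (- g * real L)" for m L
  proof -
    have "(\<Sum>l | l \<in> levels 1 m \<and> L < lsum 1 l. 2 powr (- g * real (lsum 1 l)))
       = (\<Sum>l\<in>levels 1 m. if L < lsum 1 l then 2 powr (- g * real (lsum 1 l)) else 0)"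
      by (rule sum.inter_filter) simp
    also have "\<dots> = (\<Sum>x\<le>m. if L < x then 2 powr (- g * real x) else 0)"
      by (rule sum_levels_1)
    also have "\<dots> = (\<Sum>x | x \<in> {..m} \<and> L < x. 2 powr (- g * real x))"
      by (rule sum.inter_filter[symmetric]) simp
    also have "\<dots> \<le> (\<Sum>x\<in>{L..L + m}. 2 powr (- g * real x))"
      by (rule sum_mono2) auto
    also have "\<dots> = (\<Sum>x\<le>m. 2 powr (- g * real L) * 2 powr (- g * real x))"
      by (rule sum.reindex_bij_witness[of _ "\<lambda>x. L + x" "\<lambda>x. x - L"]) (auto simp: powr_add[symmetric] algebra_simps of_nat_diff)
    also have "\<dots> = 2 powr (- g * real L) * (\<Sum>x\<le>m. 2 powr (- g * real x))"
      by (rule sum_distrib_left[symmetric])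
    also have "\<dots> \<le> 2 powr (- g * real L) * (1 / (1 - 2 powr (- g)))"
      using assms(2) by (intro mult_left_mono geometric_powr_bound) auto
    also have "\<dots> \<le> C * 2 powr (- g * real L)"
      unfolding mult.commute[of C] by (intro mult_left_mono) (auto simp: C_def)
    finally show ?thesis .
  qed
  moreover have "harm 1 = (1::real)" by (simp add: harm_expand One_nat_def)
  moreover have "C \<ge> 1" by (simp add: C_def)
  ultimately show ?thesis using True by (intro exI[of _ C]) auto
next
  case False
  \<comment> \<open>Taking the square root makes both inequalities strict, a > 1 and g / a < g,
    while the ratio of the exponents is still g / H(d). The two gaps supply the geometric decay that
    outweighs the number of level vectors with a given sum.\<close>
  define a where "a = sqrt (harm d)"
  have "1 < (harm d :: real)" using False assms(1) by (intro harm_gt_1) simp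
  then have a: "1 < a" by (simp add: a_def)
  define b where "b = g / a"
  have b: "0 < b" "b < g" using a assms(2) by (auto simp: b_def field_simps)
  define C where "C = max 1 (max ((1 / (1 - 2 powr (1 - a))) ^ d) ((1 / (1 - 2 powr (b - g))) ^ d))"
  have "(\<Sum>l | l \<in> levels d m \<and> lsum d l \<le> L. 2 powr real (lsum d l)) \<le> C * 2 powr (a * real L)" for m L
  proof -
    have "(\<Sum>l | l \<in> levels d m \<and> lsum d l \<le> L. 2 powr real (lsum d l))
       \<le> (\<Sum>l | l \<in> levels d m \<and> lsum d l \<le> L. 2 powr (a * real L) * 2 powr ((1 - a) * real (lsum d l)))"
    proof (rule sum_mono)
      fix l assume "l \<in> {l. l \<in> levels d m \<and> lsum d l \<le> L}"
      then have "a * real (lsum d l) \<le> a * real L" using a by simp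
      then have "real (lsum d l) \<le> a * real L + (1 - a) * real (lsum d l)" by (simp add: algebra_simps)
      then show "2 powr real (lsum d l) \<le> 2 powr (a * real L) * 2 powr ((1 - a) * real (lsum d l))"
        by (simp add: powr_add[symmetric])
    qed
    also have "\<dots> \<le> (\<Sum>l\<in>levels d m. 2 powr (a * real L) * 2 powr ((1 - a) * real (lsum d l)))"
      by (rule sum_mono2) auto
    also have "\<dots> = 2 powr (a * real L) * (\<Sum>l\<in>levels d m. 2 powr ((1 - a) * real (lsum d l)))"
      by (rule sum_distrib_left[symmetric])
    also have "\<dots> \<le> 2 powr (a * real L) * C"
      using a by (intro mult_left_mono order_trans[OF sum_levels_bound]) (auto simp: C_def)
    finally show ?thesis by (simp add: mult.commute)
  qed
  moreover have "(\<Sum>l | l \<in> levels d m \<and> L < lsum d l. 2 powr (- g * real (lsum d l))) \<le> C * 2 powr (- b * real L)" for m L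
  proof -
    have "(\<Sum>l | l \<in> levels d m \<and> L < lsum d l. 2 powr (- g * real (lsum d l)))
       \<le> (\<Sum>l | l \<in> levels d m \<and> L < lsum d l. 2 powr (- b * real L) * 2 powr ((b - g) * real (lsum d l)))"
    proof (rule sum_mono)
      fix l assume "l \<in> {l. l \<in> levels d m \<and> L < lsum d l}"
      then have "b * real L \<le> b * real (lsum d l)" using b by simp
      then have "- g * real (lsum d l) \<le> - b * real L + (b - g) * real (lsum d l)" by (simp add: algebra_simps)
      then show "2 powr (- g * real (lsum d l)) \<le> 2 powr (- b * real L) * 2 powr ((b - g) * real (lsum d l))"
        by (simp add: powr_add[symmetric])
    qed
    also have "\<dots> \<le> (\<Sum>l\<in>levels d m. 2 powr (- b * real L) * 2 powr ((b - g) * real (lsum d l)))"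
      by (rule sum_mono2) auto
    also have "\<dots> = 2 powr (- b * real L) * (\<Sum>l\<in>levels d m. 2 powr ((b - g) * real (lsum d l)))"
      by (rule sum_distrib_left[symmetric])
    also have "\<dots> \<le> 2 powr (- b * real L) * C"
      using b by (intro mult_left_mono order_trans[OF sum_levels_bound]) (auto simp: C_def)
    finally show ?thesis by (simp add: mult.commute)
  qed
  moreover have "C \<ge> 1" by (simp add: C_def)
  ultimately show ?thesis unfolding a_def b_def by (intro exI[of _ C]) simp
qed

section \<open>A hyperbolic-cross subspace close to all dictionary tensors\<close>

context box
begin

definition lev_tens :: "idx \<Rightarrow> idx \<Rightarrow> tensor" where
  "lev_tens l p = tens n {1..d} (\<lambda>i. lev_part (n i) k (l i) (p i))"

lemma scal_1 [simp]: "scal 1 f = f"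
  by (simp add: scal_def)

lemma phit_tensor_levels:
  assumes "\<And>i. i \<in> {1..d} \<Longrightarrow> n i \<le> 2 ^ m"
  shows "psi p = (\<Sum>l\<in>levels d m. lev_tens l p)"
proof -
  have "psi p = (\<Sum>l\<in>PiE {1..d} (\<lambda>_. {..m}).
      scal (\<Prod>i\<in>{1..d}. 1) (tens n {1..d} (\<lambda>i. lev_part (n i) k (l i) (p i))))"
    unfolding phit_tensor_tens
  proof (rule tens_sum[where c = "\<lambda>_ _. 1" and v = "\<lambda>i s. lev_part (n i) k s (p i)"])
    fix i assume "i \<in> {1..d}"
    then show "phit (n i) k (p i) = (\<Sum>s\<le>m. scal 1 (lev_part (n i) k s (p i)))"
      using lev_part_sum[of "n i" m k "p i"] assms by simp
  qed auto
  then show ?thesis by (simp add: levels_def lev_tens_def)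
qed

definition lev_tens_gen :: "idx \<Rightarrow> tensor set" where
  "lev_tens_gen l = (\<lambda>w. tens n {1..d} w) ` PiE {1..d} (\<lambda>i. lev_set (n i) k (l i))"

lemma lev_tens_gen_props:
  shows "finite (lev_tens_gen l)" "lev_tens_gen l \<subseteq> supp_on B"
    "real (card (lev_tens_gen l)) \<le> lev_const k ^ d * 2 powr real (lsum d l)"
proof -
  have fin: "finite (PiE {1..d} (\<lambda>i. lev_set (n i) k (l i)))"
    by (intro finite_PiE lev_set_props(1)[OF k1]) auto
  then show "finite (lev_tens_gen l)" by (simp add: lev_tens_gen_def)
  show "lev_tens_gen l \<subseteq> supp_on B" by (auto simp: lev_tens_gen_def tens_supp)
  have "real (card (lev_tens_gen l)) \<le> real (card (PiE {1..d} (\<lambda>i. lev_set (n i) k (l i))))"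
    unfolding lev_tens_gen_def using card_image_le[OF fin] by simp
  also have "\<dots> = (\<Prod>i\<in>{1..d}. real (card (lev_set (n i) k (l i))))"
    by (simp add: card_PiE)
  also have "\<dots> \<le> (\<Prod>i\<in>{1..d}. lev_const k * 2 powr (1 * real (l i)))"
    using lev_set_props(2)[OF k1] by (intro prod_mono) (auto simp: powr_realpow)
  also have "\<dots> = lev_const k ^ d * 2 powr real (lsum d l)"
    unfolding prod.distrib powr_lsum[symmetric] by simp
  finally show "real (card (lev_tens_gen l)) \<le> lev_const k ^ d * 2 powr real (lsum d l)" .
qed

lemma lev_tens_span:
  assumes "p \<in> B"
  shows "lev_tens l p \<in> spn (lev_tens_gen l)"
proof -
  have "lev_tens l p \<in> spn ((\<lambda>q. tens n {1..d} (\<lambda>i. (\<lambda>x. x) (q i))) ` PiE {1..d} (\<lambda>i. lev_set (n i) k (l i)))"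
    unfolding lev_tens_def
  proof (rule tens_span_idx[where v = "\<lambda>_ x. x"])
    fix i assume i: "i \<in> {1..d}"
    show "finite (lev_set (n i) k (l i))" by (rule lev_set_props(1)[OF k1])
    have "p i \<in> {1..n i}" using assms i by (auto simp: ibox_def)
    then show "lev_part (n i) k (l i) (p i) \<in> spn ((\<lambda>x. x) ` lev_set (n i) k (l i))"
      using lev_part_span[OF k1 nk'(1)[OF i]] by simp
  qed simp
  then show ?thesis by (simp add: lev_tens_gen_def)
qed

lemma lev_tens_norm:
  assumes "p \<in> B"
  shows "L2_set (lev_tens l p) B \<le> lev_const k ^ d * sqrt vol * 2 powr (- (real k - 1/2) * real (lsum d l))"
proof -
  have "L2_set (lev_tens l p) B = (\<Prod>i\<in>{1..d}. L2_set (lev_part (n i) k (l i) (p i)) {1..n i})"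
    unfolding lev_tens_def by (rule L2_set_tens) simp
  also have "\<dots> \<le> (\<Prod>i\<in>{1..d}. lev_const k * sqrt (real (n i)) * 2 powr (- (real k - 1/2) * real (l i)))"
  proof (intro prod_mono conjI)
    fix i assume i: "i \<in> {1..d}"
    have "p i \<in> {1..n i}" using assms i by (auto simp: ibox_def)
    then show "L2_set (lev_part (n i) k (l i) (p i)) {1..n i}
        \<le> lev_const k * sqrt (real (n i)) * 2 powr (- (real k - 1/2) * real (l i))"
      using lev_part_norm[OF k1 nk'(1)[OF i]] by simp
  qed simp
  also have "\<dots> = lev_const k ^ d * (\<Prod>i\<in>{1..d}. sqrt (real (n i))) * 2 powr (- (real k - 1/2) * real (lsum d l))"
    unfolding prod.distrib powr_lsum[symmetric] by simp
  also have "(\<Prod>i\<in>{1..d}. sqrt (real (n i))) = sqrt vol"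
  proof -
    have "(\<Prod>i\<in>A. sqrt (real (n i))) = sqrt (\<Prod>i\<in>A. real (n i))" for A
      by (induction A rule: infinite_finite_induct) (auto simp: real_sqrt_mult)
    then show ?thesis by (simp add: numel_def)
  qed
  finally show ?thesis .
qed

lemma cross_space:
  assumes C: "\<And>m L. (\<Sum>l | l \<in> levels d m \<and> lsum d l \<le> L. 2 powr real (lsum d l)) \<le> C * 2 powr (a * real L)"
    "\<And>m L. (\<Sum>l | l \<in> levels d m \<and> L < lsum d l. 2 powr (- (real k - 1/2) * real (lsum d l))) \<le> C * 2 powr (- b * real L)"
  shows "\<exists>E. finite E \<and> orthonormal B E \<and> real (card E) \<le> lev_const k ^ d * C * 2 powr (a * real L) \<and>
     (\<forall>p\<in>B. L2_set (psi p - on_proj B E (psi p)) B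
        \<le> lev_const k ^ d * C * sqrt vol * 2 powr (- b * real L))"
proof -
  let ?K = "lev_const k ^ d"
  have K0: "0 \<le> ?K" using lev_const_ge(2)[of k] by simp
  \<comment> \<open>Any depth with all lengths at most 2^m will do, since the two level sums are
    bounded uniformly in m.\<close>
  define m where "m = (\<Sum>i\<in>{1..d}. n i)"
  have m: "n i \<le> 2 ^ m" if i: "i \<in> {1..d}" for i
  proof -
    have "n i \<le> m" unfolding m_def using i by (intro member_le_sum) auto
    also have "m \<le> 2 ^ m" using less_exp[of m] by simp
    finally show ?thesis .
  qed
  define A where "A = {l. l \<in> levels d m \<and> lsum d l \<le> L}"
  have finA: "finite A" by (simp add: A_def)
  define W where "W = (\<Union>l\<in>A. lev_tens_gen l)"
  have W: "finite W" "W \<subseteq> supp_on B" using lev_tens_gen_props(1,2) finA by (auto simp: W_def)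
  have "card W \<le> (\<Sum>l\<in>A. card (lev_tens_gen l))"
    unfolding W_def by (rule card_UN_le[OF finA])
  then have "real (card W) \<le> (\<Sum>l\<in>A. real (card (lev_tens_gen l)))"
    by (metis of_nat_le_iff of_nat_sum)
  also have "\<dots> \<le> (\<Sum>l\<in>A. ?K * 2 powr real (lsum d l))" by (intro sum_mono lev_tens_gen_props)
  also have "\<dots> = ?K * (\<Sum>l\<in>A. 2 powr real (lsum d l))" by (rule sum_distrib_left[symmetric])
  also have "\<dots> \<le> ?K * (C * 2 powr (a * real L))"
    unfolding A_def by (intro mult_left_mono C K0)
  finally have cardW: "real (card W) \<le> ?K * C * 2 powr (a * real L)" by simp
  obtain E where E: "finite E" "card E \<le> card W" "orthonormal B E" "spn E = spn W"
    using Gram_Schmidt[OF finite_B W] by blast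
  have "L2_set (psi p - on_proj B E (psi p)) B
        \<le> ?K * C * sqrt vol * 2 powr (- b * real L)" if p: "p \<in> B" for p
  proof -
    let ?R = "{l. l \<in> levels d m \<and> L < lsum d l}"
    have "lev_tens l p \<in> spn E" if "l \<in> A" for l
    proof -
      have "spn (lev_tens_gen l) \<subseteq> spn W" using that by (intro fun_vs.span_mono) (auto simp: W_def)
      then show ?thesis using lev_tens_span[OF p] E(4) by blast
    qed
    then have x: "(\<Sum>l\<in>A. lev_tens l p) \<in> spn E" by (rule fun_vs.span_sum)
    have un: "A \<union> ?R = levels d m" by (auto simp: A_def)
    have "(\<Sum>l\<in>A. lev_tens l p) + (\<Sum>l\<in>?R. lev_tens l p) = (\<Sum>l\<in>A \<union> ?R. lev_tens l p)"
      by (rule sum.union_disjoint[symmetric]) (use finA in \<open>auto simp: A_def\<close>)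
    also have "\<dots> = psi p"
      unfolding un by (rule phit_tensor_levels[OF m, symmetric])
    finally have sum_eq: "(\<Sum>l\<in>A. lev_tens l p) + (\<Sum>l\<in>?R. lev_tens l p) = psi p" .
    have diff: "psi p - (\<Sum>l\<in>A. lev_tens l p) = (\<Sum>l\<in>?R. lev_tens l p)"
      unfolding sum_eq[symmetric] by (rule add_diff_cancel_left')
    \<comment> \<open>Discarding all level vectors with sum beyond L gives an approximant in the
      span, and the projection is at least as close.\<close>
    have "L2_set (psi p - on_proj B E (psi p)) B
       \<le> L2_set (psi p - (\<Sum>l\<in>A. lev_tens l p)) B"
      by (rule on_proj_best[OF E(1,3) x])
    also have "\<dots> \<le> (\<Sum>l\<in>?R. L2_set (lev_tens l p) B)" unfolding diff by (rule L2_set_fun_sum)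
    also have "\<dots> \<le> (\<Sum>l\<in>?R. ?K * sqrt vol * 2 powr (- (real k - 1/2) * real (lsum d l)))"
      by (intro sum_mono lev_tens_norm p)
    also have "\<dots> = ?K * sqrt vol * (\<Sum>l\<in>?R. 2 powr (- (real k - 1/2) * real (lsum d l)))"
      by (rule sum_distrib_left[symmetric])
    also have "\<dots> \<le> ?K * sqrt vol * (C * 2 powr (- b * real L))"
      by (intro mult_left_mono C mult_nonneg_nonneg K0) auto
    finally show ?thesis by (simp add: mult_ac)
  qed
  moreover have "real (card E) \<le> ?K * C * 2 powr (a * real L)"
    using E(2) cardW by linarith
  ultimately show ?thesis using E by blast
qed

end

section \<open>The oracle inequality\<close>

text \<open>\<open>X\<close> is both the order of the dimension of \<open>S\<close> and of \<open>N\<close> times the rate.\<close>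

lemma rate_facts:
  fixes N :: nat
  assumes "1 \<le> d" "1 \<le> k" "2 \<le> N"
  defines "H \<equiv> harm d :: real"
  defines "p \<equiv> H / (2 * H + 2 * real k - 1)"
  defines "X \<equiv> (real N * ln (real N)) powr p"
  shows "rate d k N = X / real N" "1 \<le> X" "rate d k N \<le> 1" "ln (real N) \<le> 2 / p * X" "0 < p"
    and "real N * ln (real N) = X powr (2 + (2 * real k - 1) / H)"
proof -
  have H: "1 \<le> H" using harm_ge_1[OF assms(1)] by (simp add: H_def)
  have den: "0 < 2 * H + 2 * real k - 1" using H assms(2) by linarith
  show p0: "0 < p" using H den by (simp add: p_def)
  \<comment> \<open>Together with ln N being at most N this keeps X below N, so that the rate is at
    most 1 and the square of \<open>lam\<close> is of the order of the rate.\<close>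
  have p2: "p \<le> 1 / 2" using H den assms(2) by (simp add: p_def field_simps)
  have N: "2 \<le> real N" using assms(3) by simp
  have ln2: "1 / 2 \<le> ln (real N)"
  proof -
    have "1 / 2 \<le> ln (2::real)" using ln_le_minus_one[of "1 / 2"] by (simp add: ln_div)
    also have "ln 2 \<le> ln (real N)" using N by simp
    finally show ?thesis .
  qed
  have lnN: "ln (real N) \<le> real N" using ln_le_minus_one[of "real N"] N by simp
  have NL: "1 \<le> real N * ln (real N)"
    using mult_mono[OF N ln2] by simp
  have "- ((H + 2 * real k - 1) / (2 * H + 2 * real k - 1)) = p - 1"
    using den by (simp add: p_def field_simps)
  then have "rate d k N = real N powr (p - 1) * ln (real N) powr p"
    by (simp add: rate_def Let_def H_def p_def)
  also have "\<dots> = real N powr p * ln (real N) powr p / real N"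
    using N by (simp add: powr_diff)
  finally show r: "rate d k N = X / real N"
    using N ln2 by (simp add: X_def powr_mult)
  show X1: "1 \<le> X" unfolding X_def using NL p0 by (intro ge_one_powr_ge_zero) auto
  have "X \<le> (real N * real N) powr p"
    unfolding X_def using N ln2 lnN p0 NL by (intro powr_mono2 mult_left_mono) auto
  also have "\<dots> \<le> (real N * real N) powr (1 / 2)"
  proof (rule powr_mono[OF p2])
    show "1 \<le> real N * real N" using mult_mono[OF N N] by simp
  qed
  also have "\<dots> = real N" by (simp add: powr_half_sqrt)
  finally have "X \<le> real N" .
  then show "rate d k N \<le> 1" using N by (simp add: r)
  \<comment> \<open>A lower bound on the logarithmic factor is what allows N^p, and with it ln N, to
    be bounded by a multiple of X; the confidence term of the chi-square tail is thereby
    absorbed.\<close>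
  have "1 / 2 \<le> ln (real N) powr p"
  proof -
    have "1 / 2 = (1 / 2 :: real) powr 1" by simp
    also have "\<dots> \<le> (1 / 2) powr p" using p2 by (intro powr_mono') auto
    also have "\<dots> \<le> ln (real N) powr p" using p0 ln2 by (intro powr_mono2) auto
    finally show ?thesis .
  qed
  then have "real N powr p * (1 / 2) \<le> real N powr p * ln (real N) powr p"
    by (intro mult_left_mono) auto
  also have "\<dots> = X" using N ln2 by (simp add: X_def powr_mult)
  finally have "real N powr p \<le> 2 * X" by simp
  then have "real N powr p / p \<le> 2 * X / p" using p0 by (simp add: divide_right_mono)
  moreover have "ln (real N) \<le> real N powr p / p" using N p0 by (intro ln_powr_bound) auto
  ultimately show "ln (real N) \<le> 2 / p * X" by simp
  have "2 + (2 * real k - 1) / H = 1 / p"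
    using H den by (simp add: p_def field_simps)
  then show "real N * ln (real N) = X powr (2 + (2 * real k - 1) / H)"
    using p0 NL by (simp add: X_def powr_powr)
qed

text \<open>Rounding L up to an integer costs at most the factor 2^a.\<close>

lemma level_choice:
  fixes a Z :: real
  assumes "0 < a" "1 \<le> Z"
  shows "\<exists>L::nat. Z \<le> 2 powr (a * real L) \<and> 2 powr (a * real L) \<le> 2 powr a * Z"
proof -
  define L where "L = nat \<lceil>log 2 Z / a\<rceil>"
  have l0: "0 \<le> log 2 Z / a" using assms by simp
  then have "real L = real_of_int \<lceil>log 2 Z / a\<rceil>" by (simp add: L_def)
  then have "log 2 Z / a \<le> real L" "real L \<le> log 2 Z / a + 1" by linarith+
  then have "log 2 Z \<le> a * real L" "a * real L \<le> a + log 2 Z"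
    using assms(1) by (simp_all add: field_simps)
  then have "2 powr log 2 Z \<le> 2 powr (a * real L)" "2 powr (a * real L) \<le> 2 powr (a + log 2 Z)"
    by simp_all
  then show ?thesis using assms(2) by (intro exI[of _ L]) (simp add: powr_add)
qed

lemma gaussian_noise_gauss:
  assumes "gaussian_noise Om s J eps" "finite J" "0 < s"
  shows "gauss Om J eps s"
proof -
  interpret prob_space Om using assms(1) by (simp add: gaussian_noise_def)
  show ?thesis
    by unfold_locales (use assms in \<open>auto simp: gaussian_noise_def\<close>)
qed

section \<open>The good event and the choice of constants\<close>

context gauss
begin

text \<open>The quadratic form fails with probability at most 1/N, by \<open>chi_tail\<close> at ln
  N. The factor 4 in the variance condition makes the Gaussian exponent 2 ln N, so each of the at
  most N linear forms fails with probability at most 2/N^2. In total this is 3/N.\<close>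

lemma good_event:
  assumes "finite E" "orthonormal J E" "finite P"
    and "\<And>q. q \<in> P \<Longrightarrow> 4 * ln N * (sd\<^sup>2 * ip J (r q) (r q)) \<le> x\<^sup>2"
    and "0 < x" "1 < N" "real (card P) \<le> N"
    and "T \<in> sets M"
    and "\<And>om. om \<in> space M \<Longrightarrow> (\<Sum>e\<in>E. (lin e om)\<^sup>2) \<le> 8 * sd\<^sup>2 / 3 * (real (card E) + ln N) \<Longrightarrow>
           (\<And>q. q \<in> P \<Longrightarrow> \<bar>lin (r q) om\<bar> \<le> x) \<Longrightarrow> om \<in> T"
  shows "1 - 3 / N \<le> prob T"
proof -
  let ?c = "8 * sd\<^sup>2 / 3 * (real (card E) + ln N)"
  define A where "A = {om \<in> space M. ?c \<le> (\<Sum>e\<in>E. (lin e om)\<^sup>2)}"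
  define D where "D q = {om \<in> space M. x \<le> \<bar>lin (r q) om\<bar>}" for q
  have meas: "A \<in> sets M" "\<And>q. D q \<in> sets M" unfolding A_def D_def by measurable
  have lnN: "0 < ln N" using assms(6) by simp
  have pA: "prob A \<le> 1 / N"
    using chi_tail[OF assms(1,2), of "ln N"] assms(6) by (simp add: A_def exp_minus inverse_eq_divide)
  have pD: "prob (D q) \<le> 2 / N\<^sup>2" if q: "q \<in> P" for q
  proof -
    have "prob (D q) \<le> 2 * exp (- (x\<^sup>2 / (2 * (x\<^sup>2 / (4 * ln N)))))"
      unfolding D_def using assms(4)[OF q] lnN assms(5)
      by (intro lin_tail) (auto simp: field_simps)
    also have "x\<^sup>2 / (2 * (x\<^sup>2 / (4 * ln N))) = ln N + ln N"
      using assms(5) lnN by (simp add: field_simps)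
    also have "2 * exp (- (ln N + ln N)) = 2 / N\<^sup>2"
      using assms(6) unfolding exp_minus exp_add by (simp add: power2_eq_square inverse_eq_divide)
    finally show ?thesis .
  qed
  have "prob (A \<union> (\<Union>q\<in>P. D q)) \<le> prob A + prob (\<Union>q\<in>P. D q)"
    using meas assms(3) by (intro measure_Un_le) auto
  also have "prob (\<Union>q\<in>P. D q) \<le> (\<Sum>q\<in>P. prob (D q))"
    using meas assms(3) by (intro measure_UNION_le) auto
  also have "\<dots> \<le> real (card P) * (2 / N\<^sup>2)" by (rule sum_bounded_above) (rule pD)
  also have "\<dots> \<le> N * (2 / N\<^sup>2)" using assms(7) by (intro mult_right_mono) auto
  also have "\<dots> = 2 / N" using assms(6) by (simp add: power2_eq_square)
  finally have bad: "prob (A \<union> (\<Union>q\<in>P. D q)) \<le> 3 / N" using pA by (simp add: add_divide_distrib[symmetric])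
  have "space M - (A \<union> (\<Union>q\<in>P. D q)) \<subseteq> T"
  proof
    fix om assume "om \<in> space M - (A \<union> (\<Union>q\<in>P. D q))"
    then show "om \<in> T" by (intro assms(9)) (auto simp: A_def D_def not_le)
  qed
  then have "prob (space M - (A \<union> (\<Union>q\<in>P. D q))) \<le> prob T"
    using assms(8) by (intro finite_measure_mono) auto
  moreover have "prob (space M - (A \<union> (\<Union>q\<in>P. D q))) = 1 - prob (A \<union> (\<Union>q\<in>P. D q))"
    using meas assms(3) by (intro prob_compl) auto
  ultimately show ?thesis using bad by linarith
qed

end

lemma (in box) numel_ge_2:
  assumes "1 \<le> d"
  shows "2 \<le> numel n {1..d}"
proof -
  have "numel n {1..d} = n 1 * (\<Prod>i\<in>{1..d} - {1}. n i)"
    unfolding numel_def using assms by (intro prod.remove) auto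
  moreover have "1 \<le> (\<Prod>i\<in>{1..d} - {1}. n i)"
    by (rule prod_ge_1) (use nk'(2) in \<open>auto simp: Suc_le_eq One_nat_def\<close>)
  moreover have "2 \<le> n 1" using nk[of 1] k1 assms by auto
  ultimately show ?thesis by (metis mult_le_mono mult_1_right)
qed

text \<open>A set outside the sigma-algebra has \<open>measure\<close> 0, so the lower bound on the
  probability rests on this lemma.\<close>

lemma (in box) mse_estimator_measurable:
  assumes "gauss Om B eps s" "0 < lam"
  shows "(\<lambda>om. mse n {1..d} (tf_estimator d n k (\<lambda>M h. lam) (f0 + (\<lambda>j. eps j om))) f0) \<in> borel_measurable Om"
proof -
  interpret gauss Om B eps s by fact
  have "(\<lambda>om. tf_estimator d n k (\<lambda>M h. lam) (f0 + (\<lambda>j. eps j om)) j) \<in> borel_measurable Om" if j: "j \<in> B" for j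
  proof (rule lipschitz_measurable[where Phi = "\<lambda>f. tf_estimator d n k (\<lambda>M h. lam) (f0 + f) j" and J = B
        and K = "real (card comp_index)"])
    fix f g :: tensor
    have "(f0 + f) - (f0 + g) = f - g" by (simp add: fun_eq_iff)
    then show "\<bar>tf_estimator d n k (\<lambda>M h. lam) (f0 + f) j - tf_estimator d n k (\<lambda>M h. lam) (f0 + g) j\<bar>
       \<le> real (card comp_index) * L2_set (f - g) B"
      using tf_estimator_lipschitz[OF j assms(2), of "f0 + f" "f0 + g"] by (simp del: plus_fun_apply minus_apply)
  qed (use eps_measurable in auto)
  then show ?thesis unfolding mse_ip ip_def by (auto intro!: borel_measurable_sum borel_measurable_times borel_measurable_diff borel_measurable_divide)
qed

definition oracle_event where
  "oracle_event d k Om eps n f0 c lam C = {om \<in> space Om.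
     mse n {1..d} (tf_estimator d n k (\<lambda>M h. lam) (f0 + (\<lambda>j. eps j om))) f0
     \<le> (\<Sum>M\<in>Pow {1..d} - {{}}. \<Sum>h\<in>h_range d k M. oracle_err d n k M h (c M h) f0)
       + C * rate d k (numel n {1..d})}"

lemma box_theorem:
  fixes d k :: nat and sd b1 b2 b :: real
  assumes "1 \<le> d" "1 \<le> k" "0 < sd" "0 < b1" "0 \<le> b"
  shows "\<exists>C2>0. \<forall>(Om :: 'w measure) eps n f0 c lam.
      box d n k \<longrightarrow> gauss Om (ibox n {1..d}) eps sd \<longrightarrow>
      (\<forall>M\<in>Pow {1..d} - {{}}. \<forall>h\<in>h_range d k M. 0 < c M h \<and> c M h \<le> b) \<longrightarrow>
      b1 * rate d k (numel n {1..d}) \<le> lam \<longrightarrow> lam \<le> b2 * rate d k (numel n {1..d}) \<longrightarrow>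
      1 - 3 / real (numel n {1..d}) \<le> measure Om (oracle_event d k Om eps n f0 c lam C2)"
proof -
  define H where "H = (harm d :: real)"
  define g where "g = real k - 1/2"
  define p where "p = H / (2 * H + 2 * real k - 1)"
  have H: "1 \<le> H" using harm_ge_1[OF assms(1)] by (simp add: H_def)
  have g0: "0 < g" using assms(2) by (simp add: g_def)
  obtain C where C: "1 \<le> C"
    "\<And>m L. (\<Sum>l | l \<in> levels d m \<and> lsum d l \<le> L. 2 powr real (lsum d l)) \<le> C * 2 powr (sqrt H * real L)"
    "\<And>m L. (\<Sum>l | l \<in> levels d m \<and> L < lsum d l. 2 powr (- g * real (lsum d l))) \<le> C * 2 powr (- (g / sqrt H) * real L)"
    using cross_sums[OF assms(1) g0] unfolding H_def by blast
  define K where "K = lev_const k ^ d * C"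
  have K: "0 < K" using C(1) lev_const_ge(2)[of k] by (simp add: K_def)
  \<comment> \<open>This is 2 g / H, the exponent with which the squared residuals decay in the
    dimension of the subspace.\<close>
  define t where "t = (2 * real k - 1) / H"
  have t0: "0 < t" using H assms(2) by (simp add: t_def)
  \<comment> \<open>Enlarging the dimension by \<open>A\<close> shrinks the squared residuals by
    A^(-t), which has to outweigh the variance factors relative to the prescribed \<open>b1\<close>;
    the 4 is the one required by \<open>good_event\<close>.\<close>
  define A where "A = max 1 ((4 * sd\<^sup>2 * K\<^sup>2 / b1\<^sup>2) powr (1 / t))"
  have A1: "1 \<le> A" by (simp add: A_def)
  have Apow: "4 * sd\<^sup>2 * K\<^sup>2 \<le> b1\<^sup>2 * A powr t"
  proof -
    have "4 * sd\<^sup>2 * K\<^sup>2 / b1\<^sup>2 = ((4 * sd\<^sup>2 * K\<^sup>2 / b1\<^sup>2) powr (1 / t)) powr t"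
      using t0 by (simp add: powr_powr)
    also have "\<dots> \<le> A powr t" using t0 by (intro powr_mono2) (auto simp: A_def)
    finally show ?thesis using assms(4) by (simp add: field_simps)
  qed
  \<comment> \<open>The chi-square threshold in units of X: the first summand bounds the dimension,
    the second ln N.\<close>
  define Ct where "Ct = 8 * sd\<^sup>2 / 3 * (K * (2 powr sqrt H * A) + 2 / p)"
  \<comment> \<open>The index set of the components depends on d and k only, so its size may enter a
    constant chosen before n. The sign of \<open>b2\<close> is not known at this point, hence the
    absolute value; the 1 ensures positivity.\<close>
  define C2 where "C2 = real (card (box.comp_index d k)) * (2 * Ct + 4 * \<bar>b2\<bar> * b + 2 * b2\<^sup>2) + 1"
  have p0: "0 < p" using rate_facts(5)[OF assms(1,2), of 2] by (simp add: p_def H_def)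
  have Ct0: "0 \<le> Ct" unfolding Ct_def using K A1 p0 by (intro mult_nonneg_nonneg add_nonneg_nonneg) auto
  have C20: "0 < C2" unfolding C2_def using Ct0 assms(5) by (intro add_nonneg_pos mult_nonneg_nonneg add_nonneg_nonneg) auto
  have "1 - 3 / real (numel n {1..d}) \<le> measure Om (oracle_event d k Om eps n f0 c lam C2)"
    if bx: "box d n k" and ga: "gauss Om (ibox n {1..d}) eps sd"
      and c: "\<forall>M\<in>Pow {1..d} - {{}}. \<forall>h\<in>h_range d k M. 0 < c M h \<and> c M h \<le> b"
      and lam1: "b1 * rate d k (numel n {1..d}) \<le> lam" and lam2: "lam \<le> b2 * rate d k (numel n {1..d})"
    for Om :: "'w measure" and eps n f0 c lam
  proof -
    interpret box d n k by fact
    interpret gauss Om "ibox n {1..d}" eps sd by fact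
    define N where "N = real (numel n {1..d})"
    define X where "X = (N * ln N) powr p"
    define rt where "rt = rate d k (numel n {1..d})"
    note rf = rate_facts[OF assms(1,2) numel_ge_2[OF assms(1)], folded H_def N_def, folded p_def, folded X_def rt_def]
    have N2: "2 \<le> N" using numel_ge_2[OF assms(1)] by (simp add: N_def)
    have rt: "rt = X / N" "1 \<le> X" "rt \<le> 1" "ln N \<le> 2 / p * X" "N * ln N = X powr (2 + t)"
      using rf by (simp_all add: t_def)
    have rt0: "0 < rt" using rt N2 by simp
    have lam: "b1 * rt \<le> lam" "lam \<le> b2 * rt" using lam1 lam2 by (simp_all add: rt_def)
    have lam0: "0 < lam" using lam(1) rt0 assms(4) by (meson less_le_trans mult_pos_pos)
    have lnN: "0 < ln N" using N2 by simp
    obtain L :: nat where L: "A * X \<le> 2 powr (sqrt H * real L)" "2 powr (sqrt H * real L) \<le> 2 powr sqrt H * (A * X)"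
      using level_choice[of "sqrt H" "A * X"] H A1 rt(2) mult_mono[OF A1 rt(2)] by auto
    obtain E where E: "finite E" "orthonormal B E" "real (card E) \<le> K * 2 powr (sqrt H * real L)"
      and res: "\<And>q. q \<in> B \<Longrightarrow> L2_set (phit_tensor n k {1..d} q - on_proj B E (phit_tensor n k {1..d} q)) B
           \<le> K * sqrt N * 2 powr (- (g / sqrt H) * real L)"
      using cross_space[OF C(2) C(3)[unfolded g_def], of L] unfolding K_def N_def g_def by blast
    define r where "r q = phit_tensor n k {1..d} q - on_proj B E (phit_tensor n k {1..d} q)" for q
    \<comment> \<open>The defining property of X enters here: the squared residual is at most K^2 N
      (A X)^(-t), and N ln N = X^(2 + t) leaves X^2, to be compared with N lam, which is at least b1
      X.\<close>
    have small: "4 * ln N * (sd\<^sup>2 * ip B (r q) (r q)) \<le> (N * lam)\<^sup>2" if q: "q \<in> B" for q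
    proof -
      have "ip B (r q) (r q) = (L2_set (r q) B)\<^sup>2" by (simp add: L2_set_sq)
      also have "\<dots> \<le> (K * sqrt N * 2 powr (- (g / sqrt H) * real L))\<^sup>2"
        using res[OF q] unfolding r_def by (intro power_mono L2_set_nonneg)
      also have "\<dots> = K\<^sup>2 * N * (2 powr (sqrt H * real L)) powr (- t)"
      proof -
        have "(2 powr (- (g / sqrt H) * real L))\<^sup>2 = 2 powr (2 * (- (g / sqrt H) * real L))"
          by (simp add: power2_eq_square powr_add[symmetric])
        also have "2 * (- (g / sqrt H) * real L) = (sqrt H * real L) * (- t)"
        proof -
          define s where "s = sqrt H"
          have "0 < s" "s * s = H" using H by (simp_all add: s_def)
          then have "t = 2 * g / (s * s)" by (simp add: t_def g_def)
          then have "s * t = 2 * g / s" using \<open>0 < s\<close> by simp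
          then have "(s * t) * real L = 2 * g / s * real L" by simp
          then have "2 * (- (g / s) * real L) = (s * real L) * (- t)" by (simp add: algebra_simps)
          then show ?thesis by (simp only: s_def)
        qed
        finally show ?thesis using N2 by (simp add: power_mult_distrib powr_powr)
      qed
      also have "\<dots> \<le> K\<^sup>2 * N * (A * X) powr (- t)"
        using L(1) A1 rt(2) t0 K N2 by (intro mult_left_mono powr_mono2') auto
      finally have "4 * ln N * (sd\<^sup>2 * ip B (r q) (r q)) \<le> 4 * ln N * (sd\<^sup>2 * (K\<^sup>2 * N * (A * X) powr (- t)))"
        using lnN by (intro mult_left_mono) auto
      also have "\<dots> = (4 * sd\<^sup>2 * K\<^sup>2) * (N * ln N) * (A * X) powr (- t)" by (simp add: mult_ac)
      also have "\<dots> \<le> (b1\<^sup>2 * A powr t) * (N * ln N) * (A * X) powr (- t)"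
        using Apow lnN N2 by (intro mult_right_mono) auto
      also have "\<dots> = b1\<^sup>2 * ((A powr t * A powr (- t)) * (X powr (2 + t) * X powr (- t)))"
        unfolding rt(5) using A1 rt(2) by (simp add: powr_mult mult_ac)
      also have "A powr t * A powr (- t) = 1" using A1 by (simp add: powr_add[symmetric])
      also have "X powr (2 + t) * X powr (- t) = X\<^sup>2"
        using rt(2) by (simp add: powr_add[symmetric] powr_numeral)
      also have "b1\<^sup>2 * (1 * X\<^sup>2) = (b1 * X)\<^sup>2" by (simp add: power_mult_distrib)
      also have "\<dots> \<le> (N * lam)\<^sup>2"
      proof (rule power_mono)
        show "b1 * X \<le> N * lam" using lam(1) N2 unfolding rt(1) by (simp add: field_simps)
      qed (use assms(4) rt(2) in simp)
      finally show ?thesis .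
    qed
    have bound: "mse n {1..d} (tf_estimator d n k (\<lambda>M h. lam) (f0 + (\<lambda>j. eps j om))) f0
          \<le> (\<Sum>M\<in>Pow {1..d} - {{}}. \<Sum>h\<in>h_range d k M. oracle_err d n k M h (c M h) f0) + C2 * rt"
      if ev: "(\<Sum>e\<in>E. (lin e om)\<^sup>2) \<le> 8 * sd\<^sup>2 / 3 * (real (card E) + ln N)"
        "\<And>q. q \<in> B \<Longrightarrow> \<bar>lin (r q) om\<bar> \<le> N * lam" for om
    proof -
      let ?e = "\<lambda>j. eps j om"
      have noise_energy: "noise_energy E ?e = (\<Sum>e\<in>E. (lin e om)\<^sup>2)"
        unfolding noise_energy_def by (intro sum.cong refl) (simp add: ip_commute)
      have "noise_energy E ?e \<le> 8 * sd\<^sup>2 / 3 * (real (card E) + ln N)" unfolding noise_energy by (rule ev(1))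
      also have "\<dots> \<le> 8 * sd\<^sup>2 / 3 * (K * (2 powr sqrt H * (A * X)) + 2 / p * X)"
      proof (intro mult_left_mono add_mono rt(4))
        show "real (card E) \<le> K * (2 powr sqrt H * (A * X))"
          by (rule order_trans[OF E(3) mult_left_mono[OF L(2) less_imp_le[OF K]]])
      qed simp
      also have "\<dots> = Ct * X" by (simp add: Ct_def algebra_simps)
      finally have "noise_energy E ?e / N \<le> Ct * rt" using N2 by (simp add: rt(1) divide_right_mono)
      moreover have "4 * lam * b \<le> 4 * (\<bar>b2\<bar> * rt) * b"
      proof -
        have "lam \<le> \<bar>b2\<bar> * rt" using lam(2) rt0 by (meson abs_ge_self less_imp_le mult_right_mono order_trans)
        then show ?thesis using assms(5) by (intro mult_right_mono) auto
      qed
      moreover have "lam\<^sup>2 \<le> b2\<^sup>2 * rt"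
      proof -
        have "lam\<^sup>2 \<le> (b2 * rt)\<^sup>2" using lam(2) lam0 by (intro power_mono) auto
        also have "\<dots> = b2\<^sup>2 * rt * rt" by (simp add: power2_eq_square)
        also have "\<dots> \<le> b2\<^sup>2 * rt * 1" using rt(3) rt0 by (intro mult_left_mono) auto
        finally show ?thesis by simp
      qed
      ultimately have le: "2 * (noise_energy E ?e / N) + 4 * lam * b + 2 * lam\<^sup>2 \<le> (2 * Ct + 4 * \<bar>b2\<bar> * b + 2 * b2\<^sup>2) * rt"
        by (simp add: algebra_simps)
      have "mse n {1..d} (tf_estimator d n k (\<lambda>M h. lam) (f0 + ?e)) f0
          \<le> (\<Sum>M\<in>Pow {1..d} - {{}}. \<Sum>h\<in>h_range d k M. oracle_err d n k M h (c M h) f0)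
            + real (card comp_index) * (2 * (noise_energy E ?e / real (numel n {1..d})) + 4 * lam * b + 2 * lam\<^sup>2)"
      proof (rule deterministic_bound[OF E(1,2) lam0])
        fix q assume "q \<in> B"
        then show "\<bar>ip B ?e (phit_tensor n k {1..d} q - on_proj B E (phit_tensor n k {1..d} q))\<bar> \<le> real (numel n {1..d}) * lam"
          using ev(2)[of q] unfolding r_def N_def by (subst ip_commute)
      qed (use c assms(5) in auto)
      also have "real (card comp_index) * (2 * (noise_energy E ?e / real (numel n {1..d})) + 4 * lam * b + 2 * lam\<^sup>2)
         \<le> real (card comp_index) * ((2 * Ct + 4 * \<bar>b2\<bar> * b + 2 * b2\<^sup>2) * rt)"
        using le unfolding N_def by (intro mult_left_mono) auto
      also have "\<dots> \<le> C2 * rt" using rt0 by (simp add: C2_def algebra_simps)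
      finally show ?thesis by simp
    qed
    have "1 - 3 / N \<le> prob (oracle_event d k Om eps n f0 c lam C2)"
    proof (rule good_event[OF E(1,2) finite_B small])
      show "0 < N * lam" using N2 lam0 by simp
      show "1 < N" using N2 by simp
      show "real (card B) \<le> N" by (simp add: N_def card_ibox)
      show "oracle_event d k Om eps n f0 c lam C2 \<in> sets Om"
        unfolding oracle_event_def using mse_estimator_measurable[OF ga lam0, of f0] by measurable
    qed (use bound in \<open>auto simp: oracle_event_def rt_def\<close>)
    then show ?thesis by (simp only: N_def)
  qed
  then show ?thesis using C20 by blast
qed

theorem theorem8p2:
  fixes d k :: nat and \<sigma> a1 a2 b1 b2 B :: real
  assumes "1 \<le> d" and "1 \<le> k" and "0 < \<sigma>" and "0 < a1" and "0 < b1"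
  shows "\<exists>C1>0. \<exists>C2>0.
    \<forall>(\<Omega> :: 'w measure) (eps :: idx \<Rightarrow> 'w \<Rightarrow> real) (n :: idx) (f0 :: tensor)
      (c :: nat set \<Rightarrow> idx \<Rightarrow> real) (lam :: real).
      (\<forall>i\<in>{1..d}. k + 1 \<le> n i) \<longrightarrow>
      (\<forall>i\<in>{1..d}. a1 * real (numel n {1..d}) powr (1 / real d) \<le> real (n i) \<and>
                  real (n i) \<le> a2 * real (numel n {1..d}) powr (1 / real d)) \<longrightarrow>
      (\<forall>M\<in>Pow {1..d} - {{}}. \<forall>h\<in>h_range d k M. 0 < c M h \<and> c M h \<le> B) \<longrightarrow>
      b1 * rate d k (numel n {1..d}) \<le> lam \<longrightarrow>
      lam \<le> b2 * rate d k (numel n {1..d}) \<longrightarrow>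
      gaussian_noise \<Omega> \<sigma> (ibox n {1..d}) eps \<longrightarrow>
      measure \<Omega> {\<omega> \<in> space \<Omega>.
          mse n {1..d} (tf_estimator d n k (\<lambda>M h. lam) (\<lambda>j. f0 j + eps j \<omega>)) f0
          \<le> (\<Sum>M\<in>Pow {1..d} - {{}}. \<Sum>h\<in>h_range d k M.
                oracle_err d n k M h (c M h) f0)
            + C2 * rate d k (numel n {1..d})}
        \<ge> 1 - C1 / real (numel n {1..d})"
proof -
  \<comment> \<open>\<open>B\<close> comes without a sign condition, whereas the bound on the
    \<open>c M h\<close> has to be nonnegative in \<open>box_theorem\<close>.\<close>
  obtain C2 where C2: "C2 > 0 \<and> (\<forall>(Om :: 'w measure) eps n f0 c lam.
      box d n k \<longrightarrow> gauss Om (ibox n {1..d}) eps \<sigma> \<longrightarrow>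
      (\<forall>M\<in>Pow {1..d} - {{}}. \<forall>h\<in>h_range d k M. 0 < c M h \<and> c M h \<le> max B 0) \<longrightarrow>
      b1 * rate d k (numel n {1..d}) \<le> lam \<longrightarrow> lam \<le> b2 * rate d k (numel n {1..d}) \<longrightarrow>
      1 - 3 / real (numel n {1..d}) \<le> measure Om (oracle_event d k Om eps n f0 c lam C2))"
    using box_theorem[OF assms(1,2,3,5) max.cobounded2] ..
  note all = C2[THEN conjunct2, THEN spec, THEN spec, THEN spec, THEN spec, THEN spec, THEN spec,
      THEN mp, THEN mp, THEN mp, THEN mp, THEN mp]
  show ?thesis
  proof (rule exI[of _ "3::real"], rule conjI, simp, rule exI[of _ C2], intro conjI allI impI)
    fix \<Omega> :: "'w measure" and eps :: "idx \<Rightarrow> 'w \<Rightarrow> real" and n :: idx and f0 :: tensor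
      and c :: "nat set \<Rightarrow> idx \<Rightarrow> real" and lam :: real
    assume n: "\<forall>i\<in>{1..d}. k + 1 \<le> n i"
      and c: "\<forall>M\<in>Pow {1..d} - {{}}. \<forall>h\<in>h_range d k M. 0 < c M h \<and> c M h \<le> B"
      and lam: "b1 * rate d k (numel n {1..d}) \<le> lam" "lam \<le> b2 * rate d k (numel n {1..d})"
      and noise: "gaussian_noise \<Omega> \<sigma> (ibox n {1..d}) eps"
    have bx: "box d n k" using n assms(2) by unfold_locales auto
    have ga: "gauss \<Omega> (ibox n {1..d}) eps \<sigma>"
      by (rule gaussian_noise_gauss[OF noise finite_ibox assms(3)]) simp
    have c': "\<forall>M\<in>Pow {1..d} - {{}}. \<forall>h\<in>h_range d k M. 0 < c M h \<and> c M h \<le> max B 0"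
      using c by fastforce
    show "measure \<Omega> {\<omega> \<in> space \<Omega>.
          mse n {1..d} (tf_estimator d n k (\<lambda>M h. lam) (\<lambda>j. f0 j + eps j \<omega>)) f0
          \<le> (\<Sum>M\<in>Pow {1..d} - {{}}. \<Sum>h\<in>h_range d k M.
                oracle_err d n k M h (c M h) f0)
            + C2 * rate d k (numel n {1..d})}
        \<ge> 1 - 3 / real (numel n {1..d})"
      using all[OF bx ga c' lam, of f0] by (simp only: oracle_event_def plus_fun_def)
  qed (use C2 in simp_all)
qed

end
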